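(* Let $(A,B,Q,T)$ be an LQ optimal control problem satisfying the Kalman condition, with $T<t^*$, and let $c=c^{0,T}$ be its cost. Let $\mu,\nu\in P_2(\mathbb{R}^n)$, and assume that $\mu(E)=0$ for every $c-c$-hypersurface $E\subset\mathbb{R}^n$. Then there exists a unique optimal transport plan $\alpha\in P_2(\mathbb{R}^n\times\mathbb{R}^n)$ between $\mu$ and $\nu$ for the Kantorovich problem with cost $c$, and it is induced by a map $\mathcal{T}:\mathbb{R}^n\to\mathbb{R}^n$, i.e. $\alpha=(\mathrm{id},\mathcal{T})_\sharp\mu$. In addition, any Kantorovich potential $\psi$ associated with $\alpha$ is $\mu$-almost everywhere differentiable, and $$\mathcal{T}(x)=\exp_{x,T}(\nabla\psi(x))\qquad\text{for }\mu\text{-a.e. }x\in\mathbb{R}^n.$$ If moreover $\mu\ll\mathscr{L}^n$, then $\psi$ is $\mu$-almost everywhere twice differentiable; in particular $\mathcal{T}$ is $\mu$-almost everywhere differentiable.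
   Context: LQ setting: $n,m\in\mathbb N$, $m\le n$, $A\in\mathbb{R}^{n\times n}$, $B\in\mathbb{R}^{n\times m}$ of rank $m$, $Q\in\mathbb{R}^{n\times n}$ symmetric, $T>0$. A curve $\gamma\in\mathcal{C}([t,s],\mathbb{R}^n)$ is admissible if it is absolutely continuous and $\dot\gamma=A\gamma+Bu$ a.e. for some (unique) control $u\in L^2([t,s],\mathbb{R}^m)$. For $0\le t<s\le T$ the LQ action is $\mathcal{A}^{t,s}(\gamma)=\frac12\int_t^s(|u|^2-\gamma^*Q\gamma)\,d\tau$ for admissible $\gamma$ and $+\infty$ otherwise; the LQ cost is $c^{t,s}(x,y)=\inf\{\mathcal{A}^{t,s}(\gamma):\gamma(t)=x,\gamma(s)=y\}$. The Kalman condition is $\mathrm{span}\{A^jb_i: 0\le j\le n-1,\ b_i \text{ columns of } B\}=\mathbb{R}^n$. The LQ Hamiltonian system on $T^*\mathbb{R}^n\cong\mathbb{R}^{2n}$ is $\dot p=-A^*p-Qx$, $\dot x=BB^*p+Ax$. A time $t>0$ is conjugate if a nontrivial solution has $x(0)=x(t)=0$; $t^*\in(0,+\infty]$ denotes the first conjugate time ($+\infty$ if none). The exponential map $\exp_{x,\tau}:\mathbb{R}^n\to\mathbb{R}^n$ sends $p$ to $x(\tau)$, where $(p(\cdot),x(\cdot))$ solves the Hamiltonian system with $(p(0),x(0))=(p,x)$. Optimal transport: $P_2(\mathbb{R}^n)$ is the set of Borel probability measures with finite second moment. A transport plan between $\mu,\nu$ is $\alpha\in P(\mathbb{R}^n\times\mathbb{R}^n)$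 with marginals $\mu,\nu$; it is optimal if it minimizes $\int c\,d\alpha$. A function $\psi:\mathbb{R}^n\to\mathbb{R}\cup\{+\infty\}$, not identically $+\infty$, is $c$-convex if $\psi(x)=\sup\{\lambda-c(x,y):(y,\lambda)\in\mathcal A\}$ for some nonempty $\mathcal A\subset\mathbb{R}^n\times\mathbb{R}$; its $c$-transform is $\psi^c(y)=\inf_x\{\psi(x)+c(x,y)\}$, and $\partial_c\psi=\{(x,y):\psi^c(y)=c(x,y)+\psi(x)\}$. A Kantorovich potential associated with an optimal plan $\alpha$ is a $c$-convex $\psi$ with $\alpha(\partial_c\psi)=1$. A $c-c$-hypersurface is a set which, after permuting coordinates, equals $\{(z,t)\in\mathbb{R}^{n-1}\times\mathbb{R}: t=f(z)-g(z)\}$ for some convex $f,g:\mathbb{R}^{n-1}\to\mathbb{R}$. *)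

theory Defs
  imports "HOL-Analysis.Analysis" "HOL-Probability.Probability"
begin

section \<open>LQ optimal control\<close>

text \<open>Absolute continuity of a curve on [t,s] (epsilon-delta definition).\<close>
definition abs_cont_on :: "real \<Rightarrow> real \<Rightarrow> (real \<Rightarrow> 'a::real_normed_vector) \<Rightarrow> bool" where
  "abs_cont_on t s \<gamma> \<longleftrightarrow>
     (\<forall>\<epsilon>>0. \<exists>\<delta>>0. \<forall>(k::nat) (a::nat \<Rightarrow> real) (b::nat \<Rightarrow> real).
        (\<forall>i<k. t \<le> a i \<and> a i \<le> b i \<and> b i \<le> s) \<and>
        (\<forall>i<k. \<forall>j<k. i \<noteq> j \<longrightarrow> b i \<le> a j \<or> b j \<le> a i) \<and>
        (\<Sum>i<k. b i - a i) < \<delta>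
        \<longrightarrow> (\<Sum>i<k. norm (\<gamma> (b i) - \<gamma> (a i))) < \<epsilon>)"

text \<open>u is an L2 control on [t,s] steering the admissible curve gamma.\<close>
definition LQ_control ::
  "real^'n^'n \<Rightarrow> real^'m^'n \<Rightarrow> real \<Rightarrow> real \<Rightarrow> (real \<Rightarrow> real^'n) \<Rightarrow> (real \<Rightarrow> real^'m) \<Rightarrow> bool" where
  "LQ_control A B t s \<gamma> u \<longleftrightarrow>
     abs_cont_on t s \<gamma> \<and>
     u \<in> borel_measurable (lebesgue_on {t..s}) \<and>
     integrable (lebesgue_on {t..s}) (\<lambda>\<tau>. (norm (u \<tau>))\<^sup>2) \<and>
     (AE \<tau> in lebesgue_on {t..s}.
        (\<gamma> has_vector_derivative (A *v \<gamma> \<tau> + B *v u \<tau>)) (at \<tau> within {t..s}))"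

definition LQ_admissible :: "real^'n^'n \<Rightarrow> real^'m^'n \<Rightarrow> real \<Rightarrow> real \<Rightarrow> (real \<Rightarrow> real^'n) \<Rightarrow> bool" where
  "LQ_admissible A B t s \<gamma> \<longleftrightarrow> (\<exists>u. LQ_control A B t s \<gamma> u)"

text \<open>Value of the action of an admissible curve with its (a.e. unique) control u.\<close>
definition LQ_action_val ::
  "real^'n^'n \<Rightarrow> real \<Rightarrow> real \<Rightarrow> (real \<Rightarrow> real^'n) \<Rightarrow> (real \<Rightarrow> real^'m) \<Rightarrow> real" where
  "LQ_action_val Q t s \<gamma> u =
     (1/2) * integral\<^sup>L (lebesgue_on {t..s}) (\<lambda>\<tau>. (norm (u \<tau>))\<^sup>2 - \<gamma> \<tau> \<bullet> (Q *v \<gamma> \<tau>))"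

text \<open>LQ cost c^{t,s}(x,y): infimum of the action over admissible curves joining x to y
  (non-admissible curves have action +infinity and do not contribute).\<close>
definition LQ_cost ::
  "real^'n^'n \<Rightarrow> real^'m^'n \<Rightarrow> real^'n^'n \<Rightarrow> real \<Rightarrow> real \<Rightarrow> real^'n \<Rightarrow> real^'n \<Rightarrow> real" where
  "LQ_cost A B Q t s x y =
     Inf {LQ_action_val Q t s \<gamma> u | \<gamma> u. LQ_control A B t s \<gamma> u \<and> \<gamma> t = x \<and> \<gamma> s = y}"

definition kalman_condition :: "real^'n^'n \<Rightarrow> real^'m^'n \<Rightarrow> bool" where
  "kalman_condition A B \<longleftrightarrow>
     span {(((*v) A) ^^ j) (column i B) | j i. j \<le> CARD('n) - 1} = UNIV"

text \<open>Solutions of the LQ Hamiltonian system (p(t), x(t)) defined for all times.\<close>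
definition ham_sol ::
  "real^'n^'n \<Rightarrow> real^'m^'n \<Rightarrow> real^'n^'n \<Rightarrow> (real \<Rightarrow> real^'n) \<Rightarrow> (real \<Rightarrow> real^'n) \<Rightarrow> bool" where
  "ham_sol A B Q P X \<longleftrightarrow>
     (\<forall>\<tau>. (P has_vector_derivative (- (transpose A *v P \<tau>) - Q *v X \<tau>)) (at \<tau>) \<and>
          (X has_vector_derivative ((B ** transpose B) *v P \<tau> + A *v X \<tau>)) (at \<tau>))"

definition conjugate_time :: "real^'n^'n \<Rightarrow> real^'m^'n \<Rightarrow> real^'n^'n \<Rightarrow> real \<Rightarrow> bool" where
  "conjugate_time A B Q \<tau> \<longleftrightarrow> \<tau> > 0 \<and>
     (\<exists>P X. ham_sol A B Q P X \<and> X 0 = 0 \<and> X \<tau> = 0 \<and> \<not> (\<forall>r. P r = 0 \<and> X r = 0))"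

text \<open>First conjugate time t* in (0,+infinity], +infinity if there is none.\<close>
definition first_conj_time :: "real^'n^'n \<Rightarrow> real^'m^'n \<Rightarrow> real^'n^'n \<Rightarrow> ereal" where
  "first_conj_time A B Q = Inf (ereal ` {\<tau>. conjugate_time A B Q \<tau>})"

text \<open>Exponential map exp_{x,tau}(p) = x(tau).\<close>
definition LQ_exp ::
  "real^'n^'n \<Rightarrow> real^'m^'n \<Rightarrow> real^'n^'n \<Rightarrow> real^'n \<Rightarrow> real \<Rightarrow> real^'n \<Rightarrow> real^'n" where
  "LQ_exp A B Q x \<tau> p = (THE y. \<exists>P X. ham_sol A B Q P X \<and> P 0 = p \<and> X 0 = x \<and> X \<tau> = y)"

section \<open>Optimal transport\<close>

definition P2 :: "'a::euclidean_space measure \<Rightarrow> bool" where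
  "P2 \<mu> \<longleftrightarrow> prob_space \<mu> \<and> sets \<mu> = sets borel \<and> integrable \<mu> (\<lambda>x. (norm x)\<^sup>2)"

definition transport_plan ::
  "'a::euclidean_space measure \<Rightarrow> 'a measure \<Rightarrow> ('a \<times> 'a) measure \<Rightarrow> bool" where
  "transport_plan \<mu> \<nu> \<alpha> \<longleftrightarrow> prob_space \<alpha> \<and> sets \<alpha> = sets borel \<and>
     distr \<alpha> borel fst = \<mu> \<and> distr \<alpha> borel snd = \<nu>"

definition optimal_plan ::
  "('a::euclidean_space \<Rightarrow> 'a \<Rightarrow> real) \<Rightarrow> 'a measure \<Rightarrow> 'a measure \<Rightarrow> ('a \<times> 'a) measure \<Rightarrow> bool" where
  "optimal_plan c \<mu> \<nu> \<alpha> \<longleftrightarrow> transport_plan \<mu> \<nu> \<alpha> \<and>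
     (\<forall>\<beta>. transport_plan \<mu> \<nu> \<beta> \<longrightarrow>
        integral\<^sup>L \<alpha> (\<lambda>(x,y). c x y) \<le> integral\<^sup>L \<beta> (\<lambda>(x,y). c x y))"

definition c_convex :: "('a \<Rightarrow> 'a \<Rightarrow> real) \<Rightarrow> ('a \<Rightarrow> ereal) \<Rightarrow> bool" where
  "c_convex c \<psi> \<longleftrightarrow> (\<exists>x. \<psi> x \<noteq> \<infinity>) \<and>
     (\<exists>\<A>::('a \<times> real) set. \<A> \<noteq> {} \<and>
        (\<forall>x. \<psi> x = (SUP (y,l)\<in>\<A>. ereal (l - c x y))))"

definition c_transform :: "('a \<Rightarrow> 'a \<Rightarrow> real) \<Rightarrow> ('a \<Rightarrow> ereal) \<Rightarrow> 'a \<Rightarrow> ereal" where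
  "c_transform c \<psi> y = (INF x. \<psi> x + ereal (c x y))"

definition c_subdiff :: "('a \<Rightarrow> 'a \<Rightarrow> real) \<Rightarrow> ('a \<Rightarrow> ereal) \<Rightarrow> ('a \<times> 'a) set" where
  "c_subdiff c \<psi> = {(x,y). c_transform c \<psi> y = ereal (c x y) + \<psi> x}"

text \<open>alpha(partial_c psi) = 1, phrased as: alpha-almost every pair lies in partial_c psi.\<close>
definition kantorovich_potential ::
  "('a::euclidean_space \<Rightarrow> 'a \<Rightarrow> real) \<Rightarrow> ('a \<times> 'a) measure \<Rightarrow> ('a \<Rightarrow> ereal) \<Rightarrow> bool" where
  "kantorovich_potential c \<alpha> \<psi> \<longleftrightarrow> c_convex c \<psi> \<and> (AE z in \<alpha>. z \<in> c_subdiff c \<psi>)"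

text \<open>c-c-hypersurface: after permuting coordinates, the graph t = f(z) - g(z) over R^(n-1),
  f, g convex. Encoded: a distinguished coordinate k, f and g convex and not depending on x$k.\<close>
definition cc_hypersurface :: "(real^'n) set \<Rightarrow> bool" where
  "cc_hypersurface E \<longleftrightarrow> (\<exists>(k::'n) (f::real^'n \<Rightarrow> real) g.
     convex_on UNIV f \<and> convex_on UNIV g \<and>
     (\<forall>x y. (\<forall>i. i \<noteq> k \<longrightarrow> x $ i = y $ i) \<longrightarrow> f x = f y \<and> g x = g y) \<and>
     E = {x. x $ k = f x - g x})"

section \<open>Differentiability of extended-real valued functions\<close>

text \<open>psi is differentiable at x with gradient g (psi is finite near x).\<close>
definition ereal_has_grad :: "('a::real_inner \<Rightarrow> ereal) \<Rightarrow> 'a \<Rightarrow> 'a \<Rightarrow> bool" where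
  "ereal_has_grad \<psi> x g \<longleftrightarrow> (\<exists>f. (\<forall>\<^sub>F z in nhds x. \<psi> z = ereal (f z)) \<and>
      (f has_derivative (\<lambda>h. g \<bullet> h)) (at x))"

definition ereal_differentiable_at :: "('a::real_inner \<Rightarrow> ereal) \<Rightarrow> 'a \<Rightarrow> bool" where
  "ereal_differentiable_at \<psi> x \<longleftrightarrow> (\<exists>g. ereal_has_grad \<psi> x g)"

definition ereal_grad :: "('a::real_inner \<Rightarrow> ereal) \<Rightarrow> 'a \<Rightarrow> 'a" where
  "ereal_grad \<psi> x = (SOME g. ereal_has_grad \<psi> x g)"

text \<open>Twice differentiability at x: second-order Taylor expansion.\<close>
definition ereal_twice_differentiable_at :: "(real^'n \<Rightarrow> ereal) \<Rightarrow> real^'n \<Rightarrow> bool" where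
  "ereal_twice_differentiable_at \<psi> x \<longleftrightarrow> (\<exists>f g (H::real^'n^'n).
      (\<forall>\<^sub>F z in nhds x. \<psi> z = ereal (f z)) \<and>
      (f has_derivative (\<lambda>h. g \<bullet> h)) (at x) \<and>
      ((\<lambda>y. (f y - f x - g \<bullet> (y - x) - (1/2) * ((y - x) \<bullet> (H *v (y - x)))) / (norm (y - x))\<^sup>2)
         \<longlongrightarrow> 0) (at x))"

end

(* Below the first conjugate time the extremals issuing from a point slightly before time 0 form a
   field, so the cost is the quadratic function c(x,y) = x.Gx/2 + y.Hy/2 - x.Ey with E invertible and
   E^-1 p = exp_{0,T}(p). The quadratic terms only see the marginals: a plan is optimal for c iff it
   maximizes the integral of x.Ey, and x |-> psi(x) + x.Gx/2 is convex for every c-convex psi. The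
   supports of all optimal plans together are cyclically monotone, hence lie in the subdifferential
   of one convex f, in the sense that Ey is a subgradient of f at x. The points with several
   subgradients, among them the domain points on the boundary, are covered by countably many
   c-c-hypersurfaces. So mu-almost surely y = E^-1 grad f(x) = exp_{x,T}(grad f(x) - Gx), for the
   same f for all optimal plans. Second order differentiability is Alexandrov's theorem. *)
theory Submission
  imports Defs
begin

text \<open>The convex function f is finite only on a convex set D, while a c-c-hypersurface asks
  for convex functions finite on all of R^(n-1). Subgradients are therefore taken relative to D, and
  the cover restricts to subgradients of norm at most m, for which the suprema of the corresponding
  affine minorants are finite everywhere. Existence of an optimal plan does not pass through weak
  convergence: the values of plans on Borel rectangles are points of a compact product of intervals,
  and regularity of the fixed marginals makes a cluster point countably additive. Alexandrov's
  theorem follows Minty: the inverse of x |-> x + p, p a subgradient at x, is nonexpansive, so that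
  Rademacher's and Sard's theorems apply to it. The Riccati matrix of the extremals issuing from 0
  is singular at their starting time; starting them before time 0 keeps it regular on the closed
  interval [0,T], and the action then exceeds its value along the extremal with the same ends by
  half the integral of a square.\<close>

section \<open>Supporting hyperplanes and subgradients relative to a domain\<close>

lemma supporting_hyperplane_not_interior:
  fixes S :: "'a::euclidean_space set"
  assumes "convex S" "x \<notin> interior S"
  shows "\<exists>a. a \<noteq> 0 \<and> (\<forall>y\<in>S. a \<bullet> x \<le> a \<bullet> y)"
proof (cases "interior S = {}")
  case True
  then obtain a b where ab: "a \<noteq> 0" "S \<subseteq> {x. a \<bullet> x = b}"
    using empty_interior_subset_hyperplane[OF assms(1)] by blast
  \<comment> \<open>All of \<open>S\<close> lies in the hyperplane; the sign of its normal is chosen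
    by the side on which \<open>x\<close> lies.\<close>
  show ?thesis
  proof (cases "a \<bullet> x \<le> b")
    case True
    then show ?thesis using ab by (intro exI[of _ a]) auto
  next
    case False
    then show ?thesis using ab by (intro exI[of _ "-a"]) auto
  qed
next
  case False
  obtain a b where ab: "a \<noteq> 0" "a \<bullet> x \<le> b" "\<forall>y\<in>interior S. b \<le> a \<bullet> y"
    using separating_hyperplane_sets[of "{x}" "interior S"] False assms
    by (auto simp: convex_interior)
  have "closure (interior S) \<subseteq> {y. b \<le> a \<bullet> y}"
    by (rule closure_minimal) (use ab closed_halfspace_ge[of b a] in auto)
  then have "S \<subseteq> {y. b \<le> a \<bullet> y}"
    using convex_closure_interior[OF assms(1) False] closure_subset[of S] by auto
  then show ?thesis using ab by (intro exI[of _ a]) force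
qed

text \<open>The subdifferential of the function equal to \<open>f\<close> on \<open>D\<close> and to
  +infinity elsewhere. Carrying \<open>D\<close> explicitly keeps \<open>f\<close> real-valued; at
  boundary points of a convex \<open>D\<close> the normals of \<open>D\<close> enter the
  set.\<close>

definition subgrad :: "'a::real_inner set \<Rightarrow> ('a \<Rightarrow> real) \<Rightarrow> 'a \<Rightarrow> 'a set" where
  "subgrad D f x = {p. x \<in> D \<and> (\<forall>z\<in>D. f x + p \<bullet> (z - x) \<le> f z)}"

lemma subgrad_le: "p \<in> subgrad D f x \<Longrightarrow> z \<in> D \<Longrightarrow> f x + p \<bullet> (z - x) \<le> f z"
  by (simp add: subgrad_def)

lemma subgrad_dom: "p \<in> subgrad D f x \<Longrightarrow> x \<in> D"
  by (simp add: subgrad_def)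

lemma subgrad_monotone:
  assumes "p \<in> subgrad D f x" "q \<in> subgrad D f y"
  shows "0 \<le> (p - q) \<bullet> (x - y)"
  using subgrad_le[OF assms(1) subgrad_dom[OF assms(2)]]
    subgrad_le[OF assms(2) subgrad_dom[OF assms(1)]]
  by (simp add: inner_diff_left inner_diff_right)

lemma convex_subgrad: "convex (subgrad D f x)"
proof (rule convexI)
  fix p q and u v :: real
  assume p: "p \<in> subgrad D f x" and q: "q \<in> subgrad D f x" and uv: "0 \<le> u" "0 \<le> v" "u + v = 1"
  have "f x + (u *\<^sub>R p + v *\<^sub>R q) \<bullet> (z - x) \<le> f z" if z: "z \<in> D" for z
  proof -
    have "u * (f x + p \<bullet> (z - x)) + v * (f x + q \<bullet> (z - x)) \<le> u * f z + v * f z"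
      by (intro add_mono mult_left_mono subgrad_le[OF p z] subgrad_le[OF q z] uv)
    moreover have "u * f z + v * f z = f z" "u * f x + v * f x = f x"
      using uv by (simp_all add: distrib_right[symmetric])
    ultimately show ?thesis by (simp add: inner_add_left distrib_left)
  qed
  then show "u *\<^sub>R p + v *\<^sub>R q \<in> subgrad D f x" using p by (simp add: subgrad_def)
qed

section \<open>Points with several subgradients\<close>

text \<open>Let \<open>h c\<close> be the supremum of the affine minorants of \<open>f\<close> whose
  slope has k-th component c, with c z_k subtracted; it does not depend on z_k. A subgradient of
  this kind at x gives f(x) = h_c(x) + c x_k. If this happens for both r and s, then x_k = (h_r(x) -
  h_s(x)) / (s - r), a difference of convex functions of the other coordinates.\<close>

lemma two_subgradients_cc_hypersurface:
  fixes f :: "real^'n \<Rightarrow> real"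
  assumes rs: "r < s"
  shows "\<exists>Z. cc_hypersurface Z \<and>
    {x. norm x \<le> m \<and> (\<exists>p\<in>subgrad D f x. norm p \<le> m \<and> p $ k = r) \<and>
        (\<exists>q\<in>subgrad D f x. norm q \<le> m \<and> q $ k = s)} \<subseteq> Z" (is "\<exists>Z. _ \<and> ?E \<subseteq> Z")
proof (cases "?E = {}")
  case True
  \<comment> \<open>If the set is empty, the suprema used below may range over nothing, so an
    arbitrary hypersurface is taken.\<close>
  have "cc_hypersurface {x::real^'n. x $ k = (\<lambda>_. 0) x - (\<lambda>_. 0) x}"
    unfolding cc_hypersurface_def
    by (intro exI[of _ k] exI[of _ "\<lambda>_. 0"]) (auto simp: convex_on_def)
  then show ?thesis using True by blast
next
  case False
  define W where "W c = {(x, p). norm x \<le> m \<and> p \<in> subgrad D f x \<and> norm p \<le> m \<and> p $ k = c}" for c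
  define l where "l c z = (\<lambda>(x, p). f x + p \<bullet> (z - x) - c * z $ k)" for c and z :: "real^'n"
  define h where "h c z = (SUP w\<in>W c. l c z w)" for c z
  obtain x0 where x0: "x0 \<in> ?E" using False by blast
  then have x0D: "x0 \<in> D" and x0m: "norm x0 \<le> m" by (auto dest: subgrad_dom)
  have m0: "0 \<le> m" using x0m norm_ge_zero order_trans by blast
  \<comment> \<open>Rebasing every minorant at one fixed point \<open>x0\<close> of
    \<open>D\<close>, with slopes of norm at most \<open>m\<close>, bounds it at every z, also
    outside \<open>D\<close>.\<close>
  have bdd: "bdd_above (l c z ` W c)" for c z
  proof (rule bdd_aboveI2)
    fix w assume "w \<in> W c"
    then obtain x p where w: "w = (x, p)" "norm x \<le> m" "p \<in> subgrad D f x" "norm p \<le> m"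
      by (auto simp: W_def)
    have "l c z w = f x + p \<bullet> (x0 - x) + p \<bullet> (z - x0) - c * z $ k"
      by (simp add: l_def w inner_diff_right)
    also have "\<dots> \<le> f x0 + norm p * norm (z - x0) - c * z $ k"
      using subgrad_le[OF w(3) x0D] norm_cauchy_schwarz[of p "z - x0"] by simp
    also have "\<dots> \<le> f x0 + m * norm (z - x0) - c * z $ k"
      using w(4) by (simp add: mult_right_mono)
    finally show "l c z w \<le> f x0 + m * norm (z - x0) - c * z $ k" .
  qed
  have ne: "W r \<noteq> {}" "W s \<noteq> {}" using x0 by (auto simp: W_def)
  have convh: "convex_on UNIV (h c)" if "W c \<noteq> {}" for c
  proof (rule convex_onI)
    fix t :: real and x y :: "real^'n" assume t: "0 < t" "t < 1"
    show "h c ((1 - t) *\<^sub>R x + t *\<^sub>R y) \<le> (1 - t) * h c x + t * h c y"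
      unfolding h_def[of c "(1 - t) *\<^sub>R x + t *\<^sub>R y"]
    proof (rule cSUP_least[OF that])
      fix w assume w: "w \<in> W c"
      have "l c ((1 - t) *\<^sub>R x + t *\<^sub>R y) w = (1 - t) * l c x w + t * l c y w"
        by (simp add: l_def inner_add_right inner_diff_right algebra_simps split: prod.split)
      also have "\<dots> \<le> (1 - t) * h c x + t * h c y"
        unfolding h_def by (intro add_mono mult_left_mono cSUP_upper[OF w bdd]) (use t in auto)
      finally show "l c ((1 - t) *\<^sub>R x + t *\<^sub>R y) w \<le> (1 - t) * h c x + t * h c y" .
    qed
  qed simp
  have indep: "h c x = h c y" if "\<forall>i. i \<noteq> k \<longrightarrow> x $ i = y $ i" for c x y
  proof -
    have "l c x w = l c y w" if "w \<in> W c" for w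
    proof -
      obtain u p where w: "w = (u, p)" "p $ k = c" using \<open>w \<in> W c\<close> by (auto simp: W_def)
      have "p \<bullet> x - p \<bullet> y = (\<Sum>i\<in>UNIV. p $ i * (x $ i - y $ i))"
        by (simp add: inner_vec_def sum_subtractf algebra_simps)
      also have "\<dots> = (\<Sum>i\<in>UNIV. if i = k then p $ k * (x $ k - y $ k) else 0)"
        by (rule sum.cong) (use that \<open>\<forall>i. i \<noteq> k \<longrightarrow> x $ i = y $ i\<close> in auto)
      finally show ?thesis by (simp add: l_def w inner_diff_right algebra_simps)
    qed
    then show ?thesis unfolding h_def by (intro SUP_cong) auto
  qed
  have val: "h c x = f x - c * x $ k" if "(x, p) \<in> W c" for c x p
  proof (rule antisym)
    show "h c x \<le> f x - c * x $ k"
      unfolding h_def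
    proof (rule cSUP_least)
      show "W c \<noteq> {}" using that by auto
      fix w assume "w \<in> W c"
      then show "l c x w \<le> f x - c * x $ k"
        using that subgrad_le[of _ D f _ x] by (auto simp: W_def l_def dest: subgrad_dom)
    qed
    have "l c x (x, p) \<le> h c x" unfolding h_def by (rule cSUP_upper[OF that bdd])
    then show "f x - c * x $ k \<le> h c x" by (simp add: l_def)
  qed
  define g where "g c z = inverse (s - r) * h c z" for c z
  have "convex_on UNIV (g r)" "convex_on UNIV (g s)"
    unfolding g_def using rs by (intro convex_on_cmul convh ne; simp)+
  moreover have "\<forall>x y. (\<forall>i. i \<noteq> k \<longrightarrow> x $ i = y $ i) \<longrightarrow> g r x = g r y \<and> g s x = g s y"
    using indep by (metis g_def)
  ultimately have "cc_hypersurface {x. x $ k = g r x - g s x}"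
    unfolding cc_hypersurface_def by blast
  moreover have "?E \<subseteq> {x. x $ k = g r x - g s x}"
  proof
    fix x assume "x \<in> ?E"
    then obtain p q where "(x, p) \<in> W r" "(x, q) \<in> W s" by (auto simp: W_def)
    then have "h r x - h s x = (s - r) * x $ k" by (simp add: val algebra_simps)
    then have "g r x - g s x = inverse (s - r) * ((s - r) * x $ k)"
      by (simp add: g_def right_diff_distrib[symmetric])
    then show "x \<in> {x. x $ k = g r x - g s x}" using rs by simp
  qed
  ultimately show ?thesis by blast
qed

text \<open>Two distinct subgradients differ in some coordinate k. The segment between them consists
  of subgradients, and on it the k-th component takes two rational values r < s; so countably many
  choices of (k, r, s, m) suffice.\<close>

lemma multiple_subgradients_cover:
  fixes f :: "real^'n \<Rightarrow> real"
  shows "\<exists>\<Z>. countable \<Z> \<and> (\<forall>Z\<in>\<Z>. cc_hypersurface Z) \<and>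
    {x. \<exists>p\<in>subgrad D f x. \<exists>q\<in>subgrad D f x. p \<noteq> q} \<subseteq> \<Union>\<Z>"
proof -
  define E where "E = (\<lambda>(k, r, s, m). {x. norm x \<le> real m \<and>
      (\<exists>p\<in>subgrad D f x. norm p \<le> real m \<and> p $ k = r) \<and>
      (\<exists>q\<in>subgrad D f x. norm q \<le> real m \<and> q $ k = s)})"
  define I where "I = {(k::'n, r::real, s::real, m::nat). r \<in> \<rat> \<and> s \<in> \<rat> \<and> r < s}"
  have "\<forall>i\<in>I. \<exists>Z. cc_hypersurface Z \<and> E i \<subseteq> Z"
  proof
    fix i assume "i \<in> I"
    then obtain k r s m where i: "i = (k, r, s, m)" "r < s" by (auto simp: I_def)
    show "\<exists>Z. cc_hypersurface Z \<and> E i \<subseteq> Z"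
      unfolding i(1) E_def prod.case by (rule two_subgradients_cc_hypersurface[OF i(2)])
  qed
  then obtain Z where Z: "\<And>i. i \<in> I \<Longrightarrow> cc_hypersurface (Z i)" "\<And>i. i \<in> I \<Longrightarrow> E i \<subseteq> Z i"
    using bchoice[of I "\<lambda>i Z. cc_hypersurface Z \<and> E i \<subseteq> Z"] by blast
  have "countable ((UNIV::'n set) \<times> \<rat> \<times> \<rat> \<times> (UNIV::nat set))"
    by (intro countable_SIGMA countable_rat) auto
  then have cI: "countable I"
    by (rule countable_subset[rotated]) (auto simp: I_def)
  have *: "\<exists>i\<in>I. x \<in> E i" if pq: "p \<in> subgrad D f x" "q \<in> subgrad D f x" "p \<noteq> q" for x p q
  proof -
    obtain k where "p $ k \<noteq> q $ k" using pq(3) by (auto simp: vec_eq_iff)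
    then have "\<exists>p\<in>subgrad D f x. \<exists>q\<in>subgrad D f x. p $ k < q $ k"
    proof (cases "p $ k < q $ k")
      case False
      then have "q $ k < p $ k" using \<open>p $ k \<noteq> q $ k\<close> by simp
      then show ?thesis using pq by blast
    qed (use pq in blast)
    then obtain p q where pq: "p \<in> subgrad D f x" "q \<in> subgrad D f x" "p $ k < q $ k" by blast
    obtain r where r: "r \<in> \<rat>" "p $ k < r" "r < q $ k" using Rats_dense_in_real[OF pq(3)] by blast
    obtain s where s: "s \<in> \<rat>" "r < s" "s < q $ k" using Rats_dense_in_real[OF r(3)] by blast
    obtain m :: nat where m: "max (norm x) (max (norm p) (norm q)) \<le> real m"
      using real_arch_simple by blast
    have mid: "\<exists>w\<in>subgrad D f x. norm w \<le> real m \<and> w $ k = c" if c: "p $ k \<le> c" "c \<le> q $ k" for c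
    proof -
      define t where "t = (c - p $ k) / (q $ k - p $ k)"
      have t: "0 \<le> t" "t \<le> 1" using pq(3) c by (auto simp: t_def)
      let ?w = "(1 - t) *\<^sub>R p + t *\<^sub>R q"
      have "?w \<in> subgrad D f x" using convexD_alt[OF convex_subgrad pq(1,2) t] .
      moreover have "norm ?w \<le> (1 - t) * norm p + t * norm q"
        using norm_triangle_ineq[of "(1 - t) *\<^sub>R p" "t *\<^sub>R q"] t by simp
      moreover have "\<dots> \<le> (1 - t) * real m + t * real m"
        by (intro add_mono mult_left_mono) (use m t in auto)
      moreover have "?w $ k = c"
      proof -
        have "t * (q $ k - p $ k) = c - p $ k" using pq(3) by (simp add: t_def)
        then show ?thesis by (simp add: algebra_simps)
      qed
      moreover have "(1 - t) * real m + t * real m = real m" by (simp add: algebra_simps)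
      ultimately show ?thesis by (intro bexI[of _ ?w] conjI) linarith+
    qed
    have "(k, r, s, m) \<in> I" using r s by (simp add: I_def)
    moreover have "x \<in> E (k, r, s, m)"
    proof -
      have "norm x \<le> real m" using m by simp
      moreover have "\<exists>w\<in>subgrad D f x. norm w \<le> real m \<and> w $ k = r"
        by (rule mid) (use r s in linarith)+
      moreover have "\<exists>w\<in>subgrad D f x. norm w \<le> real m \<and> w $ k = s"
        by (rule mid) (use r s in linarith)+
      ultimately show ?thesis unfolding E_def prod.case by blast
    qed
    ultimately show ?thesis by blast
  qed
  have "{x. \<exists>p\<in>subgrad D f x. \<exists>q\<in>subgrad D f x. p \<noteq> q} \<subseteq> \<Union>(Z ` I)"
  proof (safe)
    fix x p q assume "p \<in> subgrad D f x" "q \<in> subgrad D f x" "p \<noteq> q"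
    from *[OF this] obtain i where "i \<in> I" "x \<in> E i" by blast
    then show "x \<in> \<Union>(Z ` I)" using Z(2)[of i] by blast
  qed
  then show ?thesis using cI Z(1) by (intro exI[of _ "Z ` I"]) auto
qed

text \<open>Subtracting an inward normal of \<open>D\<close> at \<open>x\<close> from a subgradient
  preserves the inequality on \<open>D\<close>. Thus a unique subgradient forces \<open>x\<close>
  into the interior, and the hypersurfaces that cover multiplicity also cover boundary points with a
  subgradient.\<close>

lemma subgrad_boundary_multiple:
  fixes f :: "'a::euclidean_space \<Rightarrow> real"
  assumes "convex D" "x \<notin> interior D" "p \<in> subgrad D f x"
  shows "\<exists>q\<in>subgrad D f x. p \<noteq> q"
proof -
  obtain a where a: "a \<noteq> 0" "\<forall>y\<in>D. a \<bullet> x \<le> a \<bullet> y"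
    using supporting_hyperplane_not_interior[OF assms(1,2)] by blast
  have "p - a \<in> subgrad D f x"
    unfolding subgrad_def
  proof (safe intro!: subgrad_dom[OF assms(3)])
    fix z assume "z \<in> D"
    then show "f x + (p - a) \<bullet> (z - x) \<le> f z"
      using subgrad_le[OF assms(3), of z] bspec[OF a(2), of z]
      by (simp add: inner_diff_left inner_diff_right)
  qed
  then show ?thesis using a(1) by (intro bexI[of _ "p - a"]) auto
qed

section \<open>Subgradients at interior points\<close>

text \<open>A hyperplane supporting the epigraph at (x, f x). It cannot be vertical: its normal (a,
  0) would make a.z minimal over a neighbourhood of x at the centre x.\<close>

lemma subgrad_interior_nonempty:
  fixes f :: "'a::euclidean_space \<Rightarrow> real"
  assumes f: "convex_on D f" and x: "x \<in> interior D"
  shows "subgrad D f x \<noteq> {}"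
proof -
  define S where "S = {(z, t). z \<in> D \<and> f z \<le> t}"
  have S: "convex S"
    using f unfolding S_def convex_epigraph[symmetric] epigraph_def by (simp add: case_prod_beta')
  have xD: "x \<in> D" using x interior_subset by blast
  have "(x, f x) \<notin> interior S"
  proof
    assume "(x, f x) \<in> interior S"
    then obtain e where e: "e > 0" "ball (x, f x) e \<subseteq> S" by (auto simp: mem_interior)
    have "(x, f x - e/2) \<in> ball (x, f x) e" using e(1) by (simp add: dist_Pair_Pair dist_real_def)
    then show False using e by (auto simp: S_def)
  qed
  from supporting_hyperplane_not_interior[OF S this]
  obtain c where c: "c \<noteq> 0" "\<forall>y\<in>S. c \<bullet> (x, f x) \<le> c \<bullet> y" by blast
  obtain a b where cab: "c = (a, b)" by (cases c)
  have ab: "(a, b) \<noteq> 0" "\<And>z t. z \<in> D \<Longrightarrow> f z \<le> t \<Longrightarrow> a \<bullet> x + b * f x \<le> a \<bullet> z + b * t"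
    using c(1) bspec[OF c(2), of "(_, _)"] by (simp_all add: cab S_def)
  have b0: "0 \<le> b" using ab(2)[OF xD, of "f x + 1"] by (simp add: distrib_left)
  have "b \<noteq> 0"
  proof
    assume b: "b = 0"
    then have a: "a \<noteq> 0" using ab(1) by (simp add: zero_prod_def)
    obtain e where e: "e > 0" "ball x e \<subseteq> D" using x by (auto simp: mem_interior)
    let ?z = "x - (e / (2 * norm a)) *\<^sub>R a"
    have "?z \<in> ball x e" using e a by (simp add: dist_norm)
    then have "?z \<in> D" using e by blast
    then have "a \<bullet> x \<le> a \<bullet> ?z" using ab(2)[of ?z "f ?z"] b by simp
    then have "(e / (2 * norm a)) * (a \<bullet> a) \<le> 0" by (simp add: inner_diff_right)
    moreover have "0 < (e / (2 * norm a)) * (a \<bullet> a)" using e a by simp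
    ultimately show False by linarith
  qed
  then have b: "b > 0" using b0 by simp
  have "(- (1/b)) *\<^sub>R a \<in> subgrad D f x"
    unfolding subgrad_def
  proof (safe intro!: xD)
    fix z assume z: "z \<in> D"
    have "a \<bullet> x + b * f x \<le> a \<bullet> z + b * f z" using ab(2)[OF z] by simp
    then have "(1/b) * (a \<bullet> x + b * f x) \<le> (1/b) * (a \<bullet> z + b * f z)"
      using b by (intro mult_left_mono) auto
    then show "f x + (- (1/b)) *\<^sub>R a \<bullet> (z - x) \<le> f z"
      using b by (simp add: inner_diff_right algebra_simps)
  qed
  then show ?thesis by blast
qed

text \<open>Moving from y by the length e/2 in the direction of p raises f by at least (e/2)|p|,
  while f varies by at most 2M on the ball of radius e; hence the constant 4M/e.\<close>

lemma subgrad_locally_bounded: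
  fixes f :: "'a::euclidean_space \<Rightarrow> real"
  assumes f: "convex_on D f" and x: "x \<in> interior D"
  obtains d K where "d > 0" "ball x d \<subseteq> interior D"
    "\<And>y p. y \<in> ball x d \<Longrightarrow> p \<in> subgrad D f y \<Longrightarrow> norm p \<le> K"
proof -
  obtain e where e: "e > 0" "cball x e \<subseteq> interior D"
    using x open_contains_cball[of "interior D"] by auto
  have "continuous_on (interior D) f"
    by (rule convex_on_continuous)
      (auto intro: convex_on_subset[OF f interior_subset] convex_interior convex_on_imp_convex[OF f])
  then have "compact (f ` cball x e)"
    by (intro compact_continuous_image continuous_on_subset[OF _ e(2)]) auto
  then obtain M where M: "\<And>y. y \<in> cball x e \<Longrightarrow> \<bar>f y\<bar> \<le> M"
    by (meson bounded_real compact_imp_bounded imageI)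
  have "norm p \<le> 4 * M / e" if y: "y \<in> ball x (e/2)" and p: "p \<in> subgrad D f y" for y p
  proof (cases "p = 0")
    case True
    have "0 \<le> M" using M[of x] e by (simp add: order_trans[OF abs_ge_zero])
    then show ?thesis using True e by simp
  next
    case False
    let ?z = "y + (e / (2 * norm p)) *\<^sub>R p"
    have "dist x ?z \<le> dist x y + dist y ?z" by (rule dist_triangle)
    also have "dist y ?z = e/2" using False e by (simp add: dist_norm)
    finally have z: "?z \<in> cball x e" using y by simp
    have yc: "y \<in> cball x e" using y e by simp
    have "?z \<in> D" using z e interior_subset by blast
    from subgrad_le[OF p this] have "(e / (2 * norm p)) * (p \<bullet> p) \<le> f ?z - f y" by simp
    also have "\<dots> \<le> 2 * M" using M[OF z] M[OF yc] by linarith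
    finally have "(e/2) * norm p \<le> 2 * M" using False by (simp add: dot_square_norm power2_eq_square)
    then show ?thesis using e by (simp add: field_simps)
  qed
  moreover have "ball x (e/2) \<subseteq> interior D"
    using e by (auto simp: subset_iff)
  ultimately show ?thesis using that[of "e/2" "4 * M / e"] e by simp
qed

lemma subgrad_closed:
  fixes f :: "'a::euclidean_space \<Rightarrow> real"
  assumes f: "convex_on D f" and x: "x \<in> interior D"
    and X: "X \<longlonglongrightarrow> x" "P \<longlonglongrightarrow> p" "\<And>n. P n \<in> subgrad D f (X n)"
  shows "p \<in> subgrad D f x"
  unfolding subgrad_def
proof (safe)
  show "x \<in> D" using x interior_subset by blast
  have "continuous_on (interior D) f"
    by (rule convex_on_continuous) (auto intro: convex_on_subset[OF f interior_subset] convex_interior convex_on_imp_convex[OF f])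
  then have "isCont f x" using x by (simp add: continuous_on_eq_continuous_at)
  then have fX: "(\<lambda>n. f (X n)) \<longlonglongrightarrow> f x" using X(1) by (rule isCont_tendsto_compose)
  fix z assume "z \<in> D"
  then have "\<And>n. f (X n) + P n \<bullet> (z - X n) \<le> f z" using X(3) subgrad_le by blast
  moreover have "(\<lambda>n. f (X n) + P n \<bullet> (z - X n)) \<longlonglongrightarrow> f x + p \<bullet> (z - x)"
    by (intro tendsto_intros fX X)
  ultimately show "f x + p \<bullet> (z - x) \<le> f z"
    by (intro LIMSEQ_le_const2) auto
qed

text \<open>Upper semicontinuity by compactness: subgradients at points tending to \<open>x\<close>
  are bounded, and a subsequential limit is a subgradient at \<open>x\<close>, hence equals
  \<open>p\<close>.\<close>

lemma unique_subgrad_continuous: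
  fixes f :: "'a::euclidean_space \<Rightarrow> real"
  assumes f: "convex_on D f" and x: "x \<in> interior D" and p: "subgrad D f x = {p}" and e: "e > 0"
  shows "\<exists>d>0. \<forall>y\<in>ball x d. \<forall>q\<in>subgrad D f y. norm (q - p) < e"
proof (rule ccontr)
  assume neg: "\<not> ?thesis"
  obtain d K where dK: "d > 0" "ball x d \<subseteq> interior D"
    "\<And>y p. y \<in> ball x d \<Longrightarrow> p \<in> subgrad D f y \<Longrightarrow> norm p \<le> K"
    using subgrad_locally_bounded[OF f x] by blast
  have "\<exists>w. fst w \<in> ball x (min d (1 / Suc n)) \<and> snd w \<in> subgrad D f (fst w) \<and> e \<le> norm (snd w - p)"
    for n
  proof -
    have "min d (1 / real (Suc n)) > 0" using dK(1) by simp
    then have "\<not> (\<forall>y\<in>ball x (min d (1 / real (Suc n))). \<forall>q\<in>subgrad D f y. norm (q - p) < e)"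
      using neg by blast
    then obtain y q where "y \<in> ball x (min d (1 / real (Suc n)))" "q \<in> subgrad D f y"
      "\<not> norm (q - p) < e" by blast
    then show ?thesis by (intro exI[of _ "(y, q)"]) (simp add: not_less)
  qed
  then obtain w where w: "\<And>n. fst (w n) \<in> ball x (min d (1 / Suc n)) \<and>
      snd (w n) \<in> subgrad D f (fst (w n)) \<and> e \<le> norm (snd (w n) - p)"
    by metis
  define Y where "Y n = fst (w n)" for n
  define R where "R n = snd (w n)" for n
  have YR: "\<And>n. Y n \<in> ball x (min d (1 / Suc n))"
    "\<And>n. R n \<in> subgrad D f (Y n)" "\<And>n. e \<le> norm (R n - p)" using w by (auto simp: Y_def R_def)
  have "(\<lambda>n. dist (Y n) x) \<longlonglongrightarrow> 0"
  proof (rule tendsto_sandwich[OF _ _ tendsto_const LIMSEQ_inverse_real_of_nat])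
    show "\<forall>\<^sub>F n in sequentially. dist (Y n) x \<le> inverse (real (Suc n))"
    proof (intro always_eventually allI)
      fix n show "dist (Y n) x \<le> inverse (real (Suc n))"
        using YR(1)[of n] by (simp add: dist_commute inverse_eq_divide)
    qed
  qed auto
  then have Yx: "Y \<longlonglongrightarrow> x" by (rule tendsto_dist_iff[THEN iffD2])
  have "R n \<in> cball 0 K" for n using dK(3)[OF _ YR(2)] YR(1)[of n] by simp
  then obtain l r where l: "strict_mono (r :: nat \<Rightarrow> nat)" "(R \<circ> r) \<longlonglongrightarrow> l"
    using seq_compactE[OF compact_imp_seq_compact[OF compact_cball]] by metis
  have "l \<in> subgrad D f x"
    using YR(2) by (intro subgrad_closed[OF f x LIMSEQ_subseq_LIMSEQ[OF Yx l(1)] l(2)]) simp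
  then have "l = p" using p by simp
  moreover have "e \<le> norm (l - p)"
    by (rule LIMSEQ_le_const[OF tendsto_norm[OF tendsto_diff[OF l(2) tendsto_const]]])
      (use YR(3) in auto)
  ultimately show False using e by simp
qed

text \<open>The error f y - f x - p.(y - x) lies between 0 and (q - p).(y - x) for any subgradient q
  at y, and q tends to p as y tends to x.\<close>

lemma unique_subgrad_has_derivative:
  fixes f :: "'a::euclidean_space \<Rightarrow> real"
  assumes f: "convex_on D f" and x: "x \<in> interior D" and p: "subgrad D f x = {p}"
  shows "(f has_derivative (\<lambda>h. p \<bullet> h)) (at x)"
  unfolding has_derivative_within_alt
proof (safe)
  show "bounded_linear ((\<bullet>) p)" by (rule bounded_linear_inner_right)
  fix e :: real assume e: "e > 0"
  obtain d where d: "d > 0" "\<forall>y\<in>ball x d. \<forall>q\<in>subgrad D f y. norm (q - p) < e"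
    using unique_subgrad_continuous[OF f x p e] by blast
  obtain d' where d': "d' > 0" "ball x d' \<subseteq> interior D"
    using x open_contains_ball[of "interior D"] by auto
  show "\<exists>d>0. \<forall>y\<in>UNIV. norm (y - x) < d \<longrightarrow> norm (f y - f x - p \<bullet> (y - x)) \<le> e * norm (y - x)"
  proof (intro exI[of _ "min d d'"] conjI ballI impI)
    show "min d d' > 0" using d d' by simp
    fix y assume "norm (y - x) < min d d'"
    then have y: "y \<in> ball x d" "y \<in> interior D" using d' by (auto simp: dist_norm norm_minus_commute)
    then have yD: "y \<in> D" and xD: "x \<in> D" using x interior_subset by blast+
    obtain q where q: "q \<in> subgrad D f y" using subgrad_interior_nonempty[OF f y(2)] by blast
    have "0 \<le> f y - f x - p \<bullet> (y - x)" using subgrad_le[OF _ yD, of p f x] p by simp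
    moreover have "f y - f x - p \<bullet> (y - x) \<le> (q - p) \<bullet> (y - x)"
      using subgrad_le[OF q xD] by (simp add: inner_diff_left inner_diff_right)
    moreover have "\<dots> \<le> norm (q - p) * norm (y - x)" by (rule norm_cauchy_schwarz)
    moreover have "\<dots> \<le> e * norm (y - x)"
      using d(2) y(1) q by (intro mult_right_mono) (auto intro: less_imp_le)
    ultimately show "norm (f y - f x - p \<bullet> (y - x)) \<le> e * norm (y - x)" by simp
  qed
qed

lemma subgrad_unique_if_has_derivative:
  fixes f :: "'a::euclidean_space \<Rightarrow> real"
  assumes x: "x \<in> interior D" and f: "(f has_derivative (\<lambda>h. g \<bullet> h)) (at x)"
    and q: "q \<in> subgrad D f x"
  shows "q = g"
proof -
  obtain d where d: "d > 0" "ball x d \<subseteq> D" using x by (auto simp: mem_interior)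
  have der: "((\<lambda>y. f y - q \<bullet> y) has_derivative (\<lambda>h. g \<bullet> h - q \<bullet> h)) (at x)"
    by (intro derivative_intros f)
  \<comment> \<open>The function f - q.y has a local minimum at \<open>x\<close>.\<close>
  have "(\<lambda>h. g \<bullet> h - q \<bullet> h) = (\<lambda>h. 0)"
  proof (rule differential_zero_maxmin[OF _ _ der, of "ball x d"])
    show "(\<forall>y\<in>ball x d. f y - q \<bullet> y \<le> f x - q \<bullet> x) \<or> (\<forall>y\<in>ball x d. f x - q \<bullet> x \<le> f y - q \<bullet> y)"
      using subgrad_le[OF q] d(2) by (fastforce simp: inner_diff_right)
  qed (use d in auto)
  then have "g \<bullet> (g - q) - q \<bullet> (g - q) = 0" by metis
  then show ?thesis by (simp add: inner_diff_left[symmetric])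
qed

section \<open>Directional derivatives of Lipschitz functions\<close>

text \<open>Points where difference quotients along \<open>v\<close> with arbitrarily small steps
  exceed \<open>s\<close> and others fall below \<open>r\<close>; for r < s there is no derivative
  along \<open>v\<close> there. The radii 1/(n+1) exhibit the set as a countable intersection of
  open sets when \<open>f\<close> is continuous.\<close>

definition derivate_gap :: "('a::real_normed_vector \<Rightarrow> real) \<Rightarrow> 'a \<Rightarrow> real \<Rightarrow> real \<Rightarrow> 'a set" where
  "derivate_gap f v r s = {x. \<forall>n::nat.
     (\<exists>h. h \<noteq> 0 \<and> \<bar>h\<bar> < 1 / Suc n \<and> s < (f (x + h *\<^sub>R v) - f x) / h) \<and>
     (\<exists>h. h \<noteq> 0 \<and> \<bar>h\<bar> < 1 / Suc n \<and> (f (x + h *\<^sub>R v) - f x) / h < r)}"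

lemma derivate_gapD:
  assumes "x \<in> derivate_gap f v r s" "d > 0"
  shows "\<exists>h. h \<noteq> 0 \<and> \<bar>h\<bar> < d \<and> s < (f (x + h *\<^sub>R v) - f x) / h"
    and "\<exists>h. h \<noteq> 0 \<and> \<bar>h\<bar> < d \<and> (f (x + h *\<^sub>R v) - f x) / h < r"
proof -
  obtain n :: nat where n: "1 / Suc n < d"
    using reals_Archimedean[OF assms(2)] by (auto simp: inverse_eq_divide)
  have "\<exists>h. h \<noteq> 0 \<and> \<bar>h\<bar> < 1 / Suc n \<and> s < (f (x + h *\<^sub>R v) - f x) / h"
    "\<exists>h. h \<noteq> 0 \<and> \<bar>h\<bar> < 1 / Suc n \<and> (f (x + h *\<^sub>R v) - f x) / h < r"
    using assms(1) unfolding derivate_gap_def by blast+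
  then show "\<exists>h. h \<noteq> 0 \<and> \<bar>h\<bar> < d \<and> s < (f (x + h *\<^sub>R v) - f x) / h"
    "\<exists>h. h \<noteq> 0 \<and> \<bar>h\<bar> < d \<and> (f (x + h *\<^sub>R v) - f x) / h < r"
    using n by (meson less_trans)+
qed

lemma borel_derivate_gap:
  fixes f :: "'a::euclidean_space \<Rightarrow> real"
  assumes "continuous_on UNIV f"
  shows "derivate_gap f v r s \<in> sets borel"
proof -
  have cont: "continuous_on UNIV (\<lambda>x. (f (x + h *\<^sub>R v) - f x) / h)" for h
    by (cases "h = 0") (auto intro!: continuous_intros continuous_on_compose2[OF assms] assms)
  have o: "open {x. s < (f (x + h *\<^sub>R v) - f x) / h}" "open {x. (f (x + h *\<^sub>R v) - f x) / h < r}" for h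
    by (intro open_Collect_less cont continuous_on_const)+
  have "derivate_gap f v r s = (\<Inter>n::nat.
      (\<Union>h\<in>{h. h \<noteq> 0 \<and> \<bar>h\<bar> < 1 / Suc n}. {x. s < (f (x + h *\<^sub>R v) - f x) / h}) \<inter>
      (\<Union>h\<in>{h. h \<noteq> 0 \<and> \<bar>h\<bar> < 1 / Suc n}. {x. (f (x + h *\<^sub>R v) - f x) / h < r}))"
    unfolding derivate_gap_def by (intro set_eqI) (simp add: conj_assoc)
  also have "\<dots> \<in> sets borel"
    by (intro sets.countable_INT'' borel_open open_Int open_UN ballI o open_UNIV) simp
  finally show ?thesis .
qed

lemma emeasure_Union_disjoint_cballs_le:
  fixes C :: "(real \<times> real) set" and M N :: "real measure"
  assumes C: "countable C" "pairwise (\<lambda>i j. disjnt (cball (fst i) (snd i)) (cball (fst j) (snd j))) C"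
    and [simp]: "sets M = sets borel" "sets N = sets borel"
    and le: "\<And>i. i \<in> C \<Longrightarrow> a * emeasure M (cball (fst i) (snd i)) \<le> b * emeasure N (cball (fst i) (snd i))"
  shows "a * emeasure M (\<Union>i\<in>C. cball (fst i) (snd i)) \<le> b * emeasure N (\<Union>i\<in>C. cball (fst i) (snd i))"
proof -
  have dis: "disjoint_family_on (\<lambda>i. cball (fst i) (snd i)) C"
    using C(2) by (auto simp: disjoint_family_on_def pairwise_def disjnt_def)
  have eq: "emeasure P (\<Union>i\<in>C. cball (fst i) (snd i)) =
      (\<integral>\<^sup>+i. emeasure P (cball (fst i) (snd i)) \<partial>count_space C)" if "sets P = sets borel" for P
    by (rule emeasure_UN_countable[OF _ C(1) dis]) (simp add: that)
  have "a * emeasure M (\<Union>i\<in>C. cball (fst i) (snd i)) =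
      (\<integral>\<^sup>+i. a * emeasure M (cball (fst i) (snd i)) \<partial>count_space C)"
    by (simp add: eq nn_integral_cmult)
  also have "\<dots> \<le> (\<integral>\<^sup>+i. b * emeasure N (cball (fst i) (snd i)) \<partial>count_space C)"
    by (rule nn_integral_mono) (simp add: le)
  also have "\<dots> = b * emeasure N (\<Union>i\<in>C. cball (fst i) (snd i))"
    by (simp add: eq nn_integral_cmult)
  finally show ?thesis .
qed

lemma emeasure_lborel_cball_real: "0 < \<rho> \<Longrightarrow> emeasure lborel (cball (c::real) \<rho>) = ennreal (2 * \<rho>)"
  by (simp add: cball_eq_atLeastAtMost)

text \<open>Lebesgue's argument: cover first by intervals on which the increment is small, then, inside
  these, by intervals on which it is large.\<close>

lemma derivate_gap_bounded_null:
  fixes F :: "real \<Rightarrow> real"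
  assumes mono: "mono F" and cont: "continuous_on UNIV F" and r: "0 \<le> r" "r < s"
  shows "emeasure lborel (derivate_gap F 1 r s \<inter> ball 0 R) = 0"
proof -
  define E where "E = derivate_gap F 1 r s \<inter> ball 0 R"
  \<comment> \<open>The Stieltjes measure of \<open>F\<close>; by continuity its value on a closed
    interval is the increment of \<open>F\<close>.\<close>
  define M where "M = interval_measure F"
  have sM[simp]: "sets M = sets borel" by (simp add: M_def)
  have Mcb: "emeasure M (cball c \<rho>) = ennreal (F (c + \<rho>) - F (c - \<rho>))" if "0 < \<rho>" for c \<rho>
    unfolding M_def cball_eq_atLeastAtMost
    by (rule emeasure_interval_measure_Icc) (use that monoD[OF mono] cont in auto)
  have Eb: "E \<in> sets borel" unfolding E_def using borel_derivate_gap[OF cont] by auto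
  have "emeasure lborel E \<le> emeasure lborel (ball 0 R :: real set)"
    by (rule emeasure_mono) (auto simp: E_def)
  also have "\<dots> < \<infinity>" by (rule emeasure_lborel_ball_finite)
  finally have fin: "emeasure lborel E \<noteq> \<infinity>" by simp
  define m where "m = measure lborel E"
  have Em: "emeasure lborel E = ennreal m" unfolding m_def by (rule emeasure_eq_ennreal_measure) (use fin in simp)
  have m0: "0 \<le> m" by (simp add: m_def)
  \<comment> \<open>Letting e tend to 0 leaves s m \<le> r m, so that m = 0.\<close>
  have key: "s * m \<le> r * (m + e)" if e: "e > 0" for e
  proof -
    obtain U where U: "open U" "E \<subseteq> U" "emeasure lebesgue (U - E) < ennreal e"
      by (rule sets_lebesgue_outer_open[of E e]) (use Eb e in auto)
    have Ub: "U \<in> sets borel" using U(1) by simp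
    have Um: "emeasure lborel U \<le> ennreal (m + e)"
    proof -
      have "emeasure lborel U = emeasure lborel E + emeasure lborel (U - E)"
        using U(2) Eb Ub by (subst plus_emeasure) (auto simp: Un_absorb1)
      also have "emeasure lborel (U - E) \<le> ennreal e"
        using U(3) Eb Ub by (simp add: emeasure_completion)
      finally show ?thesis using m0 e by (simp add: Em ennreal_plus add_left_mono)
    qed
    \<comment> \<open>The interval between x and x + h, for either sign of h, is the ball of centre
      x + h/2 and radius |h|/2. Vitali's theorem is applied to such balls.\<close>
    have cb: "cball (x + h/2) (\<bar>h\<bar>/2) \<subseteq> ball x d" "x \<in> cball (x + h/2) (\<bar>h\<bar>/2)"
      if "\<bar>h\<bar> < d" for x h d :: real
      using that by (auto simp: dist_real_def abs_if split: if_splits)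
    have quot: "(F (x + h) - F x) / h = (F (x + h/2 + \<bar>h\<bar>/2) - F (x + h/2 - \<bar>h\<bar>/2)) / \<bar>h\<bar>" if "h \<noteq> 0" for x h
    proof (cases "h > 0")
      case True
      then have "x + h/2 + \<bar>h\<bar>/2 = x + h" "x + h/2 - \<bar>h\<bar>/2 = x" by auto
      then show ?thesis using True by (simp only: abs_of_pos)
    next
      case False
      then have "x + h/2 + \<bar>h\<bar>/2 = x" "x + h/2 - \<bar>h\<bar>/2 = x + h" using that by auto
      then show ?thesis using False that by (simp only:) (simp add: divide_simps)
    qed
    define K1 where "K1 = {i. 0 < snd i \<and> cball (fst i) (snd i) \<subseteq> U \<and>
        F (fst i + snd i) - F (fst i - snd i) < r * (2 * snd i)}"
    have cov1: "\<exists>i. i \<in> K1 \<and> x \<in> cball (fst i) (snd i) \<and> snd i < d" if x: "x \<in> E" and d: "0 < d" for x d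
    proof -
      obtain d' where d': "d' > 0" "ball x d' \<subseteq> U" using U x open_contains_ball by blast
      obtain h where h: "h \<noteq> 0" "\<bar>h\<bar> < min d d'" "(F (x + h) - F x) / h < r"
        using derivate_gapD(2)[of x F 1 r s "min d d'"] x d d' by (auto simp: E_def)
      have "F (x + h/2 + \<bar>h\<bar>/2) - F (x + h/2 - \<bar>h\<bar>/2) < r * \<bar>h\<bar>"
        using h(3) h(1) unfolding quot[OF h(1)] by (simp add: pos_divide_less_eq)
      moreover have "cball (x + h/2) (\<bar>h\<bar>/2) \<subseteq> U" "x \<in> cball (x + h/2) (\<bar>h\<bar>/2)"
        using cb[of h d' x] d' h(2) by auto
      ultimately show ?thesis
        using h by (intro exI[of _ "(x + h/2, \<bar>h\<bar>/2)"]) (auto simp: K1_def)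
    qed
    obtain C1 where C1: "countable C1" "C1 \<subseteq> K1"
      "pairwise (\<lambda>i j. disjnt (cball (fst i) (snd i)) (cball (fst j) (snd j))) C1"
      "negligible (E - (\<Union>i\<in>C1. cball (fst i) (snd i)))"
      by (rule Vitali_covering_theorem_cballs[of K1 snd E fst, OF _ cov1]) (auto simp: K1_def)
    \<comment> \<open>The second covering takes place inside the open balls, so that its intervals
      stay within the first ones; the spheres lost in this way are countably many null sets.\<close>
    define O1 where "O1 = (\<Union>i\<in>C1. ball (fst i) (snd i))"
    define K2 where "K2 = {i. 0 < snd i \<and> cball (fst i) (snd i) \<subseteq> O1 \<and>
        s * (2 * snd i) < F (fst i + snd i) - F (fst i - snd i)}"
    have oO1: "open O1" unfolding O1_def by auto
    have cov2: "\<exists>i. i \<in> K2 \<and> x \<in> cball (fst i) (snd i) \<and> snd i < d" if x: "x \<in> E \<inter> O1" and d: "0 < d" for x d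
    proof -
      obtain d' where d': "d' > 0" "ball x d' \<subseteq> O1" using oO1 x open_contains_ball by blast
      obtain h where h: "h \<noteq> 0" "\<bar>h\<bar> < min d d'" "s < (F (x + h) - F x) / h"
        using derivate_gapD(1)[of x F 1 r s "min d d'"] x d d' by (auto simp: E_def)
      have "s * \<bar>h\<bar> < F (x + h/2 + \<bar>h\<bar>/2) - F (x + h/2 - \<bar>h\<bar>/2)"
        using h(3) h(1) unfolding quot[OF h(1)] by (simp add: pos_less_divide_eq)
      moreover have "cball (x + h/2) (\<bar>h\<bar>/2) \<subseteq> O1" "x \<in> cball (x + h/2) (\<bar>h\<bar>/2)"
        using cb[of h d' x] d' h(2) by auto
      ultimately show ?thesis
        using h by (intro exI[of _ "(x + h/2, \<bar>h\<bar>/2)"]) (auto simp: K2_def)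
    qed
    obtain C2 where C2: "countable C2" "C2 \<subseteq> K2"
      "pairwise (\<lambda>i j. disjnt (cball (fst i) (snd i)) (cball (fst j) (snd j))) C2"
      "negligible (E \<inter> O1 - (\<Union>i\<in>C2. cball (fst i) (snd i)))"
      by (rule Vitali_covering_theorem_cballs[of K2 snd "E \<inter> O1" fst, OF _ cov2]) (auto simp: K2_def)
    define V1 where "V1 = (\<Union>i\<in>C1. cball (fst i) (snd i))"
    define V2 where "V2 = (\<Union>i\<in>C2. cball (fst i) (snd i))"
    have Vb[measurable]: "V1 \<in> sets borel" "V2 \<in> sets borel"
      unfolding V1_def V2_def by (intro sets.countable_UN'' C1 C2 borel_closed closed_cball)+
    have neg: "negligible (E - V2)"
    proof (rule negligible_subset)
      have "negligible (\<Union>i\<in>C1. sphere (fst i) (snd i))"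
        by (rule negligible_countable_Union) (use C1(1) negligible_sphere in auto)
      then show "negligible ((E - V1) \<union> (\<Union>i\<in>C1. sphere (fst i) (snd i)) \<union> (E \<inter> O1 - V2))"
        using C1(4) C2(4) unfolding V1_def[symmetric] V2_def[symmetric] by (intro negligible_Un)
      show "E - V2 \<subseteq> (E - V1) \<union> (\<Union>i\<in>C1. sphere (fst i) (snd i)) \<union> (E \<inter> O1 - V2)"
      proof
        fix x assume x: "x \<in> E - V2"
        show "x \<in> (E - V1) \<union> (\<Union>i\<in>C1. sphere (fst i) (snd i)) \<union> (E \<inter> O1 - V2)"
        proof (cases "x \<in> V1")
          case True
          then obtain i where i: "i \<in> C1" "x \<in> cball (fst i) (snd i)" by (auto simp: V1_def)
          then have "x \<in> ball (fst i) (snd i) \<or> x \<in> sphere (fst i) (snd i)" by auto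
          then show ?thesis using i(1) x unfolding O1_def by blast
        qed (use x in blast)
      qed
    qed
    have "emeasure lebesgue E \<le> emeasure lebesgue V2"
    proof (rule emeasure_mono_AE)
      show "AE x in lebesgue. x \<in> E \<longrightarrow> x \<in> V2"
        using neg by (intro AE_I'[of "E - V2"]) (auto simp: negligible_iff_null_sets)
    qed (use Vb in auto)
    then have "emeasure lborel E \<le> emeasure lborel V2" using Eb Vb by (simp add: emeasure_completion)
    then have "ennreal s * emeasure lborel E \<le> ennreal s * emeasure lborel V2" by (rule mult_left_mono) simp
    also have "\<dots> \<le> 1 * emeasure M V2"
      unfolding V2_def
    proof (rule emeasure_Union_disjoint_cballs_le[OF C2(1,3)])
      fix i assume "i \<in> C2"
      then have i: "0 < snd i" "s * (2 * snd i) < F (fst i + snd i) - F (fst i - snd i)"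
        using C2(2) by (auto simp: K2_def)
      then show "ennreal s * emeasure lborel (cball (fst i) (snd i)) \<le> 1 * emeasure M (cball (fst i) (snd i))"
        using r by (simp add: emeasure_lborel_cball_real Mcb ennreal_mult'[symmetric] ennreal_leI)
    qed simp_all
    also have "\<dots> \<le> 1 * emeasure M V1"
    proof -
      have "V2 \<subseteq> O1"
        unfolding V2_def
      proof (rule UN_least)
        fix i assume "i \<in> C2"
        then show "cball (fst i) (snd i) \<subseteq> O1" using C2(2) unfolding K2_def by blast
      qed
      moreover have "O1 \<subseteq> V1" unfolding O1_def V1_def using ball_subset_cball by blast
      ultimately have "V2 \<subseteq> V1" by blast
      then show ?thesis by (simp add: emeasure_mono Vb)
    qed
    also have "\<dots> \<le> ennreal r * emeasure lborel V1"
      unfolding V1_def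
    proof (rule emeasure_Union_disjoint_cballs_le[OF C1(1,3)])
      fix i assume "i \<in> C1"
      then have i: "0 < snd i" "F (fst i + snd i) - F (fst i - snd i) < r * (2 * snd i)"
        using C1(2) by (auto simp: K1_def)
      then show "1 * emeasure M (cball (fst i) (snd i)) \<le> ennreal r * emeasure lborel (cball (fst i) (snd i))"
        using r by (simp add: emeasure_lborel_cball_real Mcb ennreal_mult'[symmetric] ennreal_leI)
    qed simp_all
    also have "\<dots> \<le> ennreal r * ennreal (m + e)"
    proof (rule mult_left_mono)
      have "V1 \<subseteq> U" using C1(2) by (auto simp: V1_def K1_def)
      then have "emeasure lborel V1 \<le> emeasure lborel U" using Ub by (intro emeasure_mono) auto
      then show "emeasure lborel V1 \<le> ennreal (m + e)" using Um by simp
    qed simp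
    finally have "ennreal (s * m) \<le> ennreal (r * (m + e))"
      using r m0 e by (simp add: Em ennreal_mult)
    then show ?thesis using r m0 e by (simp add: ennreal_le_iff)
  qed
  have "(s - r) * m \<le> 0"
  proof (rule field_le_epsilon)
    fix e :: real assume e: "e > 0"
    \<comment> \<open>The denominator r + 1 keeps the resulting error r e / (r + 1) below e, also
      for r = 0.\<close>
    have "s * m \<le> r * (m + e / (r + 1))" by (rule key) (use e r in simp)
    also have "\<dots> = r * m + e * (r / (r + 1))" by (simp add: algebra_simps)
    also have "\<dots> \<le> r * m + e * 1" using e r by (intro add_left_mono mult_left_mono) auto
    finally show "(s - r) * m \<le> 0 + e" by (simp add: algebra_simps)
  qed
  then have "m = 0" using m0 r by (simp add: mult_le_0_iff)
  then show ?thesis using Em by (simp add: E_def)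
qed

lemma lipschitz_imp_continuous_on:
  fixes f :: "'a::real_normed_vector \<Rightarrow> 'b::real_normed_vector"
  assumes "\<And>x y. norm (f x - f y) \<le> C * norm (x - y)"
  shows "continuous_on UNIV f"
proof -
  have "0 \<le> max C 0" by simp
  moreover have "norm (f x - f y) \<le> max C 0 * norm (x - y)" for x y
    using assms[of x y] by (rule order_trans) (simp add: mult_right_mono)
  ultimately have "(max C 0)-lipschitz_on UNIV f" by (auto simp: lipschitz_on_def dist_norm)
  then show ?thesis by (rule lipschitz_on_continuous_on)
qed

text \<open>Adding C x makes \<open>F\<close> monotone and shifts every quotient by C. If r + C < 0,
  the shifted gap set is empty because quotients of a monotone function are nonnegative; otherwise
  it is exhausted by bounded pieces.\<close>

lemma derivate_gap_real_null:
  fixes F :: "real \<Rightarrow> real"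
  assumes L: "\<And>x y. \<bar>F x - F y\<bar> \<le> C * \<bar>x - y\<bar>" and r: "r < s"
  shows "derivate_gap F 1 r s \<in> null_sets lborel"
proof -
  define G where "G x = F x + C * x" for x
  have cF: "continuous_on UNIV F"
    by (rule lipschitz_imp_continuous_on[of _ C]) (use L in simp)
  have mono: "mono G"
  proof (rule monoI)
    fix x y :: real assume "x \<le> y"
    then show "G x \<le> G y" using L[of x y] by (simp add: G_def algebra_simps abs_if split: if_splits)
  qed
  have cG: "continuous_on UNIV G" unfolding G_def by (intro continuous_intros cF)
  have q: "(G (x + h *\<^sub>R 1) - G x) / h = (F (x + h *\<^sub>R 1) - F x) / h + C" if "h \<noteq> 0" for x h
    using that by (simp add: G_def field_simps)
  have sub: "derivate_gap F 1 r s \<subseteq> derivate_gap G 1 (r + C) (s + C)"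
    unfolding derivate_gap_def
  proof safe
    fix x and n :: nat
    assume *: "\<forall>n. (\<exists>h. h \<noteq> 0 \<and> \<bar>h\<bar> < 1 / real (Suc n) \<and> s < (F (x + h *\<^sub>R 1) - F x) / h) \<and>
        (\<exists>h. h \<noteq> 0 \<and> \<bar>h\<bar> < 1 / real (Suc n) \<and> (F (x + h *\<^sub>R 1) - F x) / h < r)"
    obtain h where h: "h \<noteq> 0" "\<bar>h\<bar> < 1 / real (Suc n)" "s < (F (x + h *\<^sub>R 1) - F x) / h" using * by blast
    show "\<exists>h. h \<noteq> 0 \<and> \<bar>h\<bar> < 1 / real (Suc n) \<and> s + C < (G (x + h *\<^sub>R 1) - G x) / h"
      by (intro exI[of _ h] conjI h(1,2)) (use h(3) in \<open>simp only: q[OF h(1)]\<close>)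
    obtain h where h: "h \<noteq> 0" "\<bar>h\<bar> < 1 / real (Suc n)" "(F (x + h *\<^sub>R 1) - F x) / h < r" using * by blast
    show "\<exists>h. h \<noteq> 0 \<and> \<bar>h\<bar> < 1 / real (Suc n) \<and> (G (x + h *\<^sub>R 1) - G x) / h < r + C"
      by (intro exI[of _ h] conjI h(1,2)) (use h(3) in \<open>simp only: q[OF h(1)]\<close>)
  qed
  have "derivate_gap G 1 (r + C) (s + C) \<in> null_sets lborel"
  proof (cases "0 \<le> r + C")
    case True
    have "derivate_gap G 1 (r + C) (s + C) \<inter> ball 0 (real R) \<in> null_sets lborel" for R
      using derivate_gap_bounded_null[OF mono cG True, of "s + C"] r borel_derivate_gap[OF cG]
      by (auto simp: null_sets_def)
    then have "(\<Union>R. derivate_gap G 1 (r + C) (s + C) \<inter> ball 0 (real R)) \<in> null_sets lborel"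
      by (intro null_sets_UN) auto
    moreover have "(\<Union>R. derivate_gap G 1 (r + C) (s + C) \<inter> ball 0 (real R)) = derivate_gap G 1 (r + C) (s + C)"
      using reals_Archimedean2 by auto
    ultimately show ?thesis by simp
  next
    case False
    have nonneg: "0 \<le> (G (x + h *\<^sub>R 1) - G x) / h" if "h \<noteq> 0" for x h
      using monoD[OF mono, of x "x + h"] monoD[OF mono, of "x + h" x] that
      by (cases "h > 0") (auto simp: zero_le_divide_iff)
    have "derivate_gap G 1 (r + C) (s + C) = {}"
    proof (rule ccontr)
      assume "derivate_gap G 1 (r + C) (s + C) \<noteq> {}"
      then obtain x where x: "x \<in> derivate_gap G 1 (r + C) (s + C)" by blast
      from derivate_gapD(2)[OF x zero_less_one] obtain h where
        "h \<noteq> 0" "(G (x + h *\<^sub>R 1) - G x) / h < r + C" by blast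
      then show False using nonneg[of h x] False by linarith
    qed
    then show ?thesis by simp
  qed
  then show ?thesis
    by (rule null_sets_subset) (use sub borel_derivate_gap[OF cF] in auto)
qed

text \<open>By translation invariance, a set whose intersection with every line of direction \<^term>\<open>v\<close>
  is null is itself null.\<close>

lemma derivate_gap_null:
  fixes f :: "'a::euclidean_space \<Rightarrow> real"
  assumes L: "\<And>x y. \<bar>f x - f y\<bar> \<le> C * norm (x - y)" and r: "r < s"
  shows "derivate_gap f v r s \<in> null_sets lborel"
proof -
  let ?N = "derivate_gap f v r s"
  have cf: "continuous_on UNIV f"
    by (rule lipschitz_imp_continuous_on[of _ C]) (use L in simp)
  have N: "?N \<in> sets borel" by (rule borel_derivate_gap[OF cf])
  have line: "{t. x + t *\<^sub>R v \<in> ?N} \<in> null_sets lborel" for x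
  proof -
    have "{t. x + t *\<^sub>R v \<in> ?N} = derivate_gap (\<lambda>t. f (x + t *\<^sub>R v)) 1 r s"
      by (simp add: derivate_gap_def scaleR_add_left add.assoc)
    also have "\<dots> \<in> null_sets lborel"
    proof (rule derivate_gap_real_null[OF _ r])
      fix t u :: real
      have "\<bar>f (x + t *\<^sub>R v) - f (x + u *\<^sub>R v)\<bar> \<le> C * norm ((x + t *\<^sub>R v) - (x + u *\<^sub>R v))" by (rule L)
      also have "(x + t *\<^sub>R v) - (x + u *\<^sub>R v) = (t - u) *\<^sub>R v" by (simp add: algebra_simps)
      finally show "\<bar>f (x + t *\<^sub>R v) - f (x + u *\<^sub>R v)\<bar> \<le> (C * norm v) * \<bar>t - u\<bar>"
        by (simp add: mult_ac)
    qed
    finally show ?thesis .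
  qed
  \<comment> \<open>The indicator of {0..1} gives the parameter t total mass 1, so integrating over
    x first yields exactly the measure of the gap set, and integrating over t first yields
    0.\<close>
  define g where "g x t = indicator {0..1} t * (indicator ?N (x + t *\<^sub>R v) :: ennreal)" for x t
  have meas: "case_prod g \<in> borel_measurable (lborel \<Otimes>\<^sub>M lborel)"
  proof -
    have [measurable]: "(\<lambda>(x, t). x + t *\<^sub>R v) \<in> borel_measurable (lborel \<Otimes>\<^sub>M lborel)"
      by measurable
    show ?thesis unfolding g_def using N by measurable
  qed
  have "(\<integral>\<^sup>+t. (\<integral>\<^sup>+x. g x t \<partial>lborel) \<partial>lborel) = (\<integral>\<^sup>+x. (\<integral>\<^sup>+t. g x t \<partial>lborel) \<partial>lborel)"
    by (rule lborel_pair.Fubini'[OF meas])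
  also have "\<dots> = 0"
  proof -
    have "(\<integral>\<^sup>+t. g x t \<partial>lborel) = 0" for x
    proof -
      have "(\<integral>\<^sup>+t. g x t \<partial>lborel) \<le> (\<integral>\<^sup>+t. indicator {t. x + t *\<^sub>R v \<in> ?N} t \<partial>lborel)"
        by (rule nn_integral_mono) (auto simp: g_def indicator_def)
      also have "\<dots> = 0" using line[of x] by (subst nn_integral_indicator) auto
      finally show ?thesis by simp
    qed
    then show ?thesis by simp
  qed
  finally have zero: "(\<integral>\<^sup>+t. (\<integral>\<^sup>+x. g x t \<partial>lborel) \<partial>lborel) = 0" .
  have "(\<integral>\<^sup>+x. g x t \<partial>lborel) = indicator {0..1} t * emeasure lborel ?N" for t
  proof -
    have "(\<integral>\<^sup>+x. indicator ?N (x + t *\<^sub>R v) \<partial>lborel) = (\<integral>\<^sup>+x. indicator ?N x \<partial>(distr lborel borel ((+) (t *\<^sub>R v))))"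
      using N by (subst nn_integral_distr) (auto simp: add.commute)
    also have "\<dots> = emeasure lborel ?N" using N by (simp add: lborel_distr_plus)
    finally have *: "(\<integral>\<^sup>+x. indicator ?N (x + t *\<^sub>R v) \<partial>lborel) = emeasure lborel ?N" .
    show ?thesis unfolding g_def using N by (subst nn_integral_cmult) (auto simp: *)
  qed
  then have "(\<integral>\<^sup>+t. (\<integral>\<^sup>+x. g x t \<partial>lborel) \<partial>lborel) = emeasure lborel ?N"
    by (simp add: nn_integral_multc)
  then show ?thesis using zero N by (simp add: null_sets_def)
qed

text \<open>The Lipschitz bound keeps the upper and lower limits of the quotients finite; if they
  differ, two rationals between them place \<open>x\<close> in a gap set.\<close>

lemma has_real_derivative_or_gap:
  fixes f :: "'a::real_normed_vector \<Rightarrow> real"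
  assumes L: "\<And>x y. \<bar>f x - f y\<bar> \<le> C * norm (x - y)"
    and no: "\<And>r s. r \<in> \<rat> \<Longrightarrow> s \<in> \<rat> \<Longrightarrow> r < s \<Longrightarrow> x \<notin> derivate_gap f v r s"
  shows "\<exists>D. ((\<lambda>t. f (x + t *\<^sub>R v)) has_real_derivative D) (at 0)"
proof -
  define q where "q h = (f (x + h *\<^sub>R v) - f x) / h" for h :: real
  have qb: "\<bar>q h\<bar> \<le> C * norm v" if "h \<noteq> 0" for h
  proof -
    have "\<bar>f (x + h *\<^sub>R v) - f x\<bar> \<le> (C * norm v) * \<bar>h\<bar>" using L[of "x + h *\<^sub>R v" x] by (simp add: mult_ac)
    then show ?thesis using that by (simp add: q_def abs_divide pos_divide_le_eq)
  qed
  let ?F = "at (0::real)"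
  let ?S = "Limsup ?F (\<lambda>h. ereal (q h))" and ?I = "Liminf ?F (\<lambda>h. ereal (q h))"
  have ev: "eventually (\<lambda>h. h \<noteq> 0) ?F" by (simp add: eventually_at_filter)
  have S: "?S \<le> ereal (C * norm v)"
    by (rule Limsup_bounded, rule eventually_mono[OF ev]) (use qb in \<open>auto simp: abs_le_iff\<close>)
  have I: "ereal (- (C * norm v)) \<le> ?I"
  proof (rule Liminf_bounded, rule eventually_mono[OF ev])
    fix h :: real assume "h \<noteq> 0"
    then show "ereal (- (C * norm v)) \<le> ereal (q h)" using qb[of h] by (simp add: abs_le_iff)
  qed
  have IS: "?I \<le> ?S" by (rule Liminf_le_Limsup) simp
  obtain D where SD: "?S = ereal D"
    using S I IS by (cases ?S) auto
  have "\<not> ?I < ?S"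
  proof
    assume "?I < ?S"
    then obtain r s where rs: "?I < ereal r" "ereal r < ereal s" "ereal s < ?S" "r \<in> \<rat>" "s \<in> \<rat>"
    proof -
      obtain i where i: "?I = ereal i" using S I IS by (cases ?I) auto
      have "i < D" using \<open>?I < ?S\<close> i SD by simp
      obtain r where r: "r \<in> \<rat>" "i < r" "r < D" using Rats_dense_in_real[OF \<open>i < D\<close>] by blast
      obtain s where s: "s \<in> \<rat>" "r < s" "s < D" using Rats_dense_in_real[OF r(3)] by blast
      show ?thesis by (rule that[of r s]) (use r s i SD in auto)
    qed
    have "x \<in> derivate_gap f v r s"
      unfolding derivate_gap_def
    proof (safe)
      fix n :: nat
      have near: "eventually (\<lambda>h. h \<noteq> 0 \<and> \<bar>h\<bar> < 1 / real (Suc n)) ?F"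
        unfolding eventually_at by (intro exI[of _ "1 / real (Suc n)"]) (simp add: dist_real_def)
      show "\<exists>h. h \<noteq> 0 \<and> \<bar>h\<bar> < 1 / real (Suc n) \<and> s < (f (x + h *\<^sub>R v) - f x) / h"
      proof (rule ccontr)
        assume "\<not> ?thesis"
        then have "eventually (\<lambda>h. ereal (q h) \<le> ereal s) ?F"
          by (intro eventually_mono[OF near]) (auto simp: q_def not_less)
        then have "?S \<le> ereal s" by (rule Limsup_bounded)
        then show False using rs(3) by simp
      qed
      show "\<exists>h. h \<noteq> 0 \<and> \<bar>h\<bar> < 1 / real (Suc n) \<and> (f (x + h *\<^sub>R v) - f x) / h < r"
      proof (rule ccontr)
        assume "\<not> ?thesis"
        then have "eventually (\<lambda>h. ereal r \<le> ereal (q h)) ?F"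
          by (intro eventually_mono[OF near]) (auto simp: q_def not_less)
        then have "ereal r \<le> ?I" by (rule Liminf_bounded)
        then show False using rs(1) by simp
      qed
    qed
    then show False using no rs by simp
  qed
  then have "?I = ereal D" using IS SD by (simp add: order.order_iff_strict)
  then have "((\<lambda>h. ereal (q h)) \<longlongrightarrow> ereal D) ?F"
    using SD by (subst tendsto_iff_Liminf_eq_Limsup) auto
  then have "(q \<longlongrightarrow> D) ?F" by simp
  then have "((\<lambda>t. f (x + t *\<^sub>R v)) has_real_derivative D) (at 0)"
    unfolding DERIV_def q_def by simp
  then show ?thesis ..
qed

lemma AE_directional_derivative:
  fixes f :: "'a::euclidean_space \<Rightarrow> real"
  assumes L: "\<And>x y. \<bar>f x - f y\<bar> \<le> C * norm (x - y)"
  shows "AE x in lborel. \<exists>D. ((\<lambda>t. f (x + t *\<^sub>R v)) has_real_derivative D) (at 0)"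
proof (rule AE_I')
  show "(\<Union>(r, s)\<in>{(r, s). r \<in> \<rat> \<and> s \<in> \<rat> \<and> r < s}. derivate_gap f v r s) \<in> null_sets lborel"
  proof (rule null_sets_UN')
    show "countable {(r::real, s::real). r \<in> \<rat> \<and> s \<in> \<rat> \<and> r < s}"
      by (rule countable_subset[of _ "\<rat> \<times> \<rat>"]) (auto intro: countable_rat)
  qed (use derivate_gap_null[OF L] in auto)
  show "{x \<in> space lborel. \<not> (\<exists>D. ((\<lambda>t. f (x + t *\<^sub>R v)) has_real_derivative D) (at 0))}
      \<subseteq> (\<Union>(r, s)\<in>{(r, s). r \<in> \<rat> \<and> s \<in> \<rat> \<and> r < s}. derivate_gap f v r s)"
    using has_real_derivative_or_gap[OF L] by blast
qed

section \<open>Rademacher's theorem\<close>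

text \<open>The limit runs along the sequence 1/(n+1) only. This makes it Borel measurable in x on
  the whole space, and it agrees with the derivative along \<open>v\<close> wherever that
  exists.\<close>

definition directional_deriv :: "('a::real_normed_vector \<Rightarrow> real) \<Rightarrow> 'a \<Rightarrow> 'a \<Rightarrow> real" where
  "directional_deriv f v x = lim (\<lambda>n. real (Suc n) * (f (x + (1 / real (Suc n)) *\<^sub>R v) - f x))"

lemma difference_quotient_LIMSEQ:
  fixes f :: "'a::real_normed_vector \<Rightarrow> real"
  assumes "((\<lambda>t. f (x + t *\<^sub>R v)) has_real_derivative D) (at 0)"
  shows "(\<lambda>n. real (Suc n) * (f (x + (1 / real (Suc n)) *\<^sub>R v) - f x)) \<longlonglongrightarrow> D"
proof -
  have lim: "((\<lambda>h. (f (x + h *\<^sub>R v) - f x) / h) \<longlongrightarrow> D) (at 0)"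
    using assms unfolding DERIV_def by simp
  have seq: "filterlim (\<lambda>n. 1 / real (Suc n)) (at 0) sequentially"
    unfolding filterlim_at
    using LIMSEQ_inverse_real_of_nat by (simp add: inverse_eq_divide)
  have "(\<lambda>n. (f (x + (1 / real (Suc n)) *\<^sub>R v) - f x) / (1 / real (Suc n))) \<longlonglongrightarrow> D"
    by (rule filterlim_compose[OF lim seq])
  then show ?thesis by (simp add: mult.commute)
qed

lemma directional_deriv_eq:
  fixes f :: "'a::real_normed_vector \<Rightarrow> real"
  assumes "((\<lambda>t. f (x + t *\<^sub>R v)) has_real_derivative D) (at 0)"
  shows "directional_deriv f v x = D"
  unfolding directional_deriv_def by (rule limI[OF difference_quotient_LIMSEQ[OF assms]])

lemma borel_measurable_directional_deriv:
  fixes f :: "'a::euclidean_space \<Rightarrow> real"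
  assumes "f \<in> borel_measurable borel"
  shows "directional_deriv f v \<in> borel_measurable borel"
  unfolding directional_deriv_def[abs_def] using assms
  by (intro borel_measurable_lim_metric) simp

lemma integral_lborel_shift:
  fixes h :: "'a::euclidean_space \<Rightarrow> real"
  assumes "h \<in> borel_measurable borel"
  shows "(\<integral>x. h (x + c) \<partial>lborel) = (\<integral>x. h x \<partial>lborel)"
proof -
  have "(\<integral>x. h x \<partial>lborel) = (\<integral>x. h x \<partial>(distr lborel borel ((+) c)))"
    by (simp add: lborel_distr_plus)
  also have "\<dots> = (\<integral>x. h (c + x) \<partial>lborel)"
    using assms by (subst integral_distr) auto
  finally show ?thesis by (simp add: add.commute)
qed

lemma integrable_indicator_mult_bounded:
  fixes g :: "'a::euclidean_space \<Rightarrow> real"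
  assumes [measurable]: "g \<in> borel_measurable borel" "S \<in> sets borel"
    and "AE x in lborel. \<bar>g x\<bar> \<le> B" and S: "bounded S"
  shows "integrable lborel (\<lambda>x. indicator S x * g x)"
proof (rule Bochner_Integration.integrable_bound)
  have "emeasure lborel S < \<infinity>" using S emeasure_bounded_finite by blast
  then show "integrable lborel (\<lambda>x. indicator S x * B)" by simp
  show "AE x in lborel. norm (indicator S x * g x) \<le> norm (indicator S x * B)"
    using assms(3) by eventually_elim (auto simp: indicator_def)
qed measurable

text \<open>After adding \<open>B\<close>, both g + B and the constant B are densities of measures.
  These agree on boxes, which form an intersection-stable generator, so the measures and hence the
  densities coincide.\<close>

lemma AE_zero_if_box_integrals_zero:
  fixes g :: "'a::euclidean_space \<Rightarrow> real"
  assumes g: "g \<in> borel_measurable borel" and B: "\<And>x. \<bar>g x\<bar> \<le> B"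
    and zero: "\<And>a b. (\<integral>x. indicator (box a b) x * g x \<partial>lborel) = 0"
  shows "AE x in lborel. g x = 0"
proof -
  have B0: "0 \<le> B" using B[of undefined] by (simp add: order_trans[OF abs_ge_zero])
  note [measurable] = g
  have pos: "0 \<le> g x + B" for x using B[of x] by (simp add: abs_le_iff)
  define M1 where "M1 = density lborel (\<lambda>x. ennreal (g x + B))"
  define M2 where "M2 = density lborel (\<lambda>x::'a. ennreal B)"
  have em: "emeasure M1 (box a b) = emeasure M2 (box a b)" for a b
  proof -
    have fin: "emeasure lborel (box a b) < \<infinity>" using emeasure_bounded_finite[OF bounded_box] by blast
    have ig: "integrable lborel (\<lambda>x. indicator (box a b) x * g x)"
      by (rule integrable_indicator_mult_bounded[of _ _ B]) (use B in \<open>auto intro: bounded_box\<close>)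
    have iB: "integrable lborel (\<lambda>x. indicator (box a b) x * B)" using fin by simp
    have "emeasure M1 (box a b) = (\<integral>\<^sup>+x. ennreal (indicator (box a b) x * (g x + B)) \<partial>lborel)"
      unfolding M1_def by (subst emeasure_density) (auto intro!: nn_integral_cong simp: indicator_def)
    also have "\<dots> = ennreal (\<integral>x. indicator (box a b) x * (g x + B) \<partial>lborel)"
    proof (rule nn_integral_eq_integral)
      show "integrable lborel (\<lambda>x. indicator (box a b) x * (g x + B))"
        using ig iB by (simp add: distrib_left)
      show "AE x in lborel. 0 \<le> indicator (box a b) x * (g x + B)" using pos by simp
    qed
    also have "(\<integral>x. indicator (box a b) x * (g x + B) \<partial>lborel) = (\<integral>x. indicator (box a b) x * B \<partial>lborel)"
      using ig iB zero[of a b] by (simp add: distrib_left)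
    also have "ennreal \<dots> = (\<integral>\<^sup>+x. ennreal (indicator (box a b) x * B) \<partial>lborel)"
      using iB B0 by (intro nn_integral_eq_integral[symmetric]) auto
    also have "\<dots> = emeasure M2 (box a b)"
      unfolding M2_def by (subst emeasure_density) (auto intro!: nn_integral_cong simp: indicator_def)
    finally show ?thesis .
  qed
  have "M1 = M2"
  proof (rule measure_eqI_generator_eq)
    let ?E = "range (\<lambda>(a, b). box a b::'a set)"
    show "Int_stable ?E" by (auto simp: Int_stable_def box_Int_box)
    show "?E \<subseteq> Pow UNIV" "sets M1 = sigma_sets UNIV ?E" "sets M2 = sigma_sets UNIV ?E"
      by (simp_all add: borel_eq_box M1_def M2_def)
    let ?A = "\<lambda>n::nat. box (- (real n *\<^sub>R One)) (real n *\<^sub>R One) :: 'a set"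
    show "range ?A \<subseteq> ?E" "(\<Union>i. ?A i) = UNIV" unfolding UN_box_eq_UNIV by auto
    show "emeasure M1 (?A i) \<noteq> \<infinity>" for i
    proof -
      have "emeasure M2 (?A i) = ennreal B * emeasure lborel (?A i)"
        unfolding M2_def by (simp add: emeasure_density_const)
      also have "\<dots> < \<infinity>" using emeasure_bounded_finite[OF bounded_box] by (simp add: ennreal_mult_less_top)
      finally show ?thesis using em by simp
    qed
    show "emeasure M1 X = emeasure M2 X" if "X \<in> ?E" for X using that em by auto
  qed
  then have "AE x in lborel. ennreal (g x + B) = ennreal B"
    unfolding M1_def M2_def by (intro sigma_finite_measure.density_unique[OF sigma_finite_lborel]) auto
  then show ?thesis by eventually_elim (use pos B0 in \<open>auto simp: ennreal_inj\<close>)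
qed

context
  fixes f :: "'a::euclidean_space \<Rightarrow> real" and C :: real
  assumes lip: "\<And>x y. \<bar>f x - f y\<bar> \<le> C * norm (x - y)"
begin

lemma borel_measurable_lip: "f \<in> borel_measurable borel"
  by (intro borel_measurable_continuous_onI lipschitz_imp_continuous_on[of _ C]) (use lip in simp)

lemma difference_quotient_bound:
  "\<bar>real (Suc n) * (f (x + (1 / real (Suc n)) *\<^sub>R v) - f x)\<bar> \<le> C * norm v"
proof -
  have "\<bar>f (x + (1 / real (Suc n)) *\<^sub>R v) - f x\<bar> \<le> C * ((1 / real (Suc n)) * norm v)"
    using lip[of "x + (1 / real (Suc n)) *\<^sub>R v" x] by simp
  then have "real (Suc n) * \<bar>f (x + (1 / real (Suc n)) *\<^sub>R v) - f x\<bar> \<le> real (Suc n) * (C * ((1 / real (Suc n)) * norm v))"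
    by (rule mult_left_mono) simp
  then show ?thesis by (simp add: abs_mult)
qed

lemma AE_directional_deriv:
  "AE x in lborel. ((\<lambda>t. f (x + t *\<^sub>R v)) has_real_derivative directional_deriv f v x) (at 0)"
  using AE_directional_derivative[OF lip, of v]
  by eventually_elim (use directional_deriv_eq in blast)

lemma AE_directional_deriv_bound: "AE x in lborel. \<bar>directional_deriv f v x\<bar> \<le> C * norm v"
  using AE_directional_deriv[of v]
proof eventually_elim
  case (elim x)
  have "(\<lambda>n. \<bar>real (Suc n) * (f (x + (1 / real (Suc n)) *\<^sub>R v) - f x)\<bar>) \<longlonglongrightarrow> \<bar>directional_deriv f v x\<bar>"
    by (intro tendsto_rabs difference_quotient_LIMSEQ elim)
  then show ?case by (rule LIMSEQ_le_const2) (use difference_quotient_bound in blast)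
qed

text \<open>The increment along \<^term>\<open>v + w\<close> is an increment along \<^term>\<open>v\<close> followed by one along
  \<^term>\<open>w\<close> from a shifted point; over a box the shift is negligible in the limit.\<close>

lemma box_integral_directional_deriv_add:
  "(\<integral>x. indicator (box a b) x * directional_deriv f (v + w) x \<partial>lborel) =
   (\<integral>x. indicator (box a b) x * directional_deriv f w x \<partial>lborel) +
   (\<integral>x. indicator (box a b) x * directional_deriv f v x \<partial>lborel)"
proof -
  let ?S = "box a b"
  note [measurable] = borel_measurable_lip borel_measurable_directional_deriv[OF borel_measurable_lip]
  define q where "q n u x = real (Suc n) * (f (x + (1 / real (Suc n)) *\<^sub>R u) - f x)" for n u x
  have qm[measurable]: "q n u \<in> borel_measurable borel" for n u unfolding q_def by measurable
  have qb: "\<bar>q n u x\<bar> \<le> C * norm u" for n u x unfolding q_def by (rule difference_quotient_bound)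
  have Cu: "0 \<le> C * norm u" for u :: 'a using qb[of 0 u 0] by (simp add: order_trans[OF abs_ge_zero])
  have qlim: "AE x in lborel. (\<lambda>n. q n u x) \<longlonglongrightarrow> directional_deriv f u x" for u
    using AE_directional_deriv[of u] unfolding q_def
    by eventually_elim (rule difference_quotient_LIMSEQ)
  obtain R where R: "?S \<subseteq> cball 0 R"
  proof -
    obtain R where "\<forall>x\<in>?S. norm x \<le> R" using bounded_box[of a b] by (auto simp: bounded_iff)
    then have "?S \<subseteq> cball 0 R" by auto
    then show ?thesis by (rule that)
  qed
  have ind_int: "integrable lborel (\<lambda>x::'a. indicator (cball 0 r) x * c)" for r and c :: real
    using emeasure_bounded_finite[OF bounded_cball[of "0::'a" r]] by simp
  have lim: "(\<lambda>n. \<integral>x. indicator ?S x * q n u x \<partial>lborel) \<longlonglongrightarrow> (\<integral>x. indicator ?S x * directional_deriv f u x \<partial>lborel)" for u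
  proof (rule integral_dominated_convergence[where w = "\<lambda>x. indicator (cball 0 R) x * (C * norm u)"])
    show "AE x in lborel. (\<lambda>n. indicator ?S x * q n u x) \<longlonglongrightarrow> indicator ?S x * directional_deriv f u x"
      using qlim[of u] by eventually_elim (intro tendsto_intros)
    show "AE x in lborel. norm (indicator ?S x * q n u x) \<le> indicator (cball 0 R) x * (C * norm u)" for n
      by (rule AE_I2) (use qb Cu R in \<open>auto simp: indicator_def abs_mult\<close>)
    show "integrable lborel (\<lambda>x::'a. indicator (cball 0 R) x * (C * norm u))" by (rule ind_int)
  qed measurable
  define s where "s n = (1 / real (Suc n)) *\<^sub>R v" for n
  have s0: "s \<longlonglongrightarrow> 0"
  proof -
    have "(\<lambda>n. inverse (real (Suc n)) *\<^sub>R v) \<longlonglongrightarrow> 0 *\<^sub>R v"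
      by (intro tendsto_intros LIMSEQ_inverse_real_of_nat)
    then show ?thesis by (simp add: s_def[abs_def] inverse_eq_divide)
  qed
  have sn: "norm (s n) \<le> norm v" for n
    by (simp add: s_def divide_le_eq mult_le_cancel_left1)
  \<comment> \<open>At a point off the frontier of the box the shift by \<open>s n\<close>
    eventually leaves the indicator unchanged.\<close>
  have fr: "frontier ?S \<in> null_sets lborel"
    using negligible_convex_frontier[OF convex_box(2), of a b]
    by (simp add: negligible_iff_null_sets null_sets_completion_iff)
  have lim2: "(\<lambda>n. \<integral>x. indicator ?S (x - s n) * q n w x \<partial>lborel) \<longlonglongrightarrow> (\<integral>x. indicator ?S x * directional_deriv f w x \<partial>lborel)"
  proof (rule integral_dominated_convergence[where w = "\<lambda>x. indicator (cball 0 (R + norm v)) x * (C * norm w)"])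
    show "AE x in lborel. (\<lambda>n. indicator ?S (x - s n) * q n w x) \<longlonglongrightarrow> indicator ?S x * directional_deriv f w x"
      using qlim[of w] AE_not_in[OF fr]
    proof eventually_elim
      case (elim x)
      have xs: "(\<lambda>n. x - s n) \<longlonglongrightarrow> x" using tendsto_diff[OF tendsto_const s0, of x] by simp
      have "eventually (\<lambda>n. indicator ?S (x - s n) = (indicator ?S x :: real)) sequentially"
      proof (cases "x \<in> ?S")
        case True
        show ?thesis
          by (rule eventually_mono[OF topological_tendstoD[OF xs open_box True]]) (use True in simp)
      next
        case False
        then have "x \<in> - closure ?S" using elim(2) open_box[of a b] by (auto simp: frontier_def interior_open)
        then have "eventually (\<lambda>n. x - s n \<in> - closure ?S) sequentially"
          using topological_tendstoD[OF xs, of "- closure ?S"] by auto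
        then show ?thesis
          by eventually_elim (use False closure_subset[of ?S] in \<open>auto simp: indicator_def\<close>)
      qed
      then have "(\<lambda>n. indicator ?S (x - s n) :: real) \<longlonglongrightarrow> indicator ?S x"
        by (rule tendsto_eventually)
      then show ?case by (intro tendsto_mult elim(1))
    qed
    show "AE x in lborel. norm (indicator ?S (x - s n) * q n w x) \<le> indicator (cball 0 (R + norm v)) x * (C * norm w)" for n
    proof (rule AE_I2)
      fix x
      have "x \<in> cball 0 (R + norm v)" if "x - s n \<in> ?S"
      proof -
        have "norm (x - s n) \<le> R" using that R by auto
        then show ?thesis using sn[of n] norm_triangle_sub[of x "s n"] by simp
      qed
      then show "norm (indicator ?S (x - s n) * q n w x) \<le> indicator (cball 0 (R + norm v)) x * (C * norm w)"
        using qb[of n w x] Cu[of w] by (auto simp: indicator_def abs_mult)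
    qed
    show "integrable lborel (\<lambda>x::'a. indicator (cball 0 (R + norm v)) x * (C * norm w))" by (rule ind_int)
  qed measurable
  have split: "(\<integral>x. indicator ?S x * q n (v + w) x \<partial>lborel) =
      (\<integral>x. indicator ?S (x - s n) * q n w x \<partial>lborel) + (\<integral>x. indicator ?S x * q n v x \<partial>lborel)" for n
  proof -
    have e: "q n (v + w) x = q n w (x + s n) + q n v x" for x
      by (simp add: q_def s_def scaleR_add_right algebra_simps)
    have i1: "integrable lborel (\<lambda>x. indicator ?S x * q n w (x + s n))"
      by (rule integrable_indicator_mult_bounded[of _ _ "C * norm w"])
        (use qb in \<open>auto intro: bounded_box\<close>)
    have i2: "integrable lborel (\<lambda>x. indicator ?S x * q n v x)"
      by (rule integrable_indicator_mult_bounded[of _ _ "C * norm v"])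
        (use qb in \<open>auto intro: bounded_box\<close>)
    have "(\<integral>x. indicator ?S x * q n (v + w) x \<partial>lborel) =
        (\<integral>x. indicator ?S x * q n w (x + s n) \<partial>lborel) + (\<integral>x. indicator ?S x * q n v x \<partial>lborel)"
      unfolding e distrib_left by (rule Bochner_Integration.integral_add[OF i1 i2])
    also have "(\<integral>x. indicator ?S x * q n w (x + s n) \<partial>lborel) = (\<integral>x. indicator ?S (x - s n) * q n w x \<partial>lborel)"
      using integral_lborel_shift[of "\<lambda>x. indicator ?S (x - s n) * q n w x" "s n"] by simp
    finally show ?thesis .
  qed
  have "(\<lambda>n. \<integral>x. indicator ?S x * q n (v + w) x \<partial>lborel) \<longlonglongrightarrow>
      (\<integral>x. indicator ?S x * directional_deriv f w x \<partial>lborel) +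
      (\<integral>x. indicator ?S x * directional_deriv f v x \<partial>lborel)"
    unfolding split by (intro tendsto_add lim lim2)
  then show ?thesis using lim[of "v + w"] LIMSEQ_unique by blast
qed

text \<open>The defect of additivity integrates to 0 over every box. It is truncated at
  \<open>B\<close> because its bound holds only almost everywhere, whereas the box criterion asks
  for a bound at every point.\<close>

lemma AE_directional_deriv_add:
  "AE x in lborel. directional_deriv f (v + w) x = directional_deriv f v x + directional_deriv f w x"
proof -
  note [measurable] = borel_measurable_directional_deriv[OF borel_measurable_lip]
  define B where "B = C * norm (v + w) + C * norm v + C * norm w"
  have Cu: "0 \<le> C * norm u" for u :: 'a
    using difference_quotient_bound[of 0 0 u] by (simp add: order_trans[OF abs_ge_zero])
  then have B0: "0 \<le> B" by (simp add: B_def)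
  define g where "g x = directional_deriv f (v + w) x - directional_deriv f v x - directional_deriv f w x" for x
  define g' where "g' x = max (- B) (min B (g x))" for x
  have [measurable]: "g \<in> borel_measurable borel" "g' \<in> borel_measurable borel"
    unfolding g_def g'_def by measurable
  have gg': "AE x in lborel. g' x = g x"
    using AE_directional_deriv_bound[of v] AE_directional_deriv_bound[of w] AE_directional_deriv_bound[of "v + w"]
  proof eventually_elim
    case (elim x)
    then have "\<bar>g x\<bar> \<le> B" by (simp add: g_def B_def abs_le_iff)
    then show ?case by (auto simp: g'_def abs_le_iff)
  qed
  have "AE x in lborel. g' x = 0"
  proof (rule AE_zero_if_box_integrals_zero[of _ B])
    show "\<bar>g' x\<bar> \<le> B" for x using B0 by (auto simp: g'_def)
    fix a b :: 'a
    have i: "integrable lborel (\<lambda>x. indicator (box a b) x * directional_deriv f u x)" for u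
      by (rule integrable_indicator_mult_bounded[OF _ _ AE_directional_deriv_bound])
        (auto intro: bounded_box)
    have "(\<integral>x. indicator (box a b) x * g' x \<partial>lborel) = (\<integral>x. indicator (box a b) x * g x \<partial>lborel)"
      using gg' by (intro integral_cong_AE) (auto elim: AE_mp)
    also have "\<dots> = 0"
      unfolding g_def right_diff_distrib
      using box_integral_directional_deriv_add[of a b v w] by (simp add: i)
    finally show "(\<integral>x. indicator (box a b) x * g' x \<partial>lborel) = 0" .
  qed measurable
  with gg' show ?thesis by eventually_elim (simp add: g_def)
qed

lemma AE_directional_deriv_sum:
  fixes c :: "'a \<Rightarrow> real"
  assumes "finite F"
  shows "AE x in lborel. directional_deriv f (\<Sum>b\<in>F. c b *\<^sub>R b) x = (\<Sum>b\<in>F. c b * directional_deriv f b x)"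
  using assms
proof (induction F rule: finite_induct)
  case empty
  have "directional_deriv f 0 x = 0" for x by (rule directional_deriv_eq) simp
  then show ?case by simp
next
  case (insert b F)
  have "AE x in lborel. directional_deriv f (c b *\<^sub>R b) x = c b * directional_deriv f b x"
    using AE_directional_deriv[of b]
  proof eventually_elim
    case (elim x)
    have "((\<lambda>t. f (x + (c b * t) *\<^sub>R b)) has_real_derivative (directional_deriv f b x * c b)) (at 0)"
      by (rule DERIV_chain'[where g = "\<lambda>t. f (x + t *\<^sub>R b)" and f = "\<lambda>t. c b * t" and x = 0])
        (use elim in \<open>auto intro!: derivative_eq_intros\<close>)
    then have "((\<lambda>t. f (x + t *\<^sub>R (c b *\<^sub>R b))) has_real_derivative (directional_deriv f b x * c b)) (at 0)"
      by (simp add: mult.commute)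
    from directional_deriv_eq[OF this] show ?case by simp
  qed
  then show ?case
    using insert.IH AE_directional_deriv_add[of "c b *\<^sub>R b" "\<Sum>b\<in>F. c b *\<^sub>R b"]
    by eventually_elim (use insert.hyps in simp)
qed

text \<open>For almost every x the derivatives along all vectors of a countable dense set exist and
  are given by one vector \<open>G x\<close>. Compactness of the unit sphere leaves finitely many
  directions at each precision, and the Lipschitz bound controls the directions in between.\<close>

theorem Rademacher_real: "AE x in lborel. f differentiable (at x)"
proof -
  define G where "G x = (\<Sum>b\<in>Basis. directional_deriv f b x *\<^sub>R b)" for x
  obtain W :: "'a set" where W: "countable W" "\<And>U. open U \<Longrightarrow> U \<noteq> {} \<Longrightarrow> \<exists>w\<in>W. w \<in> U"
    by (erule countable_dense_setE)
  have "AE x in lborel. \<forall>w\<in>W. ((\<lambda>t. f (x + t *\<^sub>R w)) has_real_derivative (G x \<bullet> w)) (at 0)"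
  proof (subst AE_ball_countable[OF W(1)], intro ballI)
    fix w
    have "AE x in lborel. directional_deriv f w x = (\<Sum>b\<in>Basis. (w \<bullet> b) * directional_deriv f b x)"
      using AE_directional_deriv_sum[of Basis "\<lambda>b. w \<bullet> b"] by (simp add: euclidean_representation)
    then show "AE x in lborel. ((\<lambda>t. f (x + t *\<^sub>R w)) has_real_derivative (G x \<bullet> w)) (at 0)"
      using AE_directional_deriv[of w]
    proof eventually_elim
      case (elim x)
      have "G x \<bullet> w = directional_deriv f w x"
        unfolding G_def elim(1) inner_sum_left by (simp add: inner_commute mult.commute)
      then show ?case using elim(2) by simp
    qed
  qed
  then show ?thesis
  proof eventually_elim
    case (elim x)
    have "(f has_derivative (\<lambda>h. G x \<bullet> h)) (at x)"
      unfolding has_derivative_within_alt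
    proof (safe)
      show "bounded_linear ((\<bullet>) (G x))" by (rule bounded_linear_inner_right)
      fix e :: real assume e: "e > 0"
      define K where "K = \<bar>C\<bar> + norm (G x) + 1"
      have K: "K > 0" by (simp add: K_def add_nonneg_pos)
      \<comment> \<open>Replacing a unit direction by one of the finitely many costs at most |C| r
        in \<open>f\<close> and |G x| r in the linear part, together at most e/2; the other e/2 goes
        to the difference quotients.\<close>
      define r where "r = e / (2 * K)"
      have r: "r > 0" using e K by (simp add: r_def)
      have cov: "sphere 0 1 \<subseteq> (\<Union>w\<in>W. ball w r)"
      proof
        fix u :: 'a assume "u \<in> sphere 0 1"
        obtain w where "w \<in> W" "w \<in> ball u r" using W(2)[of "ball u r"] r by auto
        then show "u \<in> (\<Union>w\<in>W. ball w r)" by (auto simp: dist_commute)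
      qed
      obtain W' where W': "W' \<subseteq> W" "finite W'" "sphere 0 1 \<subseteq> (\<Union>w\<in>W'. ball w r)"
        using compactE_image[OF compact_sphere _ cov] by blast
      have "\<exists>d>0. \<forall>t. \<bar>t\<bar> < d \<longrightarrow> \<bar>f (x + t *\<^sub>R w) - f x - t * (G x \<bullet> w)\<bar> \<le> (e/2) * \<bar>t\<bar>" if "w \<in> W'" for w
      proof -
        have "((\<lambda>t. f (x + t *\<^sub>R w)) has_derivative (\<lambda>t. (G x \<bullet> w) * t)) (at 0)"
          using elim W' that unfolding has_field_derivative_def by blast
        then have "\<exists>d>0. \<forall>t. norm (t - 0) < d \<longrightarrow>
            norm (f (x + t *\<^sub>R w) - f (x + 0 *\<^sub>R w) - (G x \<bullet> w) * (t - 0)) \<le> (e/2) * norm (t - 0)"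
          using e unfolding has_derivative_within_alt by (elim conjE allE[of _ "e/2"]) auto
        then show ?thesis by (simp add: mult.commute)
      qed
      then obtain d where d: "\<And>w. w \<in> W' \<Longrightarrow> d w > 0"
        "\<And>w t. w \<in> W' \<Longrightarrow> \<bar>t\<bar> < d w \<Longrightarrow> \<bar>f (x + t *\<^sub>R w) - f x - t * (G x \<bullet> w)\<bar> \<le> (e/2) * \<bar>t\<bar>"
        by metis
      define \<delta> where "\<delta> = Min (insert 1 (d ` W'))"
      have \<delta>: "\<delta> > 0" unfolding \<delta>_def using W'(2) d(1) by (subst Min_gr_iff) auto
      have \<delta>d: "\<delta> \<le> d w" if "w \<in> W'" for w unfolding \<delta>_def using W'(2) that by (intro Min_le) auto
      show "\<exists>d>0. \<forall>y\<in>UNIV. norm (y - x) < d \<longrightarrow> norm (f y - f x - G x \<bullet> (y - x)) \<le> e * norm (y - x)"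
      proof (intro exI[of _ \<delta>] conjI \<delta> ballI impI)
        fix y assume y: "norm (y - x) < \<delta>"
        show "norm (f y - f x - G x \<bullet> (y - x)) \<le> e * norm (y - x)"
        proof (cases "y = x")
          case False
          define t where "t = norm (y - x)"
          define u where "u = (1/t) *\<^sub>R (y - x)"
          have t: "t > 0" using False by (simp add: t_def)
          have yu: "y = x + t *\<^sub>R u" using t by (simp add: u_def)
          have "u \<in> sphere 0 1" using t by (simp add: u_def t_def)
          then obtain w where w: "w \<in> W'" "dist w u < r" using W'(3) by auto
          have uw: "norm (u - w) \<le> r" using w(2) by (simp add: dist_norm norm_minus_commute)
          have "\<bar>f (x + t *\<^sub>R u) - f (x + t *\<^sub>R w)\<bar> \<le> C * norm ((x + t *\<^sub>R u) - (x + t *\<^sub>R w))" by (rule lip)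
          also have "(x + t *\<^sub>R u) - (x + t *\<^sub>R w) = t *\<^sub>R (u - w)" by (simp add: algebra_simps)
          also have "C * norm (t *\<^sub>R (u - w)) \<le> \<bar>C\<bar> * (t * r)"
            using t uw by (simp add: mult_mono)
          finally have 1: "\<bar>f (x + t *\<^sub>R u) - f (x + t *\<^sub>R w)\<bar> \<le> \<bar>C\<bar> * (t * r)" .
          have 2: "\<bar>f (x + t *\<^sub>R w) - f x - t * (G x \<bullet> w)\<bar> \<le> (e/2) * t"
            using d(2)[OF w(1), of t] y \<delta>d[OF w(1)] t by (simp add: t_def)
          have "\<bar>G x \<bullet> (w - u)\<bar> \<le> norm (G x) * r"
            using Cauchy_Schwarz_ineq2[of "G x" "w - u"] uw
            by (metis mult_left_mono norm_ge_zero norm_minus_commute order_trans)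
          then have 3: "\<bar>t * (G x \<bullet> (w - u))\<bar> \<le> t * (norm (G x) * r)"
            using t by (simp add: abs_mult)
          have "f y - f x - G x \<bullet> (y - x) = (f (x + t *\<^sub>R u) - f (x + t *\<^sub>R w)) +
              (f (x + t *\<^sub>R w) - f x - t * (G x \<bullet> w)) + t * (G x \<bullet> (w - u))"
            by (simp add: yu inner_diff_right algebra_simps)
          then have "\<bar>f y - f x - G x \<bullet> (y - x)\<bar> \<le> \<bar>C\<bar> * (t * r) + (e/2) * t + t * (norm (G x) * r)"
            using 1 2 3 by linarith
          also have "\<dots> = t * ((\<bar>C\<bar> + norm (G x)) * r + e/2)" by (simp add: algebra_simps)
          also have "\<dots> \<le> t * (K * r + e/2)"
            using t r by (intro mult_left_mono add_right_mono mult_right_mono) (auto simp: K_def)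
          also have "K * r = e/2" using K by (simp add: r_def)
          finally show ?thesis by (simp add: t_def mult.commute)
        qed simp
      qed
    qed
    then show ?case unfolding differentiable_def by blast
  qed
qed

end

theorem Rademacher:
  fixes f :: "'a::euclidean_space \<Rightarrow> 'b::euclidean_space"
  assumes lip: "\<And>x y. norm (f x - f y) \<le> C * norm (x - y)"
  shows "AE x in lborel. f differentiable (at x)"
proof -
  have "AE x in lborel. (\<lambda>x. f x \<bullet> b) differentiable (at x)" if "b \<in> Basis" for b
  proof (rule Rademacher_real)
    fix x y
    have "\<bar>f x \<bullet> b - f y \<bullet> b\<bar> \<le> norm (f x - f y)"
      using that by (metis Basis_le_norm inner_diff_left)
    then show "\<bar>f x \<bullet> b - f y \<bullet> b\<bar> \<le> C * norm (x - y)" using lip by (rule order_trans)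
  qed
  then have "AE x in lborel. \<forall>b\<in>Basis. (\<lambda>x. f x \<bullet> b) differentiable (at x)"
    by (intro AE_finite_allI) auto
  then show ?thesis by eventually_elim (simp add: differentiable_componentwise_within[of f])
qed

section \<open>Alexandrov's theorem\<close>

text \<open>Sard's lemma in the library needs a well-ordered index type.\<close>

typedef ('a::finite) ord_index = "{..<CARD('a)}"
  by (rule exI[of _ 0]) simp

lemma card_ord_index: "CARD('a::finite ord_index) = CARD('a)"
  using type_definition.card[OF type_definition_ord_index[where 'a = 'a]] by simp

instance ord_index :: (finite) finite
proof
  have "(UNIV :: 'a ord_index set) = Abs_ord_index ` {..<CARD('a)}"
    using type_definition.Abs_image[OF type_definition_ord_index[where 'a = 'a]] by simp
  then show "finite (UNIV :: 'a ord_index set)" by (metis finite_imageI finite_lessThan)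
qed

instantiation ord_index :: (finite) wellorder
begin

definition less_eq_ord_index :: "'a ord_index \<Rightarrow> 'a ord_index \<Rightarrow> bool" where
  "less_eq_ord_index x y \<longleftrightarrow> Rep_ord_index x \<le> Rep_ord_index y"

definition less_ord_index :: "'a ord_index \<Rightarrow> 'a ord_index \<Rightarrow> bool" where
  "less_ord_index x y \<longleftrightarrow> Rep_ord_index x < Rep_ord_index y"

instance
proof
  fix x y z :: "'a ord_index"
  show "(x < y) = (x \<le> y \<and> \<not> y \<le> x)"
    by (auto simp: less_ord_index_def less_eq_ord_index_def)
  show "x \<le> x" by (simp add: less_eq_ord_index_def)
  show "x \<le> y \<Longrightarrow> y \<le> z \<Longrightarrow> x \<le> z" by (simp add: less_eq_ord_index_def)
  show "x \<le> y \<Longrightarrow> y \<le> x \<Longrightarrow> x = y"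
    by (simp add: less_eq_ord_index_def Rep_ord_index_inject[symmetric])
  show "x \<le> y \<or> y \<le> x" by (auto simp: less_eq_ord_index_def)
next
  fix P :: "'a ord_index \<Rightarrow> bool" and a
  assume *: "\<And>x. (\<And>y. y < x \<Longrightarrow> P y) \<Longrightarrow> P x"
  show "P a"
    by (induction "Rep_ord_index a" arbitrary: a rule: less_induct)
      (use * in \<open>auto simp: less_ord_index_def\<close>)
qed

end

text \<open>Relabelling coordinates by the linear bijections \<open>w\<close> and \<open>u\<close>
  moves \<open>f\<close> to the well-ordered index type, where \<open>baby_Sard\<close> applies: a
  kernel vector lowers the rank of the derivative. The way back is Lipschitz and preserves null
  sets.\<close>

lemma negligible_image_singular_derivative:
  fixes f :: "real^'n \<Rightarrow> real^'n"
  assumes der: "\<And>x. x \<in> S \<Longrightarrow> (f has_derivative f' x) (at x)"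
    and sing: "\<And>x. x \<in> S \<Longrightarrow> \<exists>h. h \<noteq> 0 \<and> f' x h = 0"
  shows "negligible (f ` S)"
proof -
  obtain \<sigma> :: "'n ord_index \<Rightarrow> 'n" where \<sigma>: "bij \<sigma>"
    using finite_same_card_bij[of "UNIV :: 'n ord_index set" "UNIV :: 'n set"] card_ord_index by auto
  define u where "u v = (\<chi> i. v $ inv \<sigma> i)" for v :: "real^('n ord_index)"
  define w where "w v = (\<chi> i. v $ \<sigma> i)" for v :: "real^'n"
  have uw: "u (w v) = v" for v using \<sigma> by (simp add: u_def w_def vec_eq_iff bij_is_surj surj_f_inv_f)
  have wu: "w (u v) = v" for v using \<sigma> by (simp add: u_def w_def vec_eq_iff bij_is_inj)
  have lu: "linear u" and lw: "linear w"
    by (auto intro!: linearI simp: u_def w_def vec_eq_iff)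
  have bu: "bounded_linear u" and bw: "bounded_linear w"
    using lu lw linear_conv_bounded_linear by blast+
  have "negligible ((w \<circ> f \<circ> u) ` (w ` S))"
  proof (rule baby_Sard)
    fix x assume "x \<in> w ` S"
    then have xS: "u x \<in> S" by (auto simp: uw)
    have "((w \<circ> (f \<circ> u)) has_derivative (w \<circ> (f' (u x) \<circ> u))) (at x within w ` S)"
    proof (rule diff_chain_within)
      show "(f \<circ> u has_derivative f' (u x) \<circ> u) (at x within w ` S)"
        by (rule diff_chain_within) (use bu der[OF xS] in \<open>auto intro: bounded_linear_imp_has_derivative has_derivative_at_withinI\<close>)
      show "(w has_derivative w) (at ((f \<circ> u) x) within (f \<circ> u) ` w ` S)"
        using bw by (rule bounded_linear_imp_has_derivative)
    qed
    then show "((w \<circ> f \<circ> u) has_derivative (w \<circ> f' (u x) \<circ> u)) (at x within w ` S)"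
      by (simp add: comp_assoc)
    have lin: "linear (w \<circ> f' (u x) \<circ> u)"
      using lu lw has_derivative_linear[OF der[OF xS]] by (intro linear_compose)
    obtain h where h: "h \<noteq> 0" "f' (u x) h = 0" using sing[OF xS] by blast
    let ?A = "matrix (w \<circ> f' (u x) \<circ> u)"
    have "?A *v (w h) = 0" using fun_cong[OF matrix_vector_mul(2)[OF lin], of "w h"] by (simp add: uw h linear_0[OF lw])
    moreover have "w h \<noteq> 0" using h uw linear_0[OF lu] by metis
    ultimately have "\<not> inj ((*v) ?A)"
      by (metis injD matrix_vector_mult_0_right)
    then have "rank ?A \<noteq> CARD('n ord_index)" using full_rank_injective by blast
    moreover have "rank ?A \<le> CARD('n ord_index)" using rank_bound[of ?A] by simp
    ultimately show "rank ?A < CARD('n ord_index)" by simp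
  qed simp
  moreover have "(w \<circ> f \<circ> u) ` (w ` S) = w ` f ` S" by (simp add: image_comp o_def uw)
  ultimately have n: "negligible (w ` f ` S)" by simp
  obtain K where K: "\<And>v. norm (u v) \<le> norm v * K" using bounded_linear.bounded[OF bu] by blast
  have "negligible (u ` (w ` f ` S))"
  proof (rule negligible_locally_Lipschitz_image[OF _ n])
    show "DIM(real^('n ord_index)) \<le> DIM(real^'n)" by (simp add: card_ord_index)
    show "\<exists>T B. open T \<and> x \<in> T \<and> (\<forall>y\<in>w ` f ` S \<inter> T. norm (u y - u x) \<le> B * norm (y - x))" for x
      using K by (intro exI[of _ UNIV] exI[of _ K]) (simp add: linear_diff[OF lu, symmetric] mult.commute)
  qed
  then show ?thesis by (simp add: image_comp o_def uw)
qed

section \<open>Extension of Lipschitz maps\<close>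

text \<open>McShane's formula: the infimum of the upward cones of slope \<open>K\<close> placed on
  the graph over \<open>S\<close>.\<close>

lemma lipschitz_extension_real:
  fixes f :: "'a::real_normed_vector \<Rightarrow> real"
  assumes lip: "\<And>x y. x \<in> S \<Longrightarrow> y \<in> S \<Longrightarrow> \<bar>f x - f y\<bar> \<le> K * norm (x - y)" and K: "0 \<le> K"
  shows "\<exists>F. (\<forall>x\<in>S. F x = f x) \<and> (\<forall>x y. \<bar>F x - F y\<bar> \<le> K * norm (x - y))"
proof (cases "S = {}")
  case True
  then show ?thesis using K by (intro exI[of _ "\<lambda>_. 0"]) simp
next
  case False
  then obtain a where a: "a \<in> S" by blast
  define F where "F x = (INF y\<in>S. f y + K * norm (x - y))" for x
  have bdd: "bdd_below ((\<lambda>y. f y + K * norm (x - y)) ` S)" for x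
  proof (rule bdd_belowI2)
    fix y assume y: "y \<in> S"
    have "f a - f y \<le> K * norm (a - y)" using lip[OF a y] by simp
    also have "\<dots> \<le> K * (norm (a - x) + norm (x - y))"
      using K norm_triangle_ineq[of "a - x" "x - y"] by (intro mult_left_mono) auto
    finally show "f a - K * norm (a - x) \<le> f y + K * norm (x - y)" by (simp add: algebra_simps)
  qed
  have "F x = f x" if x: "x \<in> S" for x
  proof (rule antisym)
    show "F x \<le> f x" unfolding F_def using cINF_lower[OF bdd x, of x] by simp
    show "f x \<le> F x" unfolding F_def
    proof (rule cINF_greatest[OF False])
      fix y assume "y \<in> S"
      then show "f x \<le> f y + K * norm (x - y)" using lip[OF x, of y] by simp
    qed
  qed
  moreover have *: "F x \<le> F y + K * norm (x - y)" for x y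
  proof -
    have "F x - K * norm (x - y) \<le> F y" unfolding F_def[of y]
    proof (rule cINF_greatest[OF False])
      fix z assume z: "z \<in> S"
      have "F x \<le> f z + K * norm (x - z)" unfolding F_def by (rule cINF_lower[OF bdd z])
      also have "\<dots> \<le> f z + K * (norm (x - y) + norm (y - z))"
        using K norm_triangle_ineq[of "x - y" "y - z"] by (intro add_left_mono mult_left_mono) auto
      finally show "F x - K * norm (x - y) \<le> f z + K * norm (y - z)" by (simp add: algebra_simps)
    qed
    then show ?thesis by simp
  qed
  moreover have "\<bar>F x - F y\<bar> \<le> K * norm (x - y)" for x y
    using *[of x y] *[of y x] by (simp add: norm_minus_commute abs_le_iff)
  ultimately show ?thesis by blast
qed

text \<open>Extending coordinatewise multiplies the constant by the dimension. Nonexpansiveness is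
  lost, but Rademacher's theorem asks only for some constant.\<close>

lemma lipschitz_extension:
  fixes f :: "'a::real_normed_vector \<Rightarrow> 'b::euclidean_space"
  assumes lip: "\<And>x y. x \<in> S \<Longrightarrow> y \<in> S \<Longrightarrow> norm (f x - f y) \<le> K * norm (x - y)" and K: "0 \<le> K"
  shows "\<exists>F C. (\<forall>x\<in>S. F x = f x) \<and> (\<forall>x y. norm (F x - F y) \<le> C * norm (x - y))"
proof -
  have "\<exists>G. (\<forall>x\<in>S. G x = f x \<bullet> b) \<and> (\<forall>x y. \<bar>G x - G y\<bar> \<le> K * norm (x - y))" if "b \<in> Basis" for b
  proof (rule lipschitz_extension_real[OF _ K])
    fix x y assume "x \<in> S" "y \<in> S"
    have "\<bar>f x \<bullet> b - f y \<bullet> b\<bar> \<le> norm (f x - f y)"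
      using that by (metis Basis_le_norm inner_diff_left)
    then show "\<bar>f x \<bullet> b - f y \<bullet> b\<bar> \<le> K * norm (x - y)"
      using lip[OF \<open>x \<in> S\<close> \<open>y \<in> S\<close>] by (rule order_trans)
  qed
  then obtain G where G: "\<And>b x. b \<in> Basis \<Longrightarrow> x \<in> S \<Longrightarrow> G b x = f x \<bullet> b"
    "\<And>b x y. b \<in> Basis \<Longrightarrow> \<bar>G b x - G b y\<bar> \<le> K * norm (x - y)" by metis
  define F where "F x = (\<Sum>b\<in>Basis. G b x *\<^sub>R b)" for x
  have "F x = f x" if "x \<in> S" for x
    unfolding F_def using G(1)[OF _ that] by (simp add: euclidean_representation)
  moreover have "norm (F x - F y) \<le> (real DIM('b) * K) * norm (x - y)" for x y
  proof -
    have "norm (F x - F y) = norm (\<Sum>b\<in>Basis. (G b x - G b y) *\<^sub>R b)"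
      by (simp add: F_def sum_subtractf scaleR_left_diff_distrib)
    also have "\<dots> \<le> (\<Sum>b\<in>(Basis::'b set). K * norm (x - y))"
      by (rule sum_norm_le) (use G(2) in auto)
    finally show ?thesis by simp
  qed
  ultimately show ?thesis by blast
qed

section \<open>First order expansion of the subdifferential\<close>

lemma AE_lborel_negligible:
  assumes "AE x in lborel. P x"
  shows "negligible {x. \<not> P x}"
proof -
  obtain N where "\<And>x. x \<in> space lborel - N \<Longrightarrow> P x" "N \<in> null_sets lborel"
    using AE_E3[OF assms] by blast
  then have "N \<in> null_sets lborel" "{x. \<not> P x} \<subseteq> N" by auto
  then show ?thesis using negligible_iff_null_sets negligible_subset null_sets_completionI by blast
qed

text \<open>The map \<open>x + p \<mapsto> x\<close>, \<open>p\<close> a subgradient at \<open>x\<close>, is nonexpansive, since subgradients are monotone.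
  Hence it is differentiable almost everywhere, and by Sard's lemma with invertible derivative at
  the points relevant to almost every \<open>x\<close>. Inverting it differentiates the subgradients.\<close>

lemma subgrad_differentiable_AE:
  fixes f :: "real^'n \<Rightarrow> real"
  assumes f: "convex_on D f"
  shows "\<exists>N. negligible N \<and> (\<forall>x\<in>interior D - N. \<exists>p M. linear M \<and> subgrad D f x = {p} \<and>
    (\<forall>e>0. \<exists>d>0. \<forall>y\<in>ball x d. \<forall>q\<in>subgrad D f y. norm (q - p - M (y - x)) \<le> e * norm (y - x)))"
proof -
  define S where "S = {y. \<exists>x. y - x \<in> subgrad D f x}"
  have nonexp: "norm (x - x') \<le> norm (y - y')"
    if "y - x \<in> subgrad D f x" "y' - x' \<in> subgrad D f x'" for x y x' y'
  proof -
    have "0 \<le> ((y - x) - (y' - x')) \<bullet> (x - x')" by (rule subgrad_monotone[OF that])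
    then have "(x - x') \<bullet> (x - x') \<le> (y - y') \<bullet> (x - x')" by (simp add: inner_diff_left algebra_simps)
    also have "\<dots> \<le> norm (y - y') * norm (x - x')" by (rule norm_cauchy_schwarz)
    finally have "norm (x - x') * norm (x - x') \<le> norm (y - y') * norm (x - x')"
      by (simp add: dot_square_norm power2_eq_square)
    then show ?thesis
      by (metis linorder_not_le mult_le_cancel_right norm_ge_zero order_trans)
  qed
  define J where "J y = (SOME x. y - x \<in> subgrad D f x)" for y
  have J: "y - J y \<in> subgrad D f (J y)" if "y \<in> S" for y
    using that unfolding S_def J_def by (auto intro: someI_ex)
  have Jlip: "norm (J y - J y') \<le> 1 * norm (y - y')" if "y \<in> S" "y' \<in> S" for y y'
    using nonexp[OF J[OF that(1)] J[OF that(2)]] by simp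
  obtain F C where F: "\<And>y. y \<in> S \<Longrightarrow> F y = J y" "\<And>x y. norm (F x - F y) \<le> C * norm (x - y)"
    using lipschitz_extension[of S J 1, OF Jlip] by auto
  \<comment> \<open>By \<open>nonexp\<close> the point selected by \<open>J\<close> is the only
    possible one, so \<open>F\<close> inverts x |-> x + p for every subgradient p at x, not just for
    a selected one.\<close>
  have Feq: "F (x + p) = x" if "p \<in> subgrad D f x" for x p
  proof -
    have xp: "(x + p) - x \<in> subgrad D f x" using that by simp
    then have "x + p \<in> S" unfolding S_def by blast
    from nonexp[OF J[OF this] xp] show ?thesis by (simp add: F(1)[OF \<open>x + p \<in> S\<close>])
  qed
  define Nd where "Nd = {y. \<not> F differentiable (at y)}"
  define F' where "F' y = frechet_derivative F (at y)" for y
  define Sg where "Sg = {y. F differentiable (at y) \<and> (\<exists>h. h \<noteq> 0 \<and> F' y h = 0)}"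
  \<comment> \<open>The exceptional sets live in the space of x + p; their images under
    \<open>F\<close> are exceptional sets of points x. Lipschitz maps preserve null sets, and Sard's
    lemma handles the points of singular derivative.\<close>
  have "negligible Nd" unfolding Nd_def by (rule AE_lborel_negligible[OF Rademacher[OF F(2)]])
  then have "negligible (F ` Nd)"
  proof (rule negligible_locally_Lipschitz_image[OF order_refl])
    show "\<exists>T B. open T \<and> x \<in> T \<and> (\<forall>y\<in>Nd \<inter> T. norm (F y - F x) \<le> B * norm (y - x))" for x
      using F(2) by (intro exI[of _ UNIV] exI[of _ C]) auto
  qed
  moreover have "negligible (F ` Sg)"
    by (rule negligible_image_singular_derivative[where f' = F'])
      (auto simp: Sg_def F'_def frechet_derivative_works)
  ultimately have "negligible (F ` Nd \<union> F ` Sg)" by (rule negligible_Un)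
  moreover have "\<exists>p M. linear M \<and> subgrad D f x = {p} \<and>
    (\<forall>e>0. \<exists>d>0. \<forall>y\<in>ball x d. \<forall>q\<in>subgrad D f y. norm (q - p - M (y - x)) \<le> e * norm (y - x))"
    if x: "x \<in> interior D - (F ` Nd \<union> F ` Sg)" for x
  proof -
    have xi: "x \<in> interior D" using x by blast
    obtain p where p: "p \<in> subgrad D f x" using subgrad_interior_nonempty[OF f xi] by blast
    define y where "y = x + p"
    have Fy: "F y = x" using Feq[OF p] by (simp add: y_def)
    then have "y \<notin> Nd" "y \<notin> Sg" using x by blast+
    then have der: "(F has_derivative F' y) (at y)" and ker: "\<And>h. F' y h = 0 \<Longrightarrow> h = 0"
      by (auto simp: Nd_def Sg_def F'_def frechet_derivative_works)
    define L where "L = F' y"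
    have lL: "linear L" unfolding L_def by (rule has_derivative_linear[OF der])
    have "inj L" using ker linear_injective_0[OF lL] by (auto simp: L_def)
    then obtain L' where L': "linear L'" "L' \<circ> L = id"
      using linear_injective_left_inverse[OF lL] by blast
    have L'L: "L' (L h) = h" for h using L'(2) by (metis comp_apply id_apply)
    have est: "\<exists>d>0. \<forall>h. norm h < d \<longrightarrow> norm (F (y + h) - x - L h) \<le> e * norm h" if "e > 0" for e
    proof -
      obtain d where "d > 0" "\<forall>z. norm (z - y) < d \<longrightarrow> norm (F z - F y - L (z - y)) \<le> e * norm (z - y)"
        using der \<open>e > 0\<close> unfolding has_derivative_within_alt L_def by blast
      then show ?thesis
        using Fy by (intro exI[of _ d] conjI allI impI) (auto dest!: spec[of _ "y + _"])
    qed
    \<comment> \<open>The map \<open>F\<close> sends the whole segment from x + p to x + q to x. Its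
      derivative at the end x + p therefore kills q - p, and that derivative is injective.\<close>
    have uniq: "q = p" if q: "q \<in> subgrad D f x" for q
    proof -
      have "norm (L (q - p)) \<le> 0"
      proof (rule field_le_epsilon)
        fix e :: real assume e: "e > 0"
        define e' where "e' = e / (norm (q - p) + 1)"
        have e': "e' > 0" using e by (simp add: e'_def add_nonneg_pos)
        obtain d where d: "d > 0" "\<And>h. norm h < d \<Longrightarrow> norm (F (y + h) - x - L h) \<le> e' * norm h"
          using est[OF e'] by blast
        define t where "t = min 1 (d / (2 * (norm (q - p) + 1)))"
        have np: "norm (q - p) + 1 > 0" by (simp add: add_nonneg_pos)
        have t: "0 < t" "t \<le> 1" using d np by (auto simp: t_def)
        have "t * norm (q - p) \<le> d / (2 * (norm (q - p) + 1)) * (norm (q - p) + 1)"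
          using t np d by (intro mult_mono) (auto simp: t_def)
        also have "\<dots> = d / 2"
        proof -
          have "d / (2 * c) * c = d / 2" if "c > 0" for c :: real using that by simp
          then show ?thesis using np by blast
        qed
        also have "\<dots> < d" using d by simp
        finally have td: "norm (t *\<^sub>R (q - p)) < d" using t by simp
        have "(1 - t) *\<^sub>R p + t *\<^sub>R q \<in> subgrad D f x"
          using convexD_alt[OF convex_subgrad p q] t by simp
        then have "F (x + ((1 - t) *\<^sub>R p + t *\<^sub>R q)) = x" by (rule Feq)
        moreover have "x + ((1 - t) *\<^sub>R p + t *\<^sub>R q) = y + t *\<^sub>R (q - p)"
          by (simp add: y_def algebra_simps)
        ultimately have "norm (t *\<^sub>R L (q - p)) \<le> e' * norm (t *\<^sub>R (q - p))"
          using d(2)[OF td] by (simp add: linear_cmul[OF lL])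
        then have "norm (L (q - p)) \<le> e' * norm (q - p)" using t by simp
        also have "\<dots> \<le> e' * (norm (q - p) + 1)" using e' by simp
        also have "\<dots> = e" using np by (simp add: e'_def)
        finally show "norm (L (q - p)) \<le> 0 + e" by simp
      qed
      then have "F' y (q - p) = 0" by (simp add: L_def)
      then have "q - p = 0" by (rule ker)
      then show ?thesis by simp
    qed
    have sp: "subgrad D f x = {p}" using p uniq by blast
    obtain K where K: "K > 0" "\<And>h. norm (L' h) \<le> norm h * K"
      using bounded_linear.pos_bounded linear_conv_bounded_linear L'(1) by blast
    \<comment> \<open>A displacement h of x moves x + p by \<open>L' h\<close> to first order, hence
      p by \<open>L' h - h\<close>.\<close>
    define M where "M h = L' h - h" for h
    have lM: "linear M" unfolding M_def[abs_def] by (intro linear_compose_sub L'(1) linear_ident)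
    have "\<exists>d>0. \<forall>z\<in>ball x d. \<forall>q\<in>subgrad D f z. norm (q - p - M (z - x)) \<le> e * norm (z - x)" if e: "e > 0" for e
    proof -
      \<comment> \<open>The bound K e' \<le> 1/2 first absorbs an error and gives |h| \<le> 2 K |z -
        x|; then 2 K^2 e' \<le> e turns the error K e' |h| into e |z - x|.\<close>
      define e' where "e' = min (1 / (2 * K)) (e / (2 * K * K))"
      have e': "e' > 0" "K * e' \<le> 1/2" "2 * K * K * e' \<le> e"
        using K(1) e by (auto simp: e'_def min_def field_simps)
      obtain d where d: "d > 0" "\<And>h. norm h < d \<Longrightarrow> norm (F (y + h) - x - L h) \<le> e' * norm h"
        using est[OF e'(1)] by blast
      obtain d1 where d1: "d1 > 0" "\<forall>z\<in>ball x d1. \<forall>q\<in>subgrad D f z. norm (q - p) < d / 2"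
        using unique_subgrad_continuous[OF f xi sp, of "d/2"] d by auto
      show ?thesis
      proof (intro exI[of _ "min d1 (d/2)"] conjI ballI)
        show "min d1 (d/2) > 0" using d d1 by simp
        fix z q assume z: "z \<in> ball x (min d1 (d/2))" and q: "q \<in> subgrad D f z"
        \<comment> \<open>The displacement from y = x + p to z + q. Since F (y + h) = z, the
          expansion of \<open>F\<close> at \<open>y\<close> can be read backwards.\<close>
        define h where "h = (z - x) + (q - p)"
        have "norm (z - x) < d/2" using z by (simp add: dist_norm norm_minus_commute)
        moreover have "norm (q - p) < d/2" using d1(2) z q by auto
        ultimately have hd: "norm h < d" unfolding h_def by (intro norm_triangle_lt) simp
        have "y + h = z + q" by (simp add: y_def h_def)
        then have "F (y + h) = z" using Feq[OF q] by simp
        then have b: "norm (z - x - L h) \<le> e' * norm h" using d(2)[OF hd] by simp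
        have "L' (z - x) - h = L' (z - x - L h)" by (simp add: linear_diff[OF L'(1)] L'L)
        then have b2: "norm (L' (z - x) - h) \<le> K * e' * norm h"
        proof -
          have "norm (L' (z - x - L h)) \<le> norm (z - x - L h) * K" by (rule K(2))
          also have "\<dots> \<le> (e' * norm h) * K" using K(1) by (intro mult_right_mono[OF b]) simp
          finally show ?thesis unfolding \<open>L' (z - x) - h = L' (z - x - L h)\<close> by (simp add: mult_ac)
        qed
        also have "\<dots> \<le> 1/2 * norm h" using e'(2) by (rule mult_right_mono) simp
        finally have "norm h \<le> 2 * norm (L' (z - x))"
          using norm_triangle_sub[of h "L' (z - x)"] by (simp add: norm_minus_commute)
        also have "\<dots> \<le> 2 * (norm (z - x) * K)" using K(2)[of "z - x"] by simp
        finally have nh: "norm h \<le> 2 * K * norm (z - x)" by (simp add: mult_ac)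
        have "q - p - M (z - x) = h - L' (z - x)" by (simp add: M_def h_def)
        then have "norm (q - p - M (z - x)) = norm (L' (z - x) - h)" by (simp only: norm_minus_commute)
        also have "\<dots> \<le> K * e' * norm h" by (rule b2)
        also have "\<dots> \<le> K * e' * (2 * K * norm (z - x))" using nh K e' by (intro mult_left_mono) auto
        also have "\<dots> = (2 * K * K * e') * norm (z - x)" by simp
        also have "\<dots> \<le> e * norm (z - x)" using e'(3) by (rule mult_right_mono) simp
        finally show "norm (q - p - M (z - x)) \<le> e * norm (z - x)" .
      qed
    qed
    then show ?thesis by (intro exI[of _ p] exI[of _ M] conjI lM sp allI impI)
  qed
  ultimately show ?thesis by (intro exI[of _ "F ` Nd \<union> F ` Sg"] conjI ballI)
qed

text \<open>The expansion of the subgradients is integrated by elementary sums along the segment. On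
  each of N pieces the increment of \<open>f\<close> lies between q.h/N and q'.h/N, with
  subgradients q and q' at the two ends, each known up to e|h|^2 after pairing with h. Summation
  costs e|h|^2 + |m|/(2N), and N tends to infinity.\<close>

lemma taylor2_of_subgrad_derivative:
  fixes f :: "'a::euclidean_space \<Rightarrow> real"
  assumes f: "convex_on D f" and x: "x \<in> interior D" and M: "linear M"
    and exp: "\<And>e. e > 0 \<Longrightarrow> \<exists>d>0. \<forall>y\<in>ball x d. \<forall>q\<in>subgrad D f y.
      norm (q - p - M (y - x)) \<le> e * norm (y - x)"
    and e: "e > 0"
  shows "\<exists>d>0. \<forall>y\<in>ball x d.
    \<bar>f y - f x - p \<bullet> (y - x) - (1/2) * ((y - x) \<bullet> M (y - x))\<bar> \<le> e * (norm (y - x))\<^sup>2"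
proof -
  obtain d where d: "d > 0" "\<And>y q. y \<in> ball x d \<Longrightarrow> q \<in> subgrad D f y \<Longrightarrow> norm (q - p - M (y - x)) \<le> e * norm (y - x)"
    using exp[OF e] by blast
  obtain d' where d': "d' > 0" "ball x d' \<subseteq> interior D"
    using x open_contains_ball[of "interior D"] by auto
  show ?thesis
  proof (intro exI[of _ "min d d'"] conjI ballI)
    show "min d d' > 0" using d d' by simp
    fix y assume y: "y \<in> ball x (min d d')"
    define h where "h = y - x"
    define m where "m = h \<bullet> M h"
    have "\<bar>f y - f x - p \<bullet> h - (1/2) * m\<bar> \<le> e * (norm h)\<^sup>2 + \<bar>m\<bar> / 2 * (1 / real (Suc k))" for k
    proof -
      define N where "N = real (Suc k)"
      have N: "N > 0" by (simp add: N_def)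
      define X where "X i = x + (real i / N) *\<^sub>R h" for i :: nat
      define c where "c = \<bar>m\<bar> / (2 * N\<^sup>2) + e * (norm h)\<^sup>2 / N"
      have Xin: "X i \<in> ball x (min d d')" if "i \<le> Suc k" for i
      proof -
        have "norm ((real i / N) *\<^sub>R h) \<le> norm h"
        proof -
          have "real i / N \<le> 1" using that by (simp add: N_def)
          then have "(real i / N) * norm h \<le> 1 * norm h" by (rule mult_right_mono) simp
          then show ?thesis using N by simp
        qed
        then show ?thesis using y by (simp add: X_def h_def dist_norm norm_minus_commute)
      qed
      have XD: "X i \<in> D" "X i \<in> interior D" if "i \<le> Suc k" for i
        using Xin[OF that] d'(2) interior_subset by (auto simp: subset_iff)
      have sg: "\<bar>q \<bullet> h - (p \<bullet> h + (real i / N) * m)\<bar> \<le> e * (norm h)\<^sup>2"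
        if i: "i \<le> Suc k" and q: "q \<in> subgrad D f (X i)" for i q
      proof -
        have "norm (q - p - M (X i - x)) \<le> e * norm (X i - x)"
          using d(2)[OF _ q] Xin[OF i] by simp
        also have "\<dots> = e * ((real i / N) * norm h)" using N by (simp add: X_def)
        also have "\<dots> \<le> e * (1 * norm h)"
          using i N e by (intro mult_left_mono mult_right_mono) (auto simp: N_def divide_le_eq)
        finally have 1: "norm (q - p - M (X i - x)) \<le> e * norm h" by simp
        have "q \<bullet> h - (p \<bullet> h + (real i / N) * m) = (q - p - M (X i - x)) \<bullet> h"
          by (simp add: X_def linear_cmul[OF M] m_def inner_diff_left inner_diff_right inner_commute)
        also have "\<bar>\<dots>\<bar> \<le> norm (q - p - M (X i - x)) * norm h" by (rule Cauchy_Schwarz_ineq2)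
        also have "\<dots> \<le> e * norm h * norm h" using 1 by (rule mult_right_mono) simp
        finally show ?thesis by (simp add: power2_eq_square)
      qed
      have Xdiff: "X (Suc i) - X i = (1/N) *\<^sub>R h" for i
        by (simp add: X_def scaleR_left_diff_distrib[symmetric] diff_divide_distrib[symmetric])
      have main: "\<bar>f (X i) - f x - (real i / N) * (p \<bullet> h) - (1/2) * (real i / N)\<^sup>2 * m\<bar> \<le> real i * c"
        if "i \<le> Suc k" for i
        using that
      proof (induction i)
        case 0
        then show ?case by (simp add: X_def)
      next
        case (Suc i)
        then have i: "i \<le> Suc k" "Suc i \<le> Suc k" by auto
        obtain q where q: "q \<in> subgrad D f (X i)" using subgrad_interior_nonempty[OF f XD(2)[OF i(1)]] by blast
        obtain q' where q': "q' \<in> subgrad D f (X (Suc i))"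
          using subgrad_interior_nonempty[OF f XD(2)[OF i(2)]] by blast
        have lo: "q \<bullet> h / N \<le> f (X (Suc i)) - f (X i)"
          using subgrad_le[OF q XD(1)[OF i(2)]] by (simp add: Xdiff)
        have "X i - X (Suc i) = - ((1/N) *\<^sub>R h)" using Xdiff[of i] by (metis minus_diff_eq)
        then have hi: "f (X (Suc i)) - f (X i) \<le> q' \<bullet> h / N"
          using subgrad_le[OF q' XD(1)[OF i(1)]] by simp
        define a where "a = p \<bullet> h + (real i / N) * m"
        define b where "b = p \<bullet> h + (real (Suc i) / N) * m"
        define E where "E = e * (norm h)\<^sup>2"
        have qa: "a - E \<le> q \<bullet> h" using sg[OF i(1) q] by (simp add: a_def E_def abs_le_iff)
        have qb: "q' \<bullet> h \<le> b + E" using sg[OF i(2) q'] by (simp add: b_def E_def abs_le_iff)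
        have lo': "(a - E) / N \<le> f (X (Suc i)) - f (X i)"
          using lo divide_right_mono[OF qa] N by (meson less_imp_le order_trans)
        have hi': "f (X (Suc i)) - f (X i) \<le> (b + E) / N"
          using hi divide_right_mono[OF qb] N by (meson less_imp_le order_trans)
        \<comment> \<open>The exact increment of the quadratic Taylor polynomial over one piece; it
          differs from both endpoint values a/N and b/N by m/(2N^2), which explains
          \<open>c\<close>.\<close>
        define s where "s = (p \<bullet> h) / N + (1/2) * ((real (Suc i) / N)\<^sup>2 - (real i / N)\<^sup>2) * m"
        have sa: "s = a / N + m / (2 * N\<^sup>2)"
          using N by (simp add: s_def a_def power2_eq_square field_simps)
        have sb: "s = b / N - m / (2 * N\<^sup>2)"
          using N by (simp add: s_def b_def power2_eq_square field_simps)
        have mm: "m / (2 * N\<^sup>2) \<le> \<bar>m\<bar> / (2 * N\<^sup>2)" "- (m / (2 * N\<^sup>2)) \<le> \<bar>m\<bar> / (2 * N\<^sup>2)"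
        proof -
          have "\<bar>m / (2 * N\<^sup>2)\<bar> = \<bar>m\<bar> / (2 * N\<^sup>2)" by (simp add: abs_divide)
          then show "m / (2 * N\<^sup>2) \<le> \<bar>m\<bar> / (2 * N\<^sup>2)" "- (m / (2 * N\<^sup>2)) \<le> \<bar>m\<bar> / (2 * N\<^sup>2)"
            by linarith+
        qed
        have cE: "c = \<bar>m\<bar> / (2 * N\<^sup>2) + E / N" by (simp add: c_def E_def)
        have "\<bar>f (X (Suc i)) - f (X i) - s\<bar> \<le> c"
          unfolding abs_le_iff
        proof
          show "f (X (Suc i)) - f (X i) - s \<le> c"
            using hi' mm unfolding sb cE by (simp add: add_divide_distrib)
          show "- (f (X (Suc i)) - f (X i) - s) \<le> c"
            using lo' mm unfolding sa cE by (simp add: diff_divide_distrib)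
        qed
        moreover have "f (X (Suc i)) - f x - (real (Suc i) / N) * (p \<bullet> h) - (1/2) * (real (Suc i) / N)\<^sup>2 * m =
            (f (X i) - f x - (real i / N) * (p \<bullet> h) - (1/2) * (real i / N)\<^sup>2 * m) + (f (X (Suc i)) - f (X i) - s)"
          by (simp add: s_def algebra_simps add_divide_distrib)
        ultimately show ?case using Suc.IH[OF i(1)] by (simp add: algebra_simps)
      qed
      have one: "real (Suc k) / N = 1" by (simp add: N_def)
      have "X (Suc k) = y" unfolding X_def one by (simp add: h_def)
      then have "\<bar>f y - f x - p \<bullet> h - (1/2) * m\<bar> \<le> real (Suc k) * c"
        using main[of "Suc k"] unfolding one by simp
      also have "real (Suc k) * c = e * (norm h)\<^sup>2 + \<bar>m\<bar> / 2 * (1 / N)"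
        unfolding c_def N_def[symmetric] using N by (simp add: power2_eq_square field_simps)
      finally show ?thesis by (simp add: N_def)
    qed
    moreover have "(\<lambda>k. e * (norm h)\<^sup>2 + \<bar>m\<bar> / 2 * (1 / real (Suc k))) \<longlonglongrightarrow> e * (norm h)\<^sup>2 + \<bar>m\<bar> / 2 * 0"
      using LIMSEQ_inverse_real_of_nat by (intro tendsto_intros) (simp add: inverse_eq_divide)
    ultimately have "\<bar>f y - f x - p \<bullet> h - (1/2) * m\<bar> \<le> e * (norm h)\<^sup>2 + \<bar>m\<bar> / 2 * 0"
      by (intro LIMSEQ_le_const[of _ "e * (norm h)\<^sup>2 + \<bar>m\<bar> / 2 * 0"]) auto
    then show "\<bar>f y - f x - p \<bullet> (y - x) - (1/2) * ((y - x) \<bullet> M (y - x))\<bar> \<le> e * (norm (y - x))\<^sup>2"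
      by (simp add: h_def m_def)
  qed
qed

section \<open>Compactness of the set of transport plans\<close>

text \<open>Tychonoff's theorem. The index type is arbitrary, so a convergent subsequence cannot be
  expected, and a filter \<open>G\<close> finer than \<open>sequentially\<close> takes its
  place.\<close>

lemma pointwise_cluster_filter:
  fixes X :: "nat \<Rightarrow> 'b \<Rightarrow> real"
  assumes "\<And>k j. 0 \<le> X k j" "\<And>k j. X k j \<le> 1"
  obtains G F where "G \<noteq> bot" "G \<le> sequentially" "\<And>j. ((\<lambda>k. X k j) \<longlongrightarrow> F j) G"
proof -
  let ?S = "PiE UNIV (\<lambda>_::'b. {0..1::real})"
  have "compactin (product_topology (\<lambda>_. euclidean) UNIV) ?S"
    by (subst compactin_PiE) auto
  then have "compact ?S" by (simp add: euclidean_product_topology)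
  moreover have "eventually (\<lambda>x. x \<in> ?S) (filtermap X sequentially)"
    using assms by (simp add: eventually_filtermap PiE_iff)
  ultimately obtain F where F: "inf (nhds F) (filtermap X sequentially) \<noteq> bot"
    unfolding compact_filter by (metis filtermap_bot_iff sequentially_bot)
  define G where "G = inf sequentially (filtercomap X (nhds F))"
  have "G \<noteq> bot"
  proof
    assume "G = bot"
    then have "eventually (\<lambda>_. False) G" by simp
    then obtain P Q where PQ: "eventually P sequentially" "eventually Q (nhds F)" "\<And>k. P k \<Longrightarrow> Q (X k) \<Longrightarrow> False"
      unfolding G_def eventually_inf eventually_filtercomap by blast
    have "eventually (\<lambda>x. \<not> Q x) (filtermap X sequentially)"
      unfolding eventually_filtermap using PQ(1) by eventually_elim (use PQ(3) in blast)
    then have "eventually (\<lambda>_. False) (inf (nhds F) (filtermap X sequentially))"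
      using PQ(2) unfolding eventually_inf by blast
    then show False using F by (simp add: trivial_limit_def)
  qed
  moreover have "G \<le> sequentially" by (simp add: G_def)
  moreover have "((\<lambda>k. X k j) \<longlongrightarrow> F j) G" for j
  proof -
    have "filterlim X (nhds F) G"
      unfolding filterlim_iff_le_filtercomap by (simp add: G_def)
    moreover have "((\<lambda>f. f j) \<longlongrightarrow> F j) (nhds F)"
    proof (rule topological_tendstoI)
      fix S :: "real set" assume S: "open S" "F j \<in> S"
      have "open ((\<lambda>f::'b \<Rightarrow> real. f j) -` S)"
        by (rule open_vimage[OF S(1) continuous_on_product_coordinates])
      then show "eventually (\<lambda>f. f j \<in> S) (nhds F)"
        unfolding eventually_nhds using S(2) by blast
    qed
    ultimately show ?thesis by (rule filterlim_compose[rotated])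
  qed
  ultimately show ?thesis using that by blast
qed

lemma transport_planD:
  assumes "transport_plan \<mu> \<nu> \<alpha>"
  shows "prob_space \<alpha>" "sets \<alpha> = sets borel" "space \<alpha> = UNIV"
    "distr \<alpha> borel fst = \<mu>" "distr \<alpha> borel snd = \<nu>"
  using assms sets_eq_imp_space_eq[of \<alpha> borel] by (auto simp: transport_plan_def)

lemma transport_plan_measurable:
  assumes "transport_plan \<mu> \<nu> \<alpha>"
  shows "fst \<in> measurable \<alpha> borel" "snd \<in> measurable \<alpha> borel"
  using transport_planD(2)[OF assms]
  by (auto simp: measurable_cong_sets[OF _ refl, of \<alpha> borel] intro!: borel_measurable_continuous_onI continuous_intros)

lemma transport_plan_Times_sets:
  fixes A B :: "'a::euclidean_space set"
  assumes "transport_plan \<mu> \<nu> \<alpha>" "A \<in> sets borel" "B \<in> sets borel"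
  shows "A \<times> B \<in> sets \<alpha>"
  using assms transport_planD(2)[OF assms(1)] by (simp add: borel_prod[symmetric])

lemma transport_plan_measure:
  fixes \<mu> \<nu> :: "'a::euclidean_space measure"
  assumes "transport_plan \<mu> \<nu> \<alpha>" "A \<in> sets borel"
  shows "measure \<alpha> (A \<times> UNIV) = measure \<mu> A" "measure \<alpha> (UNIV \<times> A) = measure \<nu> A"
proof -
  note D = transport_planD[OF assms(1)]
  have "measure (distr \<alpha> borel fst) A = measure \<alpha> (fst -` A \<inter> space \<alpha>)"
    by (rule measure_distr[OF transport_plan_measurable(1)[OF assms(1)] assms(2)])
  moreover have "fst -` A \<inter> space \<alpha> = A \<times> UNIV" using D(3) by auto
  ultimately show "measure \<alpha> (A \<times> UNIV) = measure \<mu> A" using D(4) by simp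
  have "measure (distr \<alpha> borel snd) A = measure \<alpha> (snd -` A \<inter> space \<alpha>)"
    by (rule measure_distr[OF transport_plan_measurable(2)[OF assms(1)] assms(2)])
  moreover have "snd -` A \<inter> space \<alpha> = UNIV \<times> A" using D(3) by auto
  ultimately show "measure \<alpha> (UNIV \<times> A) = measure \<nu> A" using D(5) by simp
qed

lemma transport_plan_integral:
  fixes f :: "'a::euclidean_space \<Rightarrow> real"
  assumes "transport_plan \<mu> \<nu> \<alpha>" "f \<in> borel_measurable borel"
  shows "(\<integral>z. f (fst z) \<partial>\<alpha>) = (\<integral>x. f x \<partial>\<mu>)" "(\<integral>z. f (snd z) \<partial>\<alpha>) = (\<integral>x. f x \<partial>\<nu>)"
    "integrable \<alpha> (\<lambda>z. f (fst z)) \<longleftrightarrow> integrable \<mu> f" "integrable \<alpha> (\<lambda>z. f (snd z)) \<longleftrightarrow> integrable \<nu> f"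
  using integral_distr[OF transport_plan_measurable(1)[OF assms(1)], of f]
    integral_distr[OF transport_plan_measurable(2)[OF assms(1)], of f]
    integrable_distr_eq[OF transport_plan_measurable(1)[OF assms(1)], of f]
    integrable_distr_eq[OF transport_plan_measurable(2)[OF assms(1)], of f]
    transport_planD(4,5)[OF assms(1)] assms(2) by simp_all

text \<open>Inner and outer regularity of a Borel probability measure, stated for differences of
  sets so that the errors can be added.\<close>

lemma compact_open_approx:
  fixes \<mu> :: "'a::euclidean_space measure"
  assumes mu: "prob_space \<mu>" "sets \<mu> = sets borel" and A: "A \<in> sets borel" and e: "e > 0"
  shows "\<exists>K. compact K \<and> K \<subseteq> A \<and> measure \<mu> (A - K) < e"
    and "\<exists>U. open U \<and> A \<subseteq> U \<and> measure \<mu> (U - A) < e"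
proof -
  interpret prob_space \<mu> by (rule mu(1))
  have fin: "emeasure \<mu> (space \<mu>) \<noteq> \<infinity>" by simp
  have lt: "ennreal (measure \<mu> A - e) < emeasure \<mu> A" if "0 < measure \<mu> A"
    using that e by (simp add: emeasure_eq_measure ennreal_lessI)
  show "\<exists>K. compact K \<and> K \<subseteq> A \<and> measure \<mu> (A - K) < e"
  proof (cases "measure \<mu> A = 0")
    case True
    then show ?thesis using e by (intro exI[of _ "{}"]) simp
  next
    case False
    then have "ennreal (measure \<mu> A - e) < emeasure \<mu> A" by (intro lt) (simp add: zero_less_measure_iff)
    then obtain K where K: "K \<subseteq> A" "compact K" "ennreal (measure \<mu> A - e) < emeasure \<mu> K"
      unfolding inner_regular[OF mu(2) fin A] less_SUP_iff by auto
    have Ks: "K \<in> sets \<mu>" using K(2) mu(2) by (simp add: borel_compact)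
    have "measure \<mu> A - e < measure \<mu> K"
      using K(3) by (simp add: emeasure_eq_measure) (metis ennreal_less_iff linorder_not_le measure_nonneg order_le_less_trans)
    then have "measure \<mu> (A - K) < e"
      using K(1) A mu(2) Ks by (subst finite_measure_Diff) auto
    then show ?thesis using K by blast
  qed
  have "emeasure \<mu> A < ennreal (measure \<mu> A + e)"
    using e by (simp add: emeasure_eq_measure ennreal_less_iff del: ennreal_plus)
  then obtain U where U: "A \<subseteq> U" "open U" "emeasure \<mu> U < ennreal (measure \<mu> A + e)"
    unfolding outer_regular[OF mu(2) fin A] INF_less_iff by auto
  have "measure \<mu> U < measure \<mu> A + e"
    using U(3) e by (simp add: emeasure_eq_measure ennreal_less_iff del: ennreal_plus)
  then have "measure \<mu> (U - A) < e"
    using U A mu(2) by (subst finite_measure_Diff) auto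
  then show "\<exists>U. open U \<and> A \<subseteq> U \<and> measure \<mu> (U - A) < e" using U by blast
qed

text \<open>Since the marginals are fixed and regular, a limit of the values of plans on rectangles is
  automatically countably additive.\<close>

lemma transport_plan_limit_sums:
  fixes \<mu> \<nu> :: "'a::euclidean_space measure" and \<alpha> :: "nat \<Rightarrow> ('a \<times> 'a) measure"
  assumes mu: "prob_space \<mu>" "sets \<mu> = sets borel" and nu: "prob_space \<nu>" "sets \<nu> = sets borel"
    and a: "\<And>k. transport_plan \<mu> \<nu> (\<alpha> k)" and G: "G \<noteq> bot"
    and lim: "\<And>A B. A \<in> sets borel \<Longrightarrow> B \<in> sets borel \<Longrightarrow> ((\<lambda>k. measure (\<alpha> k) (A \<times> B)) \<longlongrightarrow> F A B) G"
    and AB: "\<And>n::nat. A n \<in> sets borel" "\<And>n. B n \<in> sets borel" "A0 \<in> sets borel" "B0 \<in> sets borel"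
    and dis: "disjoint_family (\<lambda>n. A n \<times> B n)" and un: "(\<Union>n. A n \<times> B n) = A0 \<times> B0"
  shows "(\<lambda>n. F (A n) (B n)) sums F A0 B0"
proof -
  interpret pk: prob_space "\<alpha> k" for k by (rule transport_planD(1)[OF a])
  note TS = transport_plan_Times_sets[OF a]
  have F0: "0 \<le> F C E" if "C \<in> sets borel" "E \<in> sets borel" for C E
    by (rule tendsto_lowerbound[OF lim[OF that] _ G]) simp
  have limsum: "((\<lambda>k. \<Sum>n<N. measure (\<alpha> k) (A n \<times> B n)) \<longlongrightarrow> (\<Sum>n<N. F (A n) (B n))) G" for N
    by (intro tendsto_sum lim AB)
  have upper: "(\<Sum>n<N. F (A n) (B n)) \<le> F A0 B0" for N
  proof (rule tendsto_le[OF G lim[OF AB(3,4)] limsum], rule always_eventually, rule allI)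
    fix k
    have "(\<Sum>n<N. measure (\<alpha> k) (A n \<times> B n)) = measure (\<alpha> k) (\<Union>n<N. A n \<times> B n)"
      using dis TS AB by (intro pk.finite_measure_finite_Union[symmetric])
        (auto simp: disjoint_family_on_def)
    also have "\<dots> \<le> measure (\<alpha> k) (A0 \<times> B0)"
      using un by (intro pk.finite_measure_mono TS AB) blast
    finally show "(\<Sum>n<N. measure (\<alpha> k) (A n \<times> B n)) \<le> measure (\<alpha> k) (A0 \<times> B0)" .
  qed
  \<comment> \<open>The target rectangle is shrunk to a compact one and the pieces are enlarged to
    open ones, so that finitely many of them cover. Shrinking costs 2e and the enlargements cost 2e
    in total by the geometric weights.\<close>
  have lower: "\<exists>N. F A0 B0 \<le> (\<Sum>n<N. F (A n) (B n)) + 4 * e" if e: "e > 0" for e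
  proof -
    obtain K where K: "compact K" "K \<subseteq> A0" "measure \<mu> (A0 - K) < e"
      using compact_open_approx(1)[OF mu AB(3) e] by blast
    obtain L where L: "compact L" "L \<subseteq> B0" "measure \<nu> (B0 - L) < e"
      using compact_open_approx(1)[OF nu AB(4) e] by blast
    have e2: "e * (1/2) ^ Suc n > 0" for n using e by simp
    obtain U where U: "\<And>n. open (U n)" "\<And>n. A n \<subseteq> U n" "\<And>n. measure \<mu> (U n - A n) < e * (1/2) ^ Suc n"
    proof -
      have "\<exists>U. open U \<and> A n \<subseteq> U \<and> measure \<mu> (U - A n) < e * (1/2) ^ Suc n" for n
        by (rule compact_open_approx(2)[OF mu AB(1) e2])
      then show ?thesis using that by metis
    qed
    obtain V where V: "\<And>n. open (V n)" "\<And>n. B n \<subseteq> V n" "\<And>n. measure \<nu> (V n - B n) < e * (1/2) ^ Suc n"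
    proof -
      have "\<exists>V. open V \<and> B n \<subseteq> V \<and> measure \<nu> (V - B n) < e * (1/2) ^ Suc n" for n
        by (rule compact_open_approx(2)[OF nu AB(2) e2])
      then show ?thesis using that by metis
    qed
    have cov: "K \<times> L \<subseteq> (\<Union>n. U n \<times> V n)"
    proof -
      have "K \<times> L \<subseteq> A0 \<times> B0" using K L by blast
      also have "\<dots> \<subseteq> (\<Union>n. U n \<times> V n)" unfolding un[symmetric] using U(2) V(2) by blast
      finally show ?thesis .
    qed
    obtain I where I: "finite I" "K \<times> L \<subseteq> (\<Union>n\<in>I. U n \<times> V n)"
      by (rule compactE_image[OF compact_Times[OF K(1) L(1)] _ cov]) (auto intro: open_Times U V)
    obtain N where N: "I \<subseteq> {..<N}" using finite_nat_iff_bounded I(1) by blast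
    note sb = borel_open[OF U(1)] borel_open[OF V(1)] borel_compact[OF K(1)] borel_compact[OF L(1)]
    have "measure (\<alpha> k) (A0 \<times> B0) \<le> (\<Sum>n<N. measure (\<alpha> k) (A n \<times> B n)) + 4 * e" for k
    proof -
      \<comment> \<open>Every error set lies in strips over small sets. The measure of a strip is
        given by a marginal, so the estimate is uniform in k.\<close>
      have subadd3: "measure (\<alpha> k) S \<le> measure (\<alpha> k) S1 + measure \<mu> A1 + measure \<nu> B1"
        if "S \<subseteq> S1 \<union> (A1 \<times> UNIV \<union> UNIV \<times> B1)" "S1 \<in> sets (\<alpha> k)" "A1 \<in> sets borel" "B1 \<in> sets borel" for S S1 A1 B1
      proof -
        have s: "A1 \<times> UNIV \<in> sets (\<alpha> k)" "UNIV \<times> B1 \<in> sets (\<alpha> k)" using that by (auto intro: TS)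
        have "measure (\<alpha> k) S \<le> measure (\<alpha> k) (S1 \<union> (A1 \<times> UNIV \<union> UNIV \<times> B1))"
          using that s by (intro pk.finite_measure_mono) auto
        also have "\<dots> \<le> measure (\<alpha> k) S1 + measure (\<alpha> k) (A1 \<times> UNIV \<union> UNIV \<times> B1)"
          using that s by (intro measure_Un_le) auto
        also have "measure (\<alpha> k) (A1 \<times> UNIV \<union> UNIV \<times> B1) \<le> measure (\<alpha> k) (A1 \<times> UNIV) + measure (\<alpha> k) (UNIV \<times> B1)"
          using s by (intro measure_Un_le)
        finally show ?thesis using transport_plan_measure[OF a] that by simp
      qed
      have 1: "measure (\<alpha> k) (A0 \<times> B0) \<le> measure (\<alpha> k) (K \<times> L) + measure \<mu> (A0 - K) + measure \<nu> (B0 - L)"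
        by (rule subadd3) (use AB sb in \<open>auto intro: TS\<close>)
      have 2: "measure (\<alpha> k) (K \<times> L) \<le> (\<Sum>n<N. measure (\<alpha> k) (U n \<times> V n))"
      proof -
        have "measure (\<alpha> k) (K \<times> L) \<le> measure (\<alpha> k) (\<Union>n<N. U n \<times> V n)"
          by (intro pk.finite_measure_mono sets.finite_UN TS sb) (use I(2) N in auto)
        also have "\<dots> \<le> (\<Sum>n<N. measure (\<alpha> k) (U n \<times> V n))"
          by (intro measure_UNION_le TS sb) auto
        finally show ?thesis .
      qed
      have 3: "measure (\<alpha> k) (U n \<times> V n) \<le> measure (\<alpha> k) (A n \<times> B n) + 2 * e * (1/2) ^ Suc n" for n
      proof -
        have "measure (\<alpha> k) (U n \<times> V n) \<le> measure (\<alpha> k) (A n \<times> B n) + measure \<mu> (U n - A n) + measure \<nu> (V n - B n)"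
          by (rule subadd3) (use AB sb in \<open>auto intro: TS\<close>)
        then show ?thesis using U(3)[of n] V(3)[of n] by linarith
      qed
      have "(\<Sum>n<N. measure (\<alpha> k) (U n \<times> V n)) \<le> (\<Sum>n<N. measure (\<alpha> k) (A n \<times> B n)) + (\<Sum>n<N. 2 * e * (1/2) ^ Suc n)"
        unfolding sum.distrib[symmetric] by (intro sum_mono 3)
      also have "(\<Sum>n<N. 2 * e * (1/2) ^ Suc n) = e * (\<Sum>n<N. (1/2) ^ n)"
        by (simp add: sum_distrib_left)
      also have "\<dots> \<le> e * 2"
        using e by (intro mult_left_mono) (auto simp: sum_gp_strict)
      finally show ?thesis using 1 2 K(3) L(3) by linarith
    qed
    then have "F A0 B0 \<le> (\<Sum>n<N. F (A n) (B n)) + 4 * e"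
      by (intro tendsto_le[OF G tendsto_add[OF limsum tendsto_const] lim[OF AB(3,4)]]) simp
    then show ?thesis by blast
  qed
  have inc: "incseq (\<lambda>N. \<Sum>n<N. F (A n) (B n))"
    by (rule incseq_SucI) (simp add: F0 AB)
  show ?thesis
    unfolding sums_def
  proof (rule LIMSEQ_I)
    fix r :: real assume r: "r > 0"
    obtain N where N: "F A0 B0 \<le> (\<Sum>n<N. F (A n) (B n)) + 4 * (r / 8)" using lower[of "r/8"] r by auto
    show "\<exists>no. \<forall>n\<ge>no. norm ((\<Sum>n<n. F (A n) (B n)) - F A0 B0) < r"
    proof (intro exI[of _ N] allI impI)
      fix n assume "N \<le> n"
      then have "(\<Sum>n<N. F (A n) (B n)) \<le> (\<Sum>n<n. F (A n) (B n))" using inc by (auto simp: incseq_def)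
      then show "norm ((\<Sum>n<n. F (A n) (B n)) - F A0 B0) < r" using upper[of n] N r by simp
    qed
  qed
qed

lemma semiring_of_borel_rectangles:
  "semiring_of_sets UNIV {A \<times> B |A B. A \<in> sets (borel :: 'a::topological_space measure) \<and> B \<in> sets (borel :: 'a measure)}"
  (is "semiring_of_sets UNIV ?R")
proof
  show "?R \<subseteq> Pow UNIV" "{} \<in> ?R" by auto
  show "a \<inter> b \<in> ?R" if ab: "a \<in> ?R" "b \<in> ?R" for a b
  proof -
    obtain A B where 1: "a = A \<times> B" "A \<in> sets borel" "B \<in> sets borel" using ab(1) by blast
    obtain C E where 2: "b = C \<times> E" "C \<in> sets borel" "E \<in> sets borel" using ab(2) by blast
    have "a \<inter> b = (A \<inter> C) \<times> (B \<inter> E)" unfolding 1(1) 2(1) by (rule Times_Int_Times)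
    moreover have "A \<inter> C \<in> sets borel" "B \<inter> E \<in> sets borel" using 1 2 by auto
    ultimately show ?thesis by blast
  qed
  show "\<exists>C\<subseteq>?R. finite C \<and> disjoint C \<and> a - b = \<Union> C" if ab: "a \<in> ?R" "b \<in> ?R" for a b
  proof -
    obtain A B where 1: "a = A \<times> B" "A \<in> sets borel" "B \<in> sets borel" using ab(1) by blast
    obtain C E where 2: "b = C \<times> E" "C \<in> sets borel" "E \<in> sets borel" using ab(2) by blast
    have s: "A - C \<in> sets borel" "A \<inter> C \<in> sets borel" "B - E \<in> sets borel" using 1 2 by auto
    have "{(A - C) \<times> B, (A \<inter> C) \<times> (B - E)} \<subseteq> ?R" using s 1(3) by blast
    moreover have "disjoint {(A - C) \<times> B, (A \<inter> C) \<times> (B - E)}" by (auto simp: disjoint_def)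
    moreover have "a - b = \<Union> {(A - C) \<times> B, (A \<inter> C) \<times> (B - E)}" unfolding 1(1) 2(1) by auto
    ultimately show ?thesis by (meson finite.emptyI finite.insertI)
  qed
qed

text \<open>Caratheodory extension from the semiring of rectangles. The marginals of the limit are
  exact because they are constant along the sequence.\<close>

lemma transport_plan_limit:
  fixes \<mu> \<nu> :: "'a::euclidean_space measure" and \<alpha> :: "nat \<Rightarrow> ('a \<times> 'a) measure"
  assumes mu: "prob_space \<mu>" "sets \<mu> = sets borel" and nu: "prob_space \<nu>" "sets \<nu> = sets borel"
    and a: "\<And>k. transport_plan \<mu> \<nu> (\<alpha> k)" and G: "G \<noteq> bot"
    and lim: "\<And>A B. A \<in> sets borel \<Longrightarrow> B \<in> sets borel \<Longrightarrow> ((\<lambda>k. measure (\<alpha> k) (A \<times> B)) \<longlongrightarrow> F A B) G"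
  shows "\<exists>\<beta>. transport_plan \<mu> \<nu> \<beta> \<and> (\<forall>A\<in>sets borel. \<forall>B\<in>sets borel. measure \<beta> (A \<times> B) = F A B)"
proof -
  define P where "P A B \<longleftrightarrow> A \<in> sets (borel :: 'a measure) \<and> B \<in> sets (borel :: 'a measure)" for A B
  define \<beta> where "\<beta> = extend_measure UNIV {(A, B). P A B} (\<lambda>(A, B). A \<times> B) (\<lambda>(A, B). ennreal (F A B))"
  have F0: "0 \<le> F A B" if "P A B" for A B
    by (rule tendsto_lowerbound[OF lim _ G]) (use that in \<open>auto simp: P_def\<close>)
  \<comment> \<open>An empty product does not determine its sides, so \<open>F\<close> must be shown
    to depend on the product set only.\<close>
  have Feq: "F A B = F C E" if "P A B" "P C E" "A \<times> B = C \<times> E" for A B C E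
    by (rule tendsto_unique[OF G]) (use that lim[of A B] lim[of C E] in \<open>auto simp: P_def\<close>)
  have em: "emeasure \<beta> (A \<times> B) = ennreal (F A B)" if "P A B" for A B
  proof (rule extend_measure_caratheodory_pair[OF \<beta>_def that])
    show "semiring_of_sets UNIV {A \<times> B |A B. P A B}"
      unfolding P_def by (rule semiring_of_borel_rectangles)
  next
    fix A B assume AB: "P A B" "A \<times> B = {}"
    have "((\<lambda>k. measure (\<alpha> k) (A \<times> B)) \<longlongrightarrow> 0) G" unfolding AB(2) by simp
    then show "ennreal (F A B) = 0"
      using tendsto_unique[OF G lim[of A B]] AB(1) by (auto simp: P_def)
  next
    fix A B C E assume "P A B" "P C E" "A \<times> B = C \<times> E"
    then have "F A B = F C E" by (rule Feq)
    then show "ennreal (F A B) = ennreal (F C E)" by simp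
  next
    fix A B and A0 B0 assume *: "\<And>n::nat. P (A n) (B n)" "P A0 B0" "disjoint_family (\<lambda>n. A n \<times> B n)"
      "(\<Union>i. A i \<times> B i) = A0 \<times> B0"
    have "(\<lambda>n. F (A n) (B n)) sums F A0 B0"
      by (rule transport_plan_limit_sums[OF mu nu a G lim]) (use * in \<open>auto simp: P_def\<close>)
    then have "(\<lambda>n. ennreal (F (A n) (B n))) sums ennreal (F A0 B0)"
      by (subst sums_ennreal) (use F0 * in auto)
    then show "(\<Sum>n. ennreal (F (A n) (B n))) = ennreal (F A0 B0)" by (rule sums_unique[symmetric])
  qed simp
  have "sets \<beta> = sigma_sets UNIV ((\<lambda>(A, B). A \<times> B) ` {(A, B). P A B})"
    unfolding \<beta>_def by (rule sets_extend_measure) auto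
  also have "(\<lambda>(A, B). A \<times> B) ` {(A, B). P A B} = {A \<times> B |A B. A \<in> sets borel \<and> B \<in> sets borel}"
    by (auto simp: P_def)
  also have "sigma_sets UNIV \<dots> = sets (borel \<Otimes>\<^sub>M borel :: ('a \<times> 'a) measure)"
    by (simp add: sets_pair_measure)
  finally have sb: "sets \<beta> = sets borel" unfolding borel_prod .
  then have spb: "space \<beta> = UNIV" using sets_eq_imp_space_eq[OF sb] by simp
  have ms: "fst \<in> measurable \<beta> borel" "snd \<in> measurable \<beta> borel"
    by (auto simp: measurable_cong_sets[OF sb refl] intro!: borel_measurable_continuous_onI continuous_intros)
  interpret mu: prob_space \<mu> by (rule mu(1))
  interpret nu: prob_space \<nu> by (rule nu(1))
  have F1: "F A UNIV = measure \<mu> A" if "A \<in> sets borel" for A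
  proof -
    have "((\<lambda>k. measure (\<alpha> k) (A \<times> UNIV)) \<longlongrightarrow> measure \<mu> A) G"
      using transport_plan_measure(1)[OF a that] by simp
    then show ?thesis using tendsto_unique[OF G lim[of A UNIV]] that by auto
  qed
  have F2: "F UNIV B = measure \<nu> B" if "B \<in> sets borel" for B
  proof -
    have "((\<lambda>k. measure (\<alpha> k) (UNIV \<times> B)) \<longlongrightarrow> measure \<nu> B) G"
      using transport_plan_measure(2)[OF a that] by simp
    then show ?thesis using tendsto_unique[OF G lim[of UNIV B]] that by auto
  qed
  have d1: "distr \<beta> borel fst = \<mu>"
  proof (rule measure_eqI)
    fix A assume "A \<in> sets (distr \<beta> borel fst)"
    then have A: "A \<in> sets borel" by simp
    have "fst -` A \<inter> space \<beta> = A \<times> UNIV" using spb by auto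
    then show "emeasure (distr \<beta> borel fst) A = emeasure \<mu> A"
      using A by (simp add: emeasure_distr[OF ms(1)] em P_def F1 mu.emeasure_eq_measure)
  qed (simp add: mu(2))
  have d2: "distr \<beta> borel snd = \<nu>"
  proof (rule measure_eqI)
    fix A assume "A \<in> sets (distr \<beta> borel snd)"
    then have A: "A \<in> sets borel" by simp
    have "snd -` A \<inter> space \<beta> = UNIV \<times> A" using spb by auto
    then show "emeasure (distr \<beta> borel snd) A = emeasure \<nu> A"
      using A by (simp add: emeasure_distr[OF ms(2)] em P_def F2 nu.emeasure_eq_measure)
  qed (simp add: nu(2))
  have "prob_space \<beta>"
  proof
    have "emeasure \<beta> (UNIV \<times> UNIV) = ennreal (F UNIV UNIV)" by (rule em) (simp add: P_def)
    also have "F UNIV UNIV = 1"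
      using F1[of UNIV] mu.prob_space sets_eq_imp_space_eq[OF mu(2)] by simp
    finally show "emeasure \<beta> (space \<beta>) = 1" using spb by simp
  qed
  then have "transport_plan \<mu> \<nu> \<beta>" using sb d1 d2 by (simp add: transport_plan_def)
  moreover have "\<forall>A\<in>sets borel. \<forall>B\<in>sets borel. measure \<beta> (A \<times> B) = F A B"
    using em F0 by (auto simp: P_def measure_def)
  ultimately show ?thesis by blast
qed

section \<open>Existence of optimal plans for a bilinear cost\<close>

lemma product_transport_plan:
  fixes \<mu> \<nu> :: "'a::euclidean_space measure"
  assumes mu: "prob_space \<mu>" "sets \<mu> = sets borel" and nu: "prob_space \<nu>" "sets \<nu> = sets borel"
  shows "transport_plan \<mu> \<nu> (\<mu> \<Otimes>\<^sub>M \<nu>)"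
proof -
  interpret mu: prob_space \<mu> by (rule mu(1))
  interpret nu: prob_space \<nu> by (rule nu(1))
  interpret pair_prob_space \<mu> \<nu> ..
  have s: "sets (\<mu> \<Otimes>\<^sub>M \<nu>) = sets borel"
    using sets_pair_measure_cong[OF mu(2) nu(2)] unfolding borel_prod .
  have "distr (\<mu> \<Otimes>\<^sub>M \<nu>) borel fst = distr (\<mu> \<Otimes>\<^sub>M \<nu>) \<mu> fst"
    by (rule distr_cong) (simp_all add: mu(2))
  moreover have "distr (\<mu> \<Otimes>\<^sub>M \<nu>) borel snd = distr (\<mu> \<Otimes>\<^sub>M \<nu>) \<nu> snd"
    by (rule distr_cong) (simp_all add: nu(2))
  moreover have "distr (\<mu> \<Otimes>\<^sub>M \<nu>) \<mu> fst = \<mu>" by (rule nu.distr_pair_fst)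
  moreover have "distr (\<mu> \<Otimes>\<^sub>M \<nu>) \<nu> snd = \<nu>"
  proof (rule measure_eqI)
    fix A assume A: "A \<in> sets (distr (\<mu> \<Otimes>\<^sub>M \<nu>) \<nu> snd)"
    have "snd -` A \<inter> space (\<mu> \<Otimes>\<^sub>M \<nu>) = space \<mu> \<times> A"
      using A sets.sets_into_space[of A \<nu>] by (auto simp: space_pair_measure)
    then show "emeasure (distr (\<mu> \<Otimes>\<^sub>M \<nu>) \<nu> snd) A = emeasure \<nu> A"
      using A by (simp add: emeasure_distr nu.emeasure_pair_measure_Times mu.emeasure_space_1)
  qed simp
  ultimately show ?thesis
    using s prob_space_axioms by (simp add: transport_plan_def)
qed

context
  fixes \<mu> \<nu> :: "'a::euclidean_space measure" and L :: "'a \<Rightarrow> 'a"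
  assumes mu: "P2 \<mu>" and nu: "P2 \<nu>" and L: "linear L"
begin

lemma linear_measurable: "L \<in> borel_measurable borel"
  using L linear_continuous_on linear_conv_bounded_linear borel_measurable_continuous_onI by blast

lemma bilinear_bound: "\<exists>K>0. \<forall>x y. \<bar>x \<bullet> L y\<bar> \<le> K * (norm x * norm y)"
proof -
  obtain K where K: "K > 0" "\<And>y. norm (L y) \<le> norm y * K"
    using bounded_linear.pos_bounded L linear_conv_bounded_linear by blast
  have "\<bar>x \<bullet> L y\<bar> \<le> K * (norm x * norm y)" for x y
  proof -
    have "\<bar>x \<bullet> L y\<bar> \<le> norm x * norm (L y)" by (rule Cauchy_Schwarz_ineq2)
    also have "\<dots> \<le> norm x * (norm y * K)" using K(2) by (intro mult_left_mono) auto
    finally show ?thesis by (simp add: mult_ac)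
  qed
  then show ?thesis using K(1) by blast
qed

lemma measurable_bilinear: "(\<lambda>z. fst z \<bullet> L (snd z)) \<in> borel_measurable (borel :: ('a \<times> 'a) measure)"
proof (rule borel_measurable_continuous_onI)
  have cL: "continuous_on UNIV L" using L linear_continuous_on linear_conv_bounded_linear by blast
  show "continuous_on UNIV (\<lambda>z :: 'a \<times> 'a. fst z \<bullet> L (snd z))"
    by (intro continuous_on_inner continuous_on_fst continuous_on_id continuous_on_compose2[OF cL]
      continuous_on_snd subset_UNIV)
qed

lemma transport_plan_square_integrable:
  assumes "transport_plan \<mu> \<nu> \<alpha>"
  shows "integrable \<alpha> (\<lambda>z. (norm (fst z))\<^sup>2)" "integrable \<alpha> (\<lambda>z. (norm (snd z))\<^sup>2)"
  using mu nu transport_plan_integral(3,4)[OF assms, of "\<lambda>x. (norm x)\<^sup>2"] by (auto simp: P2_def)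

lemma transport_plan_bilinear_integrable:
  assumes "transport_plan \<mu> \<nu> \<alpha>"
  shows "integrable \<alpha> (\<lambda>z. fst z \<bullet> L (snd z))"
proof -
  obtain K where K: "K > 0" "\<And>x y. \<bar>x \<bullet> L y\<bar> \<le> K * (norm x * norm y)" using bilinear_bound by blast
  show ?thesis
  proof (rule Bochner_Integration.integrable_bound)
    show "integrable \<alpha> (\<lambda>z. K * ((norm (fst z))\<^sup>2 + (norm (snd z))\<^sup>2))"
      using transport_plan_square_integrable[OF assms] by simp
    show "(\<lambda>z. fst z \<bullet> L (snd z)) \<in> borel_measurable \<alpha>"
      using measurable_bilinear by (simp add: measurable_cong_sets[OF transport_planD(2)[OF assms] refl])
    have bd: "\<bar>x \<bullet> L y\<bar> \<le> K * ((norm x)\<^sup>2 + (norm y)\<^sup>2)" for x y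
    proof -
      have "0 \<le> (norm x - norm y)\<^sup>2" "0 \<le> (norm x)\<^sup>2" "0 \<le> (norm y)\<^sup>2" by auto
      then have "norm x * norm y \<le> (norm x)\<^sup>2 + (norm y)\<^sup>2" unfolding power2_diff by linarith
      then have "K * (norm x * norm y) \<le> K * ((norm x)\<^sup>2 + (norm y)\<^sup>2)" using K(1) by (intro mult_left_mono) auto
      then show ?thesis using K(2) order_trans by blast
    qed
    show "AE z in \<alpha>. norm (fst z \<bullet> L (snd z)) \<le> norm (K * ((norm (fst z))\<^sup>2 + (norm (snd z))\<^sup>2))"
      unfolding real_norm_def by (rule AE_I2, rule order_trans[OF bd abs_ge_self])
  qed
qed

text \<open>For finitely valued s and r the functional is a finite combination of values on
  rectangles, the only quantities whose convergence is known.\<close>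

lemma integral_simple_bilinear:
  assumes \<beta>: "transport_plan \<mu> \<nu> \<beta>" and s: "finite (range s)" "\<And>a. s -` {a} \<in> sets borel"
    and r: "finite (range r)" "\<And>a. r -` {a} \<in> sets borel"
  shows "integrable \<beta> (\<lambda>z. s (fst z) \<bullet> L (r (snd z)))"
    and "(\<integral>z. s (fst z) \<bullet> L (r (snd z)) \<partial>\<beta>) =
      (\<Sum>a\<in>range s. \<Sum>b\<in>range r. (a \<bullet> L b) * measure \<beta> ((s -` {a}) \<times> (r -` {b})))"
proof -
  interpret prob_space \<beta> by (rule transport_planD(1)[OF \<beta>])
  have eq: "s (fst z) \<bullet> L (r (snd z)) =
      (\<Sum>a\<in>range s. \<Sum>b\<in>range r. (a \<bullet> L b) * indicator ((s -` {a}) \<times> (r -` {b})) z)" for z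
  proof -
    have ind: "(a \<bullet> L b) * indicator ((s -` {a}) \<times> (r -` {b})) z =
        (if r (snd z) = b then (if s (fst z) = a then a \<bullet> L b else 0) else 0)" for a b
      by (cases z) (simp add: indicator_def)
    show ?thesis unfolding ind using s(1) r(1) by (simp add: sum.delta)
  qed
  have i: "integrable \<beta> (\<lambda>z. (a \<bullet> L b) * indicator ((s -` {a}) \<times> (r -` {b})) z)" for a b
    using transport_plan_Times_sets[OF \<beta> s(2) r(2), of a b] by (simp add: emeasure_eq_measure)
  show "integrable \<beta> (\<lambda>z. s (fst z) \<bullet> L (r (snd z)))"
    unfolding eq by (intro Bochner_Integration.integrable_sum i)
  show "(\<integral>z. s (fst z) \<bullet> L (r (snd z)) \<partial>\<beta>) =
      (\<Sum>a\<in>range s. \<Sum>b\<in>range r. (a \<bullet> L b) * measure \<beta> ((s -` {a}) \<times> (r -` {b})))"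
    unfolding eq using transport_plan_Times_sets[OF \<beta> s(2) r(2)] transport_planD(3)[OF \<beta>]
    by (subst Bochner_Integration.integral_sum, use i in simp)+ simp
qed

text \<open>Approximation of the identity in L^2 by simple functions. The bound 2|x| on them yields
  the integrable majorant 9|x|^2.\<close>

lemma simple_square_approx:
  fixes \<rho> :: "'a measure"
  assumes \<rho>: "P2 \<rho>"
  obtains s :: "nat \<Rightarrow> 'a \<Rightarrow> 'a" where "\<And>i. finite (range (s i))" "\<And>i a. s i -` {a} \<in> sets borel"
    "\<And>i x. norm (s i x) \<le> 2 * norm x" "\<And>i. integrable \<rho> (\<lambda>x. (norm (x - s i x))\<^sup>2)"
    "(\<lambda>i. \<integral>x. (norm (x - s i x))\<^sup>2 \<partial>\<rho>) \<longlonglongrightarrow> 0"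
proof -
  have \<rho>s: "sets \<rho> = sets borel" "space \<rho> = UNIV"
    using \<rho> sets_eq_imp_space_eq[of \<rho> borel] by (auto simp: P2_def)
  have "(\<lambda>x::'a. x) \<in> borel_measurable \<rho>" by (simp add: measurable_cong_sets[OF \<rho>s(1) refl])
  from borel_measurable_implies_sequence_metric[OF this, of 0] obtain s where
    s: "\<And>i. simple_function \<rho> (s i)" "\<And>x. (\<lambda>i. s i x) \<longlonglongrightarrow> x" "\<And>i x. norm (s i x) \<le> 2 * norm x"
    by (auto simp: \<rho>s)
  have sm[measurable]: "s i \<in> borel_measurable \<rho>" for i by (rule borel_measurable_simple_function[OF s(1)])
  have idm: "(\<lambda>x::'a. x) \<in> borel_measurable \<rho>" by (simp add: measurable_cong_sets[OF \<rho>s(1) refl])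
  have m: "(\<lambda>x. (norm (x - s i x))\<^sup>2) \<in> borel_measurable \<rho>" for i using sm idm by measurable
  have b: "(norm (x - s i x))\<^sup>2 \<le> 9 * (norm x)\<^sup>2" for i x
  proof -
    have "norm (x - s i x) \<le> 3 * norm x" using norm_triangle_ineq4[of x "s i x"] s(3)[of i x] by simp
    then have "(norm (x - s i x))\<^sup>2 \<le> (3 * norm x)\<^sup>2" by (rule power_mono) simp
    then show ?thesis by (simp add: power_mult_distrib)
  qed
  have ib: "integrable \<rho> (\<lambda>x. 9 * (norm x)\<^sup>2)" using \<rho> by (simp add: P2_def)
  have "(\<lambda>i. \<integral>x. (norm (x - s i x))\<^sup>2 \<partial>\<rho>) \<longlonglongrightarrow> (\<integral>x. 0 \<partial>\<rho>)"
  proof (rule integral_dominated_convergence[OF _ m ib])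
    show "AE x in \<rho>. (\<lambda>i. (norm (x - s i x))\<^sup>2) \<longlonglongrightarrow> 0"
    proof (rule AE_I2)
      fix x
      have "(\<lambda>i. (norm (x - s i x))\<^sup>2) \<longlonglongrightarrow> (norm (x - x))\<^sup>2" by (intro tendsto_intros s(2))
      then show "(\<lambda>i. (norm (x - s i x))\<^sup>2) \<longlonglongrightarrow> 0" by simp
    qed
    show "AE x in \<rho>. norm ((norm (x - s i x))\<^sup>2) \<le> 9 * (norm x)\<^sup>2" for i using b by simp
  qed simp
  moreover have "finite (range (s i))" "s i -` {a} \<in> sets borel" for i a
    using simple_functionD(1)[OF s(1)[of i]] simple_functionD(2)[OF s(1)[of i], of "{a}"]
    by (simp_all add: \<rho>s)
  moreover have "integrable \<rho> (\<lambda>x. (norm (x - s i x))\<^sup>2)" for i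
    by (rule Bochner_Integration.integrable_bound[OF ib m]) (use b in auto)
  ultimately show ?thesis using that[of s] s(3) by simp
qed

text \<open>One pair s, r serves all plans at once: Young's inequality bounds the error by integrals
  that depend only on the marginals.\<close>

lemma bilinear_simple_approx:
  assumes e: "e > 0"
  obtains s r :: "'a \<Rightarrow> 'a" where "finite (range s)" "\<And>a. s -` {a} \<in> sets borel"
    "finite (range r)" "\<And>a. r -` {a} \<in> sets borel"
    "\<And>\<beta>. transport_plan \<mu> \<nu> \<beta> \<Longrightarrow>
      \<bar>(\<integral>z. fst z \<bullet> L (snd z) \<partial>\<beta>) - (\<integral>z. s (fst z) \<bullet> L (r (snd z)) \<partial>\<beta>)\<bar> \<le> e"
proof -
  obtain K where K: "K > 0" "\<And>x y. \<bar>x \<bullet> L y\<bar> \<le> K * (norm x * norm y)" using bilinear_bound by blast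
  obtain s :: "nat \<Rightarrow> 'a \<Rightarrow> 'a" where s: "\<And>i. finite (range (s i))" "\<And>i a. s i -` {a} \<in> sets borel"
    "\<And>i x. norm (s i x) \<le> 2 * norm x" "\<And>i. integrable \<mu> (\<lambda>x. (norm (x - s i x))\<^sup>2)"
    "(\<lambda>i. \<integral>x. (norm (x - s i x))\<^sup>2 \<partial>\<mu>) \<longlonglongrightarrow> 0" by (rule simple_square_approx[OF mu]) (rule that; assumption)
  obtain r :: "nat \<Rightarrow> 'a \<Rightarrow> 'a" where r: "\<And>i. finite (range (r i))" "\<And>i a. r i -` {a} \<in> sets borel"
    "\<And>i x. norm (r i x) \<le> 2 * norm x" "\<And>i. integrable \<nu> (\<lambda>x. (norm (x - r i x))\<^sup>2)"
    "(\<lambda>i. \<integral>x. (norm (x - r i x))\<^sup>2 \<partial>\<nu>) \<longlonglongrightarrow> 0" by (rule simple_square_approx[OF nu]) (rule that; assumption)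
  define m where "m = (\<integral>x. (norm x)\<^sup>2 \<partial>\<mu>)"
  define n where "n = (\<integral>x. (norm x)\<^sup>2 \<partial>\<nu>)"
  have mn: "0 \<le> m" "0 \<le> n" by (simp_all add: m_def n_def)
  \<comment> \<open>The parameter of Young's inequality. It makes the terms with the full second
    moments cost at most e/2; afterwards i is taken so large that the approximation errors, divided
    by t, cost the other half.\<close>
  define t where "t = e / (2 * K * (m + n + 1))"
  have t: "t > 0" using e K mn by (simp add: t_def)
  have Kt: "K * t * (m + n + 1) = e / 2"
  proof -
    have "K * (e / (2 * K * c)) * c = e / 2" if "c > 0" for c using K(1) that by simp
    then show ?thesis unfolding t_def using mn by simp
  qed
  define M where "M i = (\<integral>x. (norm (x - s i x))\<^sup>2 \<partial>\<mu>)" for i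
  define N where "N i = (\<integral>x. (norm (x - r i x))\<^sup>2 \<partial>\<nu>)" for i
  have "(\<lambda>i. K * (M i / t + N i / t)) \<longlonglongrightarrow> K * (0 / t + 0 / t)"
    unfolding M_def N_def by (intro tendsto_intros s r) (use t in auto)
  then have "eventually (\<lambda>i. K * (M i / t + N i / t) < e / 2) sequentially"
    using e by (intro order_tendstoD(2)) auto
  then obtain i where i: "K * (M i / t + N i / t) < e / 2" by (auto simp: eventually_sequentially)
  have pw: "\<bar>x \<bullet> L y - s i x \<bullet> L (r i y)\<bar> \<le>
      K * ((norm (x - s i x))\<^sup>2 / t + t * (norm y)\<^sup>2 + t * (norm x)\<^sup>2 + (norm (y - r i y))\<^sup>2 / t)" for x y
  proof -
    have am: "a * b \<le> (a\<^sup>2 / t + t * b\<^sup>2) / 2" for a b :: real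
    proof -
      have "0 \<le> (a - t * b)\<^sup>2 / t" using t by simp
      also have "\<dots> = a\<^sup>2 / t - 2 * (a * b) + t * b\<^sup>2" using t by (simp add: power2_eq_square field_simps)
      finally show ?thesis by simp
    qed
    have nn: "0 \<le> (norm (x - s i x))\<^sup>2 / t" "0 \<le> t * (norm y)\<^sup>2" using t by auto
    have "x \<bullet> L y - s i x \<bullet> L (r i y) = (x - s i x) \<bullet> L y + s i x \<bullet> L (y - r i y)"
      by (simp add: linear_diff[OF L] inner_diff_left inner_diff_right)
    then have "\<bar>x \<bullet> L y - s i x \<bullet> L (r i y)\<bar> \<le> K * (norm (x - s i x) * norm y) + K * (norm (s i x) * norm (y - r i y))"
      using K(2)[of "x - s i x" y] K(2)[of "s i x" "y - r i y"] by linarith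
    also have "\<dots> \<le> K * (norm (x - s i x) * norm y) + K * ((2 * norm x) * norm (y - r i y))"
      using K(1) s(3) by (intro add_left_mono mult_left_mono mult_right_mono) auto
    also have "\<dots> = K * (norm (x - s i x) * norm y + 2 * (norm (y - r i y) * norm x))"
      by (simp add: algebra_simps)
    also have "\<dots> \<le> K * ((norm (x - s i x))\<^sup>2 / t + t * (norm y)\<^sup>2 + t * (norm x)\<^sup>2 + (norm (y - r i y))\<^sup>2 / t)"
      using am[of "norm (x - s i x)" "norm y"] am[of "norm (y - r i y)" "norm x"] K(1) nn
      by (intro mult_left_mono) auto
    finally show ?thesis .
  qed
  have approx: "\<bar>(\<integral>z. fst z \<bullet> L (snd z) \<partial>\<beta>) - (\<integral>z. s i (fst z) \<bullet> L (r i (snd z)) \<partial>\<beta>)\<bar> \<le> e"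
    if \<beta>: "transport_plan \<mu> \<nu> \<beta>" for \<beta>
  proof -
    have mus: "sets \<mu> = sets borel" and nus: "sets \<nu> = sets borel" using mu nu by (auto simp: P2_def)
    have ms: "(\<lambda>x. (norm (x - s i x))\<^sup>2) \<in> borel_measurable borel"
      using borel_measurable_integrable[OF s(4)[of i]] by (simp add: measurable_cong_sets[OF mus refl])
    have mr: "(\<lambda>x. (norm (x - r i x))\<^sup>2) \<in> borel_measurable borel"
      using borel_measurable_integrable[OF r(4)[of i]] by (simp add: measurable_cong_sets[OF nus refl])
    note T = transport_plan_integral[OF \<beta>]
    have i1: "integrable \<beta> (\<lambda>z. (norm (fst z - s i (fst z)))\<^sup>2)" using T(3)[OF ms] s(4) by simp
    have i2: "integrable \<beta> (\<lambda>z. (norm (snd z - r i (snd z)))\<^sup>2)" using T(4)[OF mr] r(4) by simp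
    note i3 = transport_plan_square_integrable[OF \<beta>]
    note j1 = transport_plan_bilinear_integrable[OF \<beta>]
    note j2 = integral_simple_bilinear(1)[OF \<beta> s(1,2) r(1,2), of i i]
    let ?R = "\<lambda>z. K * ((norm (fst z - s i (fst z)))\<^sup>2 / t + t * (norm (snd z))\<^sup>2 + t * (norm (fst z))\<^sup>2 + (norm (snd z - r i (snd z)))\<^sup>2 / t)"
    have "(\<integral>z. fst z \<bullet> L (snd z) \<partial>\<beta>) - (\<integral>z. s i (fst z) \<bullet> L (r i (snd z)) \<partial>\<beta>) =
        (\<integral>z. fst z \<bullet> L (snd z) - s i (fst z) \<bullet> L (r i (snd z)) \<partial>\<beta>)"
      by (rule Bochner_Integration.integral_diff[symmetric, OF j1 j2])
    also have "\<bar>\<dots>\<bar> \<le> (\<integral>z. \<bar>fst z \<bullet> L (snd z) - s i (fst z) \<bullet> L (r i (snd z))\<bar> \<partial>\<beta>)"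
      by (rule integral_abs_bound)
    also have "\<dots> \<le> (\<integral>z. ?R z \<partial>\<beta>)"
      by (rule integral_mono) (use j1 j2 i1 i2 i3 pw in auto)
    also have "\<dots> = K * (M i / t + t * n + t * m + N i / t)"
      using i1 i2 i3 T(1)[OF ms] T(2)[OF mr] T(1)[of "\<lambda>x. (norm x)\<^sup>2"] T(2)[of "\<lambda>x. (norm x)\<^sup>2"]
      by (simp add: M_def N_def m_def n_def)
    also have "\<dots> = K * (M i / t + N i / t) + K * t * (m + n)" by (simp add: algebra_simps)
    also have "K * t * (m + n) \<le> K * t * (m + n + 1)" using K(1) t by (intro mult_left_mono) auto
    finally show ?thesis using i Kt by linarith
  qed
  show ?thesis by (rule that[OF s(1)[of i] s(2)[of i] r(1)[of i] r(2)[of i] approx])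
qed

text \<open>The direct method: a maximizing sequence, a plan realizing cluster values on all
  rectangles, and the plan-independent approximation to exchange the limit with the
  functional.\<close>

lemma maximal_bilinear_plan_exists:
  "\<exists>\<alpha>. transport_plan \<mu> \<nu> \<alpha> \<and> (\<forall>\<beta>. transport_plan \<mu> \<nu> \<beta> \<longrightarrow>
    (\<integral>z. fst z \<bullet> L (snd z) \<partial>\<beta>) \<le> (\<integral>z. fst z \<bullet> L (snd z) \<partial>\<alpha>))"
proof -
  define J where "J \<beta> = (\<integral>z. fst z \<bullet> L (snd z) \<partial>\<beta>)" for \<beta>
  define Pl where "Pl = {\<beta>. transport_plan \<mu> \<nu> \<beta>}"
  have pm: "prob_space \<mu>" "sets \<mu> = sets borel" and pn: "prob_space \<nu>" "sets \<nu> = sets borel"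
    using mu nu by (auto simp: P2_def)
  have ne: "Pl \<noteq> {}" using product_transport_plan[OF pm pn] by (auto simp: Pl_def)
  obtain s1 r1 :: "'a \<Rightarrow> 'a" where sr1: "finite (range s1)" "\<And>a. s1 -` {a} \<in> sets borel"
    "finite (range r1)" "\<And>a. r1 -` {a} \<in> sets borel"
    "\<And>\<beta>. transport_plan \<mu> \<nu> \<beta> \<Longrightarrow> \<bar>J \<beta> - (\<integral>z. s1 (fst z) \<bullet> L (r1 (snd z)) \<partial>\<beta>)\<bar> \<le> 1"
    unfolding J_def using bilinear_simple_approx[of 1] by auto
  have bdd: "bdd_above (J ` Pl)"
  proof (rule bdd_aboveI2)
    fix \<beta> assume "\<beta> \<in> Pl"
    then have \<beta>: "transport_plan \<mu> \<nu> \<beta>" by (simp add: Pl_def)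
    interpret prob_space \<beta> by (rule transport_planD(1)[OF \<beta>])
    have "(\<integral>z. s1 (fst z) \<bullet> L (r1 (snd z)) \<partial>\<beta>) \<le> (\<Sum>a\<in>range s1. \<Sum>b\<in>range r1. \<bar>a \<bullet> L b\<bar> * 1)"
      unfolding integral_simple_bilinear(2)[OF \<beta> sr1(1-4)]
      by (intro sum_mono mult_mono) auto
    then show "J \<beta> \<le> (\<Sum>a\<in>range s1. \<Sum>b\<in>range r1. \<bar>a \<bullet> L b\<bar> * 1) + 1" using sr1(5)[OF \<beta>] by linarith
  qed
  define S where "S = Sup (J ` Pl)"
  have "\<exists>\<beta>\<in>Pl. S - 1 / real (Suc k) < J \<beta>" for k
    using less_cSUP_iff[OF ne bdd, of "S - 1 / real (Suc k)"] by (simp add: S_def)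
  then obtain \<alpha> where \<alpha>: "\<And>k. \<alpha> k \<in> Pl" "\<And>k. S - 1 / real (Suc k) < J (\<alpha> k)" by metis
  have a: "transport_plan \<mu> \<nu> (\<alpha> k)" for k using \<alpha>(1) by (simp add: Pl_def)
  have JS: "J \<beta> \<le> S" if "\<beta> \<in> Pl" for \<beta> unfolding S_def by (rule cSUP_upper[OF that bdd])
  interpret pk: prob_space "\<alpha> k" for k by (rule transport_planD(1)[OF a])
  define X where "X k AB = measure (\<alpha> k) (fst AB \<times> snd AB)" for k and AB :: "'a set \<times> 'a set"
  obtain G F where G: "G \<noteq> bot" "G \<le> sequentially" and F: "\<And>j. ((\<lambda>k. X k j) \<longlongrightarrow> F j) G"
    by (rule pointwise_cluster_filter[of X]) (auto simp: X_def)
  have lim: "((\<lambda>k. measure (\<alpha> k) (A \<times> B)) \<longlongrightarrow> F (A, B)) G" for A B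
    using F[of "(A, B)"] by (simp add: X_def)
  obtain \<beta> where \<beta>: "transport_plan \<mu> \<nu> \<beta>" "\<And>A B. A \<in> sets borel \<Longrightarrow> B \<in> sets borel \<Longrightarrow> measure \<beta> (A \<times> B) = F (A, B)"
    using transport_plan_limit[OF pm pn a G(1) lim] by blast
  have "S \<le> J \<beta>"
  proof (rule field_le_epsilon)
    fix e :: real assume e: "e > 0"
    obtain s r :: "'a \<Rightarrow> 'a" where sr: "finite (range s)" "\<And>a. s -` {a} \<in> sets borel"
      "finite (range r)" "\<And>a. r -` {a} \<in> sets borel"
      "\<And>\<beta>. transport_plan \<mu> \<nu> \<beta> \<Longrightarrow> \<bar>J \<beta> - (\<integral>z. s (fst z) \<bullet> L (r (snd z)) \<partial>\<beta>)\<bar> \<le> e / 2"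
      unfolding J_def using bilinear_simple_approx[of "e/2"] e by auto
    have "((\<lambda>k. \<integral>z. s (fst z) \<bullet> L (r (snd z)) \<partial>\<alpha> k) \<longlongrightarrow> (\<integral>z. s (fst z) \<bullet> L (r (snd z)) \<partial>\<beta>)) G"
      unfolding integral_simple_bilinear(2)[OF a sr(1-4)] integral_simple_bilinear(2)[OF \<beta>(1) sr(1-4)]
      using \<beta>(2)[OF sr(2,4)] by (intro tendsto_sum tendsto_mult tendsto_const) (simp add: lim)
    moreover have "((\<lambda>k. S - 1 / real (Suc k) - e / 2) \<longlongrightarrow> S - 0 - e / 2) G"
      by (intro tendsto_intros tendsto_mono[OF G(2)])
        (use LIMSEQ_inverse_real_of_nat in \<open>simp add: inverse_eq_divide\<close>)
    ultimately have "S - 0 - e / 2 \<le> (\<integral>z. s (fst z) \<bullet> L (r (snd z)) \<partial>\<beta>)"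
    proof (rule tendsto_le[OF G(1)], intro always_eventually allI)
      fix k show "S - 1 / real (Suc k) - e / 2 \<le> (\<integral>z. s (fst z) \<bullet> L (r (snd z)) \<partial>\<alpha> k)"
        using \<alpha>(2)[of k] sr(5)[OF a, of k] by linarith
    qed
    then show "S \<le> J \<beta> + e" using sr(5)[OF \<beta>(1)] by linarith
  qed
  show ?thesis
  proof (intro exI[of _ \<beta>] conjI allI impI \<beta>(1))
    fix \<gamma> assume "transport_plan \<mu> \<nu> \<gamma>"
    then have "J \<gamma> \<le> S" by (intro JS) (simp add: Pl_def)
    then show "(\<integral>z. fst z \<bullet> L (snd z) \<partial>\<gamma>) \<le> (\<integral>z. fst z \<bullet> L (snd z) \<partial>\<beta>)"
      using \<open>S \<le> J \<beta>\<close> by (simp add: J_def)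
  qed
qed

end

section \<open>Cyclical monotonicity\<close>

text \<open>Optimality for every cost x.Gx/2 + y.Hy/2 - x.Ly when the marginals have second moments,
  freed from the terms that the marginals determine.\<close>

definition maximal_plan :: "('a::euclidean_space \<Rightarrow> 'a) \<Rightarrow> 'a measure \<Rightarrow> 'a measure \<Rightarrow> ('a \<times> 'a) measure \<Rightarrow> bool" where
  "maximal_plan L \<mu> \<nu> \<alpha> \<longleftrightarrow> transport_plan \<mu> \<nu> \<alpha> \<and> (\<forall>\<beta>. transport_plan \<mu> \<nu> \<beta> \<longrightarrow>
    (\<integral>z. fst z \<bullet> L (snd z) \<partial>\<beta>) \<le> (\<integral>z. fst z \<bullet> L (snd z) \<partial>\<alpha>))"

lemma bij_betw_cyclic_shift: "bij_betw (\<lambda>i. Suc i mod N) {..<N} {..<N}"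
proof (cases "N = 0")
  case False
  have "inj_on (\<lambda>i. Suc i mod N) {..<N}"
  proof (rule inj_onI)
    fix i j assume "i \<in> {..<N}" "j \<in> {..<N}" "Suc i mod N = Suc j mod N"
    then show "i = j" by (auto simp: mod_Suc split: if_splits)
  qed
  moreover have "(\<lambda>i. Suc i mod N) ` {..<N} \<subseteq> {..<N}" using False by auto
  ultimately show ?thesis by (simp add: bij_betw_def endo_inj_surj)
qed (simp add: bij_betw_def)

text \<open>Sample independently from maximal plans \<open>\<alpha> 0, \<dots>, \<alpha> (N - 1)\<close>. Cyclically shifting the first
  components whenever this increases the total value, and then choosing one of the \<open>N\<close> pairs
  uniformly at random, produces a plan with the same marginals. By maximality, the shift almost
  surely does not increase the value.\<close>

lemma maximal_plans_shift_null:
  fixes \<alpha> :: "nat \<Rightarrow> ('a::euclidean_space \<times> 'a) measure"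
  assumes mu: "P2 \<mu>" and nu: "P2 \<nu>" and L: "linear L" and \<alpha>: "\<And>i. maximal_plan L \<mu> \<nu> (\<alpha> i)" and N: "N > 0"
  shows "AE z in PiM {..<N} \<alpha>. (\<Sum>i<N. fst (z (Suc i mod N)) \<bullet> L (snd (z i))) \<le> (\<Sum>i<N. fst (z i) \<bullet> L (snd (z i)))"
proof -
  define \<sigma> where "\<sigma> i = Suc i mod N" for i
  have \<sigma>: "bij_betw \<sigma> {..<N} {..<N}" unfolding \<sigma>_def by (rule bij_betw_cyclic_shift)
  have \<sigma>N: "\<sigma> i < N" for i using N by (simp add: \<sigma>_def)
  have a: "transport_plan \<mu> \<nu> (\<alpha> i)" for i using \<alpha> by (simp add: maximal_plan_def)
  note D = transport_planD[OF a]
  have mus: "sets \<mu> = sets borel" and nus: "sets \<nu> = sets borel" using mu nu by (auto simp: P2_def)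
  define P where "P = PiM {..<N} \<alpha>"
  interpret P: prob_space P unfolding P_def by (intro prob_space_PiM D)
  have comp: "distr P (\<alpha> i) (\<lambda>z. z i) = \<alpha> i" if "i < N" for i
    unfolding P_def by (rule distr_PiM_component) (use D(1) that in auto)
  have zm: "(\<lambda>z. z i) \<in> measurable P (\<alpha> i)" if "i < N" for i
    unfolding P_def using that by simp
  have zb[measurable]: "(\<lambda>z. z i) \<in> measurable P borel" if "i < N" for i
    using zm[OF that] by (simp add: measurable_cong_sets[OF refl D(2)])
  have fz: "(\<lambda>z. fst (z i)) \<in> borel_measurable P" "(\<lambda>z. snd (z i)) \<in> borel_measurable P" if "i < N" for i
    using measurable_compose[OF zm[OF that] transport_plan_measurable(1)[OF a]]
      measurable_compose[OF zm[OF that] transport_plan_measurable(2)[OF a]] by simp_all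
  have Lm: "L \<in> borel_measurable borel" by (rule linear_measurable[OF mu nu L])
  have term_m[measurable]: "(\<lambda>z. fst (z i) \<bullet> L (snd (z j))) \<in> borel_measurable P" if "i < N" "j < N" for i j
    by (intro borel_measurable_inner fz that measurable_compose[OF fz(2)[OF that(2)] Lm])
  define s where "s z = (\<Sum>i<N. fst (z i) \<bullet> L (snd (z i)))" for z
  define s' where "s' z = (\<Sum>i<N. fst (z (\<sigma> i)) \<bullet> L (snd (z i)))" for z
  have sm[measurable]: "s \<in> borel_measurable P" "s' \<in> borel_measurable P"
    unfolding s_def s'_def by (auto intro!: borel_measurable_sum term_m \<sigma>N)
  define bad where "bad z \<longleftrightarrow> s z < s' z" for z
  have badm[measurable]: "Measurable.pred P bad" unfolding bad_def by measurable
  \<comment> \<open>The decision to shift depends on the whole sample, but either branch only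
    permutes the first components, so sums over all i of functions of them are unchanged.\<close>
  define x where "x i z = (if bad z then fst (z (\<sigma> i)) else fst (z i))" for i z
  have xm: "x i \<in> borel_measurable P" if "i < N" for i
    unfolding x_def[abs_def] using fz(1)[OF \<sigma>N] fz(1)[OF that] badm by simp
  define U where "U = measure_pmf (pmf_of_set {..<N})"
  have ne: "{..<N} \<noteq> {}" using N by auto
  interpret U: prob_space U unfolding U_def by (rule prob_space_measure_pmf)
  interpret UP: pair_prob_space U P ..
  \<comment> \<open>Indices outside {..<N} have probability 0 under \<open>U\<close>; sending them
    to 0 makes \<open>h\<close> measurable for all natural numbers.\<close>
  define h where "h = (\<lambda>(i, z). (x (if i < N then i else 0) z, snd (z (if i < N then i else 0))))"
  have hm: "h \<in> measurable (U \<Otimes>\<^sub>M P) borel"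
  proof -
    have "h \<in> measurable (count_space UNIV \<Otimes>\<^sub>M P) (borel \<Otimes>\<^sub>M borel)"
      unfolding h_def
    proof (rule measurable_pair_measure_countable1)
      fix i :: nat
      have "(if i < N then i else 0) < N" using N by simp
      then show "(\<lambda>z. case (i, z) of (i, z) \<Rightarrow> (x (if i < N then i else 0) z, snd (z (if i < N then i else 0))))
          \<in> measurable P (borel \<Otimes>\<^sub>M borel)"
        unfolding prod.case by (intro measurable_Pair xm fz)
    qed simp
    moreover have "sets (U \<Otimes>\<^sub>M P) = sets (count_space UNIV \<Otimes>\<^sub>M P)"
      by (rule sets_pair_measure_cong) (simp_all add: U_def)
    then have "measurable (U \<Otimes>\<^sub>M P) (borel :: ('a \<times> 'a) measure) = measurable (count_space UNIV \<Otimes>\<^sub>M P) borel"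
      by (rule measurable_cong_sets[OF _ refl])
    ultimately show ?thesis unfolding borel_prod by blast
  qed
  define \<beta> where "\<beta> = distr (U \<Otimes>\<^sub>M P) borel h"
  have nnint: "(\<integral>\<^sup>+w. g w \<partial>\<beta>) = (\<Sum>i<N. \<integral>\<^sup>+z. g (x i z, snd (z i)) \<partial>P) / ennreal (real N)"
    if g: "g \<in> borel_measurable borel" for g
  proof -
    have "(\<integral>\<^sup>+w. g w \<partial>\<beta>) = (\<integral>\<^sup>+w. g (h w) \<partial>(U \<Otimes>\<^sub>M P))"
      unfolding \<beta>_def by (rule nn_integral_distr[OF hm]) (use g in simp)
    also have "\<dots> = (\<integral>\<^sup>+i. \<integral>\<^sup>+z. g (h (i, z)) \<partial>P \<partial>U)"
      by (rule P.nn_integral_fst[symmetric]) (rule measurable_compose[OF hm g])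
    also have "\<dots> = (\<Sum>i<N. \<integral>\<^sup>+z. g (h (i, z)) \<partial>P) / ennreal (real N)"
      unfolding U_def using ne by (subst nn_integral_pmf_of_set) (auto simp: ennreal_of_nat_eq_real_of_nat)
    also have "(\<Sum>i<N. \<integral>\<^sup>+z. g (h (i, z)) \<partial>P) = (\<Sum>i<N. \<integral>\<^sup>+z. g (x i z, snd (z i)) \<partial>P)"
      by (intro sum.cong refl) (simp add: h_def)
    finally show ?thesis .
  qed
  have Ndiv: "(\<Sum>i<N. c) / ennreal (real N) = c" for c :: ennreal
    using N by (simp add: ennreal_of_nat_eq_real_of_nat[symmetric] mult_divide_eq_ennreal mult.commute)
  have fstint: "(\<integral>\<^sup>+z. f (fst (z i)) \<partial>P) = (\<integral>\<^sup>+x. f x \<partial>\<mu>)" and sndint: "(\<integral>\<^sup>+z. f (snd (z i)) \<partial>P) = (\<integral>\<^sup>+x. f x \<partial>\<nu>)"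
    if i: "i < N" and f: "f \<in> borel_measurable borel" for i f
  proof -
    have fm: "(\<lambda>w. f (fst w)) \<in> borel_measurable (\<alpha> i)" "(\<lambda>w. f (snd w)) \<in> borel_measurable (\<alpha> i)"
      using measurable_compose[OF transport_plan_measurable(1)[OF a] f]
        measurable_compose[OF transport_plan_measurable(2)[OF a] f] by simp_all
    have "(\<integral>\<^sup>+z. f (fst (z i)) \<partial>P) = (\<integral>\<^sup>+w. f (fst w) \<partial>(distr P (\<alpha> i) (\<lambda>z. z i)))"
      by (rule nn_integral_distr[OF zm[OF i], symmetric]) (use fm in simp)
    also have "\<dots> = (\<integral>\<^sup>+x. f x \<partial>(distr (\<alpha> i) borel fst))"
      unfolding comp[OF i] by (rule nn_integral_distr[symmetric]) (use transport_plan_measurable(1)[OF a] f in auto)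
    finally show "(\<integral>\<^sup>+z. f (fst (z i)) \<partial>P) = (\<integral>\<^sup>+x. f x \<partial>\<mu>)" by (simp add: D(4))
    have "(\<integral>\<^sup>+z. f (snd (z i)) \<partial>P) = (\<integral>\<^sup>+w. f (snd w) \<partial>(distr P (\<alpha> i) (\<lambda>z. z i)))"
      by (rule nn_integral_distr[OF zm[OF i], symmetric]) (use fm in simp)
    also have "\<dots> = (\<integral>\<^sup>+x. f x \<partial>(distr (\<alpha> i) borel snd))"
      unfolding comp[OF i] by (rule nn_integral_distr[symmetric]) (use transport_plan_measurable(2)[OF a] f in auto)
    finally show "(\<integral>\<^sup>+z. f (snd (z i)) \<partial>P) = (\<integral>\<^sup>+x. f x \<partial>\<nu>)" by (simp add: D(5))
  qed
  have fst_b: "fst \<in> measurable (borel :: ('a \<times> 'a) measure) borel" and snd_b: "snd \<in> measurable (borel :: ('a \<times> 'a) measure) borel"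
    by (auto intro!: borel_measurable_continuous_onI continuous_intros)
  have b1: "distr \<beta> borel fst = \<mu>"
  proof (rule measure_eqI)
    fix A assume "A \<in> sets (distr \<beta> borel fst)"
    then have A: "A \<in> sets borel" by simp
    then have iA: "(indicator A :: 'a \<Rightarrow> ennreal) \<in> borel_measurable borel" by simp
    have "emeasure (distr \<beta> borel fst) A = (\<integral>\<^sup>+w. indicator A (fst w) \<partial>\<beta>)"
      using A fst_b by (subst nn_integral_indicator[symmetric], simp, subst nn_integral_distr) (auto simp: \<beta>_def)
    also have "\<dots> = (\<Sum>i<N. \<integral>\<^sup>+z. indicator A (x i z) \<partial>P) / ennreal (real N)"
      using measurable_compose[OF fst_b iA] by (subst nnint) simp_all
    also have "(\<Sum>i<N. \<integral>\<^sup>+z. indicator A (x i z) \<partial>P) = (\<integral>\<^sup>+z. (\<Sum>i<N. indicator A (x i z)) \<partial>P)"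
      by (rule nn_integral_sum[symmetric]) (use measurable_compose[OF xm iA] in auto)
    also have "\<dots> = (\<integral>\<^sup>+z. (\<Sum>i<N. indicator A (fst (z i))) \<partial>P)"
    proof (rule nn_integral_cong)
      fix z :: "nat \<Rightarrow> 'a \<times> 'a"
      have "(\<Sum>i<N. indicator A (fst (z (\<sigma> i))) :: ennreal) = (\<Sum>i<N. indicator A (fst (z i)))"
        by (rule sum.reindex_bij_betw[OF \<sigma>])
      then show "(\<Sum>i<N. indicator A (x i z) :: ennreal) = (\<Sum>i<N. indicator A (fst (z i)))"
        by (cases "bad z") (simp_all add: x_def)
    qed
    also have "\<dots> = (\<Sum>i<N. \<integral>\<^sup>+z. indicator A (fst (z i)) \<partial>P)"
      by (rule nn_integral_sum) (use measurable_compose[OF fz(1) iA] in auto)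
    also have "\<dots> = (\<Sum>i<N. emeasure \<mu> A)"
      by (intro sum.cong refl, subst fstint[OF _ iA]) (use A mus in auto)
    finally show "emeasure (distr \<beta> borel fst) A = emeasure \<mu> A" by (simp only: Ndiv)
  qed (simp add: mus)
  have b2: "distr \<beta> borel snd = \<nu>"
  proof (rule measure_eqI)
    fix A assume "A \<in> sets (distr \<beta> borel snd)"
    then have A: "A \<in> sets borel" by simp
    then have iA: "(indicator A :: 'a \<Rightarrow> ennreal) \<in> borel_measurable borel" by simp
    have "emeasure (distr \<beta> borel snd) A = (\<integral>\<^sup>+w. indicator A (snd w) \<partial>\<beta>)"
      using A snd_b by (subst nn_integral_indicator[symmetric], simp, subst nn_integral_distr) (auto simp: \<beta>_def)
    also have "\<dots> = (\<Sum>i<N. \<integral>\<^sup>+z. indicator A (snd (z i)) \<partial>P) / ennreal (real N)"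
      using measurable_compose[OF snd_b iA] by (subst nnint) simp_all
    also have "(\<Sum>i<N. \<integral>\<^sup>+z. indicator A (snd (z i)) \<partial>P) = (\<Sum>i<N. emeasure \<nu> A)"
      by (intro sum.cong refl, subst sndint[OF _ iA]) (use A nus in auto)
    finally show "emeasure (distr \<beta> borel snd) A = emeasure \<nu> A" by (simp only: Ndiv)
  qed (simp add: nus)
  have \<beta>: "transport_plan \<mu> \<nu> \<beta>"
    unfolding transport_plan_def using b1 b2 UP.prob_space_distr[OF hm] by (simp add: \<beta>_def)
  have Jm: "(\<lambda>w. fst w \<bullet> L (snd w)) \<in> borel_measurable (borel :: ('a \<times> 'a) measure)"
    by (rule measurable_bilinear[OF mu nu L])
  have ti: "integrable P (\<lambda>z. fst (z i) \<bullet> L (snd (z i)))" and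
    tv: "(\<integral>z. fst (z i) \<bullet> L (snd (z i)) \<partial>P) = (\<integral>w. fst w \<bullet> L (snd w) \<partial>\<alpha> i)" if i: "i < N" for i
  proof -
    have m: "(\<lambda>w. fst w \<bullet> L (snd w)) \<in> borel_measurable (\<alpha> i)"
      using Jm by (simp add: measurable_cong_sets[OF D(2) refl])
    show "integrable P (\<lambda>z. fst (z i) \<bullet> L (snd (z i)))"
      using integrable_distr_eq[OF zm[OF i] m] transport_plan_bilinear_integrable[OF mu nu L a, of i]
      by (simp add: comp[OF i])
    show "(\<integral>z. fst (z i) \<bullet> L (snd (z i)) \<partial>P) = (\<integral>w. fst w \<bullet> L (snd w) \<partial>\<alpha> i)"
      using integral_distr[OF zm[OF i] m] by (simp add: comp[OF i])
  qed
  \<comment> \<open>Integrability of the modified terms is inherited from \<open>\<beta>\<close>,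
    already known to be a plan between measures with second moments; every i < N is charged by
    \<open>U\<close>.\<close>
  have xi: "integrable P (\<lambda>z. x i z \<bullet> L (snd (z i)))" if i: "i < N" for i
  proof -
    have "integrable (U \<Otimes>\<^sub>M P) (\<lambda>w. fst (h w) \<bullet> L (snd (h w)))"
      using integrable_distr_eq[OF hm, of "\<lambda>w. fst w \<bullet> L (snd w)"] Jm
        transport_plan_bilinear_integrable[OF mu nu L \<beta>] by (simp add: \<beta>_def)
    then have "AE j in U. integrable P (\<lambda>z. fst (h (j, z)) \<bullet> L (snd (h (j, z))))"
      by (rule UP.AE_integrable_fst')
    then have "integrable P (\<lambda>z. fst (h (i, z)) \<bullet> L (snd (h (i, z))))"
      unfolding U_def using i ne by (simp add: AE_measure_pmf_iff)
    then show ?thesis using i by (simp add: h_def)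
  qed
  have Jb: "(\<integral>w. fst w \<bullet> L (snd w) \<partial>\<beta>) = (\<Sum>i<N. \<integral>z. x i z \<bullet> L (snd (z i)) \<partial>P) / real N"
  proof -
    have "(\<integral>w. fst w \<bullet> L (snd w) \<partial>\<beta>) = (\<integral>w. fst (h w) \<bullet> L (snd (h w)) \<partial>(U \<Otimes>\<^sub>M P))"
      unfolding \<beta>_def by (rule integral_distr[OF hm]) (use Jm in simp)
    also have "\<dots> = (\<integral>i. \<integral>z. fst (h (i, z)) \<bullet> L (snd (h (i, z))) \<partial>P \<partial>U)"
    proof (rule UP.integral_fst'[symmetric])
      show "integrable (U \<Otimes>\<^sub>M P) (\<lambda>w. fst (h w) \<bullet> L (snd (h w)))"
        using integrable_distr_eq[OF hm, of "\<lambda>w. fst w \<bullet> L (snd w)"] Jm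
          transport_plan_bilinear_integrable[OF mu nu L \<beta>] by (simp add: \<beta>_def)
    qed
    also have "\<dots> = (\<Sum>i<N. \<integral>z. fst (h (i, z)) \<bullet> L (snd (h (i, z))) \<partial>P) / real N"
      unfolding U_def using ne by (subst integral_pmf_of_set) auto
    also have "(\<Sum>i<N. \<integral>z. fst (h (i, z)) \<bullet> L (snd (h (i, z))) \<partial>P) = (\<Sum>i<N. \<integral>z. x i z \<bullet> L (snd (z i)) \<partial>P)"
      by (intro sum.cong refl) (simp add: h_def)
    finally show ?thesis .
  qed
  \<comment> \<open>The gain from shifting. Its integral is N times the value of
    \<open>\<beta>\<close> minus the sum of the values of the \<open>\<alpha> i\<close>, which
    maximality makes nonpositive although d \<ge> 0.\<close>
  define d where "d z = (if bad z then s' z - s z else 0)" for z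
  have dx: "d z = (\<Sum>i<N. x i z \<bullet> L (snd (z i))) - (\<Sum>i<N. fst (z i) \<bullet> L (snd (z i)))" for z
    by (cases "bad z") (simp_all add: d_def x_def s_def s'_def)
  have di: "integrable P d"
    unfolding dx using xi ti by (intro Bochner_Integration.integrable_diff Bochner_Integration.integrable_sum) auto
  have dpos: "0 \<le> d z" for z by (simp add: d_def bad_def)
  have "(\<integral>z. d z \<partial>P) \<le> 0"
  proof -
    have le: "(\<integral>w. fst w \<bullet> L (snd w) \<partial>\<beta>) \<le> (\<integral>w. fst w \<bullet> L (snd w) \<partial>\<alpha> i)" for i
      using \<alpha>[of i] \<beta> by (simp add: maximal_plan_def)
    have "(\<Sum>i<N. \<integral>z. x i z \<bullet> L (snd (z i)) \<partial>P) = (\<Sum>i<N. (\<integral>w. fst w \<bullet> L (snd w) \<partial>\<beta>))"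
      using N unfolding Jb by simp
    also have "\<dots> \<le> (\<Sum>i<N. \<integral>w. fst w \<bullet> L (snd w) \<partial>\<alpha> i)" by (intro sum_mono le)
    also have "\<dots> = (\<Sum>i<N. \<integral>z. fst (z i) \<bullet> L (snd (z i)) \<partial>P)" by (intro sum.cong refl) (simp add: tv)
    finally show ?thesis
      unfolding dx using xi ti by (subst Bochner_Integration.integral_diff) (auto simp: Bochner_Integration.integral_sum)
  qed
  then have "(\<integral>z. d z \<partial>P) = 0" using dpos by (intro antisym integral_nonneg) auto
  then have "AE z in P. d z = 0"
    using integral_nonneg_eq_0_iff_AE[OF di] dpos by simp
  then have "AE z in P. s' z \<le> s z"
    by eventually_elim (auto simp: d_def bad_def split: if_splits)
  then show ?thesis unfolding P_def s_def s'_def \<sigma>_def .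
qed

section \<open>Supports of maximal plans\<close>

definition msupport :: "'a::topological_space measure \<Rightarrow> 'a set" where
  "msupport M = {x. \<forall>U. open U \<longrightarrow> x \<in> U \<longrightarrow> emeasure M U > 0}"

text \<open>The complement of the support is covered by the null members of a countable
  base.\<close>

lemma AE_msupport:
  fixes M :: "'a::second_countable_topology measure"
  assumes "sets M = sets borel"
  shows "AE x in M. x \<in> msupport M"
proof -
  obtain B :: "'a set set" where B: "countable B" "topological_basis B"
    using ex_countable_basis by blast
  have "(\<Union>U\<in>{U \<in> B. emeasure M U = 0}. U) \<in> null_sets M"
  proof (rule null_sets_UN')
    show "countable {U \<in> B. emeasure M U = 0}" using B(1) by auto
    show "U \<in> null_sets M" if "U \<in> {U \<in> B. emeasure M U = 0}" for U
      using that topological_basis_open[OF B(2)] assms by (auto simp: null_sets_def)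
  qed
  then show ?thesis
  proof (rule AE_I')
    show "{x \<in> space M. x \<notin> msupport M} \<subseteq> (\<Union>U\<in>{U \<in> B. emeasure M U = 0}. U)"
    proof safe
      fix x assume "x \<notin> msupport M"
      then obtain U where U: "open U" "x \<in> U" "emeasure M U = 0" by (auto simp: msupport_def)
      obtain V where V: "V \<in> B" "x \<in> V" "V \<subseteq> U" using topological_basisE[OF B(2) U(1,2)] .
      have "emeasure M V \<le> emeasure M U" using V(3) U(1) assms by (intro emeasure_mono) auto
      then show "x \<in> (\<Union>U\<in>{U \<in> B. emeasure M U = 0}. U)" using V U(3) by auto
    qed
  qed
qed

definition plan_support :: "('a::euclidean_space \<Rightarrow> 'a) \<Rightarrow> 'a measure \<Rightarrow> 'a measure \<Rightarrow> ('a \<times> 'a) set" where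
  "plan_support L \<mu> \<nu> = \<Union> (msupport ` {\<alpha>. maximal_plan L \<mu> \<nu> \<alpha>})"

text \<open>A strict violation at \<open>w\<close> is an open condition and persists on a product of
  neighbourhoods. Each w i lies in a support, so this product has positive measure under the product
  of the chosen plans, against the almost sure inequality.\<close>

lemma plan_support_cyclically_monotone:
  fixes w :: "nat \<Rightarrow> 'a::euclidean_space \<times> 'a"
  assumes mu: "P2 \<mu>" and nu: "P2 \<nu>" and L: "linear L"
    and w: "\<And>i. i < N \<Longrightarrow> w i \<in> plan_support L \<mu> \<nu>"
  shows "(\<Sum>i<N. fst (w (Suc i mod N)) \<bullet> L (snd (w i))) \<le> (\<Sum>i<N. fst (w i) \<bullet> L (snd (w i)))"
proof (cases "N = 0")
  case False
  then have N: "N > 0" by simp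
  \<comment> \<open>Indices beyond N get some maximal plan too, because the sampling lemma takes a
    family indexed by all natural numbers.\<close>
  have "\<forall>i. \<exists>\<alpha>. maximal_plan L \<mu> \<nu> \<alpha> \<and> (i < N \<longrightarrow> w i \<in> msupport \<alpha>)"
  proof
    fix i
    show "\<exists>\<alpha>. maximal_plan L \<mu> \<nu> \<alpha> \<and> (i < N \<longrightarrow> w i \<in> msupport \<alpha>)"
      using w[of i] w[OF N] by (cases "i < N") (auto simp: plan_support_def)
  qed
  then obtain \<alpha> where \<alpha>: "\<And>i. maximal_plan L \<mu> \<nu> (\<alpha> i)" "\<And>i. i < N \<Longrightarrow> w i \<in> msupport (\<alpha> i)"
    using choice[of "\<lambda>i \<alpha>. maximal_plan L \<mu> \<nu> \<alpha> \<and> (i < N \<longrightarrow> w i \<in> msupport \<alpha>)"] by blast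
  define s where "s z = (\<Sum>i<N. fst (z i) \<bullet> L (snd (z i)))" for z :: "nat \<Rightarrow> 'a \<times> 'a"
  define s' where "s' z = (\<Sum>i<N. fst (z (Suc i mod N)) \<bullet> L (snd (z i)))" for z :: "nat \<Rightarrow> 'a \<times> 'a"
  have "s' w \<le> s w"
  proof (rule ccontr)
    assume "\<not> s' w \<le> s w"
    then have bad: "w \<in> {z. s z < s' z}" by simp
    have cL: "continuous_on UNIV L" using L linear_continuous_on linear_conv_bounded_linear by blast
    have "continuous_on UNIV s" "continuous_on UNIV s'"
      unfolding s_def s'_def
      by (intro continuous_on_sum continuous_on_inner continuous_on_fst continuous_on_product_coordinates
        continuous_on_compose2[OF cL] continuous_on_snd subset_UNIV)+
    then have "open {z. s z < s' z}" by (intro open_Collect_less)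
    then have "openin (product_topology (\<lambda>i. euclidean) UNIV) {z. s z < s' z}"
      by (simp add: euclidean_product_topology)
    from product_topology_open_contains_basis[OF this bad] obtain X where
      X: "w \<in> (\<Pi>\<^sub>E i\<in>UNIV. X i)" "\<And>i. open (X i)" "(\<Pi>\<^sub>E i\<in>UNIV. X i) \<subseteq> {z. s z < s' z}" by auto
    have a: "transport_plan \<mu> \<nu> (\<alpha> i)" for i using \<alpha> by (simp add: maximal_plan_def)
    note D = transport_planD[OF a]
    interpret product_sigma_finite \<alpha>
      by (rule product_sigma_finite.intro) (rule prob_space_imp_sigma_finite[OF D(1)])
    have Xs: "X i \<in> sets (\<alpha> i)" for i using X(2) D(2) by simp
    have "emeasure (PiM {..<N} \<alpha>) (Pi\<^sub>E {..<N} X) = (\<Prod>i<N. emeasure (\<alpha> i) (X i))"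
      by (rule emeasure_PiM) (use Xs in auto)
    moreover have "(\<Prod>i<N. emeasure (\<alpha> i) (X i)) \<noteq> 0"
    proof -
      have "emeasure (\<alpha> i) (X i) \<noteq> 0" if "i < N" for i
        using \<alpha>(2)[OF that] X(1,2) by (force simp: msupport_def PiE_iff)
      then show ?thesis by (simp add: prod_zero_iff)
    qed
    moreover have "emeasure (PiM {..<N} \<alpha>) (Pi\<^sub>E {..<N} X) = 0"
    proof -
      have "AE z in PiM {..<N} \<alpha>. z \<notin> Pi\<^sub>E {..<N} X"
        using maximal_plans_shift_null[OF mu nu L \<alpha>(1) N]
      proof eventually_elim
        case (elim z)
        show ?case
        proof
          assume z: "z \<in> Pi\<^sub>E {..<N} X"
          \<comment> \<open>Padding with \<open>w\<close> outside {..<N} lands in the neighbourhood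
            taken in the full infinite product; the cyclic sums do not see the padding.\<close>
          define z' where "z' i = (if i < N then z i else w i)" for i
          have "z' \<in> (\<Pi>\<^sub>E i\<in>UNIV. X i)" using z X(1) by (auto simp: z'_def PiE_iff)
          then have "s z' < s' z'" using X(3) by blast
          moreover have "s z' = s z" "s' z' = s' z" using N by (auto simp: s_def s'_def z'_def)
          ultimately show False using elim by (simp add: s_def s'_def)
        qed
      qed
      moreover have "Pi\<^sub>E {..<N} X \<in> sets (PiM {..<N} \<alpha>)" using Xs by (intro sets_PiM_I_finite) auto
      ultimately show ?thesis using AE_iff_null_sets by blast
    qed
    ultimately show False by simp
  qed
  then show ?thesis by (simp add: s_def s'_def)
qed simp

section \<open>Suprema of affine functions and Rockafellar's potential\<close>

text \<open>A set of pairs (slope, constant) encodes a supremum of affine functions, and this is its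
  effective domain; outside of it the real-valued \<open>affine_sup\<close> carries no
  information.\<close>

definition affine_dom :: "('a::euclidean_space \<times> real) set \<Rightarrow> 'a set" where
  "affine_dom S = {x. bdd_above ((\<lambda>(p, c). p \<bullet> x + c) ` S)}"

definition affine_sup :: "('a::euclidean_space \<times> real) set \<Rightarrow> 'a \<Rightarrow> real" where
  "affine_sup S x = (SUP (p, c)\<in>S. p \<bullet> x + c)"

lemma affine_sup_upper:
  assumes "x \<in> affine_dom S" "(p, c) \<in> S"
  shows "p \<bullet> x + c \<le> affine_sup S x"
  using cSUP_upper[OF assms(2), of "\<lambda>(p, c). p \<bullet> x + c"] assms(1)
  by (simp add: affine_dom_def affine_sup_def)

lemma affine_sup_least:
  assumes "S \<noteq> {}" "\<And>p c. (p, c) \<in> S \<Longrightarrow> p \<bullet> x + c \<le> u"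
  shows "affine_sup S x \<le> u"
  unfolding affine_sup_def by (rule cSUP_least[OF assms(1)]) (use assms(2) in auto)

lemma affine_domI:
  assumes "\<And>p c. (p, c) \<in> S \<Longrightarrow> p \<bullet> x + c \<le> u"
  shows "x \<in> affine_dom S"
  unfolding affine_dom_def using assms by (auto intro!: bdd_aboveI[of _ u])

lemma convex_on_affine_sup:
  assumes S: "S \<noteq> {}"
  shows "convex_on (affine_dom S) (affine_sup S)"
proof -
  have key: "p \<bullet> (u *\<^sub>R x + v *\<^sub>R y) + c \<le> u * affine_sup S x + v * affine_sup S y"
    if "x \<in> affine_dom S" "y \<in> affine_dom S" "0 \<le> u" "0 \<le> v" "u + v = 1" "(p, c) \<in> S" for x y u v p c
  proof -
    have "u * (p \<bullet> x + c) + v * (p \<bullet> y + c) = u * (p \<bullet> x) + v * (p \<bullet> y) + (u + v) * c"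
      by (simp add: algebra_simps)
    then have "p \<bullet> (u *\<^sub>R x + v *\<^sub>R y) + c = u * (p \<bullet> x + c) + v * (p \<bullet> y + c)"
      using that(5) by (simp add: inner_add_right)
    also have "\<dots> \<le> u * affine_sup S x + v * affine_sup S y"
      using that by (intro add_mono mult_left_mono affine_sup_upper)
    finally show ?thesis .
  qed
  show ?thesis
    unfolding convex_on_def
  proof (intro conjI ballI allI impI)
    show "convex (affine_dom S)"
      by (rule convexI, rule affine_domI, rule key)
    fix x y u v assume "x \<in> affine_dom S" "y \<in> affine_dom S" "0 \<le> u" "0 \<le> v" "u + v = (1::real)"
    then show "affine_sup S (u *\<^sub>R x + v *\<^sub>R y) \<le> u * affine_sup S x + v * affine_sup S y"
      by (intro affine_sup_least[OF S] key)
  qed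
qed

text \<open>The affine functions come from chains in \<open>\<Gamma>\<close> that start at a fixed
  pair. Closing a chain to a cycle bounds all of them by 0 at the base point, and prolonging a chain
  by (x, y) gives the subgradient inequality for L y at x.\<close>

lemma Rockafellar:
  fixes \<Gamma> :: "('a::euclidean_space \<times> 'a) set" and L :: "'a \<Rightarrow> 'a"
  assumes ne: "\<Gamma> \<noteq> {}"
    and cyc: "\<And>N w. (\<And>i. i < N \<Longrightarrow> w i \<in> \<Gamma>) \<Longrightarrow>
      (\<Sum>i<N. fst (w (Suc i mod N)) \<bullet> L (snd (w i))) \<le> (\<Sum>i<N. fst (w i) \<bullet> L (snd (w i)))"
  shows "\<exists>S. S \<noteq> {} \<and> (\<forall>(x, y)\<in>\<Gamma>. L y \<in> subgrad (affine_dom S) (affine_sup S) x)"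
proof -
  obtain w0 where w0: "w0 \<in> \<Gamma>" using ne by blast
  define chain where "chain n w \<longleftrightarrow> w 0 = w0 \<and> (\<forall>i\<le>n. w i \<in> \<Gamma>)" for n :: nat and w :: "nat \<Rightarrow> 'a \<times> 'a"
  \<comment> \<open>The constant term of z |-> (sum over the chain) + (z - x_n).L y_n, the slope
    being L y_n.\<close>
  define c where "c n w = (\<Sum>i<n. (fst (w (Suc i)) - fst (w i)) \<bullet> L (snd (w i))) - fst (w n) \<bullet> L (snd (w n))"
    for n :: nat and w :: "nat \<Rightarrow> 'a \<times> 'a"
  define S where "S = {(L (snd (w n)), c n w) | n w. chain n w}"
  have Sne: "S \<noteq> {}"
  proof -
    have "chain 0 (\<lambda>_. w0)" using w0 by (simp add: chain_def)
    then show ?thesis unfolding S_def by blast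
  qed
  have at0: "p \<bullet> fst w0 + d \<le> 0" if "(p, d) \<in> S" for p d
  proof -
    obtain n w where nw: "p = L (snd (w n))" "d = c n w" "chain n w" using \<open>(p, d) \<in> S\<close> by (auto simp: S_def)
    have wG: "w i \<in> \<Gamma>" if "i < Suc n" for i using nw(3) that by (simp add: chain_def less_Suc_eq_le)
    have "(\<Sum>i<Suc n. fst (w (Suc i mod Suc n)) \<bullet> L (snd (w i))) \<le> (\<Sum>i<Suc n. fst (w i) \<bullet> L (snd (w i)))"
      by (rule cyc[OF wG])
    moreover have "(\<Sum>i<Suc n. fst (w (Suc i mod Suc n)) \<bullet> L (snd (w i))) =
        (\<Sum>i<n. fst (w (Suc i)) \<bullet> L (snd (w i))) + fst w0 \<bullet> L (snd (w n))"
      using nw(3) by (simp add: chain_def)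
    moreover have "c n w = (\<Sum>i<n. fst (w (Suc i)) \<bullet> L (snd (w i))) - (\<Sum>i<Suc n. fst (w i) \<bullet> L (snd (w i)))"
      by (simp add: c_def inner_diff_left sum_subtractf)
    ultimately show ?thesis unfolding nw(1,2) inner_commute[of "L (snd (w n))"] by linarith
  qed
  have extend: "\<exists>d'. (L y, d') \<in> S \<and> (\<forall>z. L y \<bullet> z + d' = L y \<bullet> (z - x) + (p \<bullet> x + d))"
    if pd: "(p, d) \<in> S" and xy: "(x, y) \<in> \<Gamma>" for p d x y
  proof -
    obtain n w where nw: "p = L (snd (w n))" "d = c n w" "chain n w" using pd by (auto simp: S_def)
    define w' where "w' = w(Suc n := (x, y))"
    have "chain (Suc n) w'" using nw(3) xy by (auto simp: chain_def w'_def le_Suc_eq)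
    then have "(L (snd (w' (Suc n))), c (Suc n) w') \<in> S" unfolding S_def by blast
    then have "(L y, c (Suc n) w') \<in> S" by (simp add: w'_def)
    moreover have "L y \<bullet> z + c (Suc n) w' = L y \<bullet> (z - x) + (p \<bullet> x + d)" for z
    proof -
      have "c (Suc n) w' = (\<Sum>i<n. (fst (w' (Suc i)) - fst (w' i)) \<bullet> L (snd (w' i))) +
          (x - fst (w n)) \<bullet> L (snd (w n)) - x \<bullet> L y"
        by (simp add: c_def w'_def)
      also have "(\<Sum>i<n. (fst (w' (Suc i)) - fst (w' i)) \<bullet> L (snd (w' i))) =
          (\<Sum>i<n. (fst (w (Suc i)) - fst (w i)) \<bullet> L (snd (w i)))"
        by (intro sum.cong refl) (simp add: w'_def)
      finally show ?thesis unfolding nw(1,2) c_def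
        by (simp add: inner_diff_left inner_diff_right inner_commute)
    qed
    ultimately show ?thesis by blast
  qed
  have "L y \<in> subgrad (affine_dom S) (affine_sup S) x" if xy: "(x, y) \<in> \<Gamma>" for x y
  proof -
    \<comment> \<open>The chain prolonged by (x, y) is at most 0 at the base point; this bounds the
      original chain at x, so x belongs to the domain.\<close>
    have "p \<bullet> x + d \<le> - (L y \<bullet> (fst w0 - x))" if pd: "(p, d) \<in> S" for p d
      using extend[OF pd xy] at0 by fastforce
    then have x: "x \<in> affine_dom S" by (rule affine_domI)
    have "affine_sup S x + L y \<bullet> (z - x) \<le> affine_sup S z" if z: "z \<in> affine_dom S" for z
    proof -
      have "affine_sup S x \<le> affine_sup S z - L y \<bullet> (z - x)"
      proof (rule affine_sup_least[OF Sne])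
        fix p d assume pd: "(p, d) \<in> S"
        obtain d' where d': "(L y, d') \<in> S" "\<And>z. L y \<bullet> z + d' = L y \<bullet> (z - x) + (p \<bullet> x + d)"
          using extend[OF pd xy] by blast
        show "p \<bullet> x + d \<le> affine_sup S z - L y \<bullet> (z - x)"
          using affine_sup_upper[OF z d'(1)] d'(2)[of z] by simp
      qed
      then show ?thesis by simp
    qed
    then show ?thesis using x by (simp add: subgrad_def)
  qed
  then show ?thesis using Sne by blast
qed

section \<open>Absolutely continuous curves\<close>

definition nonoverlapping :: "real \<Rightarrow> real \<Rightarrow> nat \<Rightarrow> (nat \<Rightarrow> real) \<Rightarrow> (nat \<Rightarrow> real) \<Rightarrow> bool" where
  "nonoverlapping t s k a b \<longleftrightarrow> (\<forall>i<k. t \<le> a i \<and> a i \<le> b i \<and> b i \<le> s) \<and>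
     (\<forall>i<k. \<forall>j<k. i \<noteq> j \<longrightarrow> b i \<le> a j \<or> b j \<le> a i)"

lemma abs_cont_on_iff:
  "abs_cont_on t s f \<longleftrightarrow> (\<forall>e>0. \<exists>d>0. \<forall>k a b. nonoverlapping t s k a b \<and> (\<Sum>i<k. b i - a i) < d \<longrightarrow>
     (\<Sum>i<k. norm (f (b i) - f (a i))) < e)"
  unfolding abs_cont_on_def nonoverlapping_def by (simp only: conj_assoc)

lemma abs_cont_onD:
  assumes "abs_cont_on t s f" "e > 0"
  shows "\<exists>d>0. \<forall>k a b. nonoverlapping t s k a b \<longrightarrow> (\<Sum>i<k. b i - a i) < d \<longrightarrow>
    (\<Sum>i<k. norm (f (b i) - f (a i))) < e"
  using assms unfolding abs_cont_on_iff by meson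

text \<open>One estimate of increments serves sums, bilinear expressions and continuously
  differentiable curves alike.\<close>

lemma abs_cont_on_dominated:
  fixes f :: "real \<Rightarrow> 'a::real_normed_vector" and g :: "real \<Rightarrow> 'b::real_normed_vector"
    and F :: "real \<Rightarrow> 'c::real_normed_vector"
  assumes f: "abs_cont_on t s f" and g: "abs_cont_on t s g" and C: "C \<ge> 0"
    and le: "\<And>a b. t \<le> a \<Longrightarrow> a \<le> b \<Longrightarrow> b \<le> s \<Longrightarrow>
      norm (F b - F a) \<le> C * (norm (f b - f a) + norm (g b - g a) + (b - a))"
  shows "abs_cont_on t s F"
  unfolding abs_cont_on_iff
proof (intro allI impI)
  fix e :: real assume e: "e > 0"
  \<comment> \<open>Three sums of increments, each below e'; the summand 1 covers C = 0.\<close>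
  define e' where "e' = e / (3 * (C + 1))"
  have e': "e' > 0" using e C by (simp add: e'_def)
  obtain d1 where d1: "d1 > 0" "\<And>k a b. nonoverlapping t s k a b \<Longrightarrow> (\<Sum>i<k. b i - a i) < d1 \<Longrightarrow>
    (\<Sum>i<k. norm (f (b i) - f (a i))) < e'" using abs_cont_onD[OF f e'] by blast
  obtain d2 where d2: "d2 > 0" "\<And>k a b. nonoverlapping t s k a b \<Longrightarrow> (\<Sum>i<k. b i - a i) < d2 \<Longrightarrow>
    (\<Sum>i<k. norm (g (b i) - g (a i))) < e'" using abs_cont_onD[OF g e'] by blast
  show "\<exists>d>0. \<forall>k a b. nonoverlapping t s k a b \<and> (\<Sum>i<k. b i - a i) < d \<longrightarrow>
      (\<Sum>i<k. norm (F (b i) - F (a i))) < e"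
  proof (intro exI[of _ "min e' (min d1 d2)"] conjI allI impI)
    show "min e' (min d1 d2) > 0" using e' d1 d2 by simp
    fix k :: nat and a b
    assume asm: "nonoverlapping t s k a b \<and> (\<Sum>i<k. b i - a i) < min e' (min d1 d2)"
    then have no: "nonoverlapping t s k a b" and *: "(\<Sum>i<k. b i - a i) < e'" "(\<Sum>i<k. b i - a i) < d1"
      "(\<Sum>i<k. b i - a i) < d2" by auto
    have "(\<Sum>i<k. norm (F (b i) - F (a i))) \<le>
        (\<Sum>i<k. C * (norm (f (b i) - f (a i)) + norm (g (b i) - g (a i)) + (b i - a i)))"
      by (rule sum_mono) (use le no in \<open>auto simp: nonoverlapping_def\<close>)
    also have "\<dots> = C * ((\<Sum>i<k. norm (f (b i) - f (a i))) + (\<Sum>i<k. norm (g (b i) - g (a i))) + (\<Sum>i<k. b i - a i))"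
      by (simp add: sum_distrib_left[symmetric] sum.distrib)
    also have "\<dots> \<le> C * (3 * e')"
      using d1(2)[OF no *(2)] d2(2)[OF no *(3)] *(1) C by (intro mult_left_mono) auto
    also have "\<dots> < (C + 1) * (3 * e')" using e' by (intro mult_strict_right_mono) auto
    also have "\<dots> = e"
    proof -
      have "c * (3 * (e / (3 * c))) = e" if "c > 0" for c using that by simp
      from this[of "C + 1"] show ?thesis unfolding e'_def using C by linarith
    qed
    finally show "(\<Sum>i<k. norm (F (b i) - F (a i))) < e" .
  qed
qed

lemma abs_cont_on_const: "abs_cont_on t s (\<lambda>_. c)"
  unfolding abs_cont_on_def by (auto intro!: exI[of _ 1])

lemma abs_cont_on_add:
  assumes "abs_cont_on t s f" "abs_cont_on t s g"
  shows "abs_cont_on t s (\<lambda>\<tau>. f \<tau> + g \<tau>)"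
proof (rule abs_cont_on_dominated[OF assms, of 1])
  fix a b :: real assume "a \<le> b"
  have "norm (f b + g b - (f a + g a)) \<le> norm (f b - f a) + norm (g b - g a)"
    using norm_triangle_ineq[of "f b - f a" "g b - g a"] by (simp add: algebra_simps)
  then show "norm (f b + g b - (f a + g a)) \<le> 1 * (norm (f b - f a) + norm (g b - g a) + (b - a))"
    using \<open>a \<le> b\<close> by simp
qed simp

lemma abs_cont_on_sum:
  assumes "finite I" "\<And>i. i \<in> I \<Longrightarrow> abs_cont_on t s (f i)"
  shows "abs_cont_on t s (\<lambda>\<tau>. \<Sum>i\<in>I. f i \<tau>)"
  using assms by (induction I rule: finite_induct) (auto intro: abs_cont_on_const abs_cont_on_add)

lemma abs_cont_on_continuous:
  assumes "abs_cont_on t s f"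
  shows "continuous_on {t..s} f"
  unfolding continuous_on_iff
proof (intro ballI allI impI)
  fix x e :: real assume x: "x \<in> {t..s}" and e: "e > 0"
  obtain d where d: "d > 0" "\<And>k a b. nonoverlapping t s k a b \<Longrightarrow> (\<Sum>i<k. b i - a i) < d \<Longrightarrow>
    (\<Sum>i<k. norm (f (b i) - f (a i))) < e" using abs_cont_onD[OF assms e] by blast
  show "\<exists>d>0. \<forall>x'\<in>{t..s}. dist x' x < d \<longrightarrow> dist (f x') (f x) < e"
  proof (intro exI[of _ d] conjI d(1) ballI impI)
    fix x' assume x': "x' \<in> {t..s}" "dist x' x < d"
    have "norm (f (max x x') - f (min x x')) < e"
      using d(2)[of 1 "\<lambda>_. min x x'" "\<lambda>_. max x x'"] x x'
      by (auto simp: dist_real_def min_def max_def nonoverlapping_def)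
    then show "dist (f x') (f x) < e"
      by (cases "x \<le> x'") (auto simp: dist_norm norm_minus_commute min_def max_def)
  qed
qed

lemma abs_cont_on_bilinear:
  assumes h: "bounded_bilinear h" and f: "abs_cont_on t s f" and g: "abs_cont_on t s g"
  shows "abs_cont_on t s (\<lambda>\<tau>. h (f \<tau>) (g \<tau>))"
proof -
  interpret bounded_bilinear h by (rule h)
  obtain K where K: "K > 0" "\<And>a b. norm (h a b) \<le> norm a * norm b * K" using pos_bounded by blast
  have "bounded (f ` {t..s})" "bounded (g ` {t..s})"
    using f g by (auto intro!: compact_imp_bounded compact_continuous_image abs_cont_on_continuous)
  then obtain Mf Mg where M: "\<And>\<tau>. \<tau> \<in> {t..s} \<Longrightarrow> norm (f \<tau>) \<le> Mf" "\<And>\<tau>. \<tau> \<in> {t..s} \<Longrightarrow> norm (g \<tau>) \<le> Mg"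
    unfolding bounded_iff by blast
  define C where "C = K * (\<bar>Mf\<bar> + \<bar>Mg\<bar>)"
  have C: "C \<ge> 0" using K by (simp add: C_def)
  show ?thesis
  proof (rule abs_cont_on_dominated[OF f g C])
    fix a b assume ab: "t \<le> a" "a \<le> b" "b \<le> s"
    have "h (f b) (g b) - h (f a) (g a) = h (f b - f a) (g b) + h (f a) (g b - g a)"
      by (simp add: diff_left diff_right)
    then have "norm (h (f b) (g b) - h (f a) (g a)) \<le> norm (h (f b - f a) (g b)) + norm (h (f a) (g b - g a))"
      by (simp add: norm_triangle_ineq)
    also have "\<dots> \<le> norm (f b - f a) * norm (g b) * K + norm (f a) * norm (g b - g a) * K"
      by (intro add_mono K)
    also have "\<dots> \<le> norm (f b - f a) * (\<bar>Mf\<bar> + \<bar>Mg\<bar>) * K + (\<bar>Mf\<bar> + \<bar>Mg\<bar>) * norm (g b - g a) * K"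
      using M(2)[of b] M(1)[of a] ab K(1) by (intro add_mono mult_right_mono mult_left_mono) auto
    also have "\<dots> = C * (norm (f b - f a) + norm (g b - g a) + 0)" by (simp add: C_def algebra_simps)
    also have "\<dots> \<le> C * (norm (f b - f a) + norm (g b - g a) + (b - a))"
      using C ab by (intro mult_left_mono) auto
    finally show "norm (h (f b) (g b) - h (f a) (g a)) \<le> C * (norm (f b - f a) + norm (g b - g a) + (b - a))" .
  qed
qed

lemma abs_cont_on_C1:
  fixes f :: "real \<Rightarrow> 'a::real_normed_vector"
  assumes f: "\<And>\<tau>. \<tau> \<in> {t..s} \<Longrightarrow> (f has_vector_derivative f' \<tau>) (at \<tau> within {t..s})"
    and f': "continuous_on {t..s} f'"
  shows "abs_cont_on t s f"
proof -
  have "bounded (f' ` {t..s})" by (intro compact_imp_bounded compact_continuous_image f') auto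
  then obtain C where C: "\<And>\<tau>. \<tau> \<in> {t..s} \<Longrightarrow> norm (f' \<tau>) \<le> C" unfolding bounded_iff by blast
  show ?thesis
  proof (rule abs_cont_on_dominated[OF abs_cont_on_const abs_cont_on_const, of "\<bar>C\<bar>" _ _ _ 0 0])
    fix a b assume ab: "t \<le> a" "a \<le> b" "b \<le> s"
    have "norm (f b - f a) \<le> \<bar>C\<bar> * norm (b - a)"
    proof (rule differentiable_bound[of "{t..s}" f "\<lambda>x h. h *\<^sub>R f' x"])
      show "(f has_derivative (\<lambda>h. h *\<^sub>R f' x)) (at x within {t..s})" if "x \<in> {t..s}" for x
        using f[OF that] by (simp add: has_vector_derivative_def)
      show "onorm (\<lambda>h. h *\<^sub>R f' x) \<le> \<bar>C\<bar>" if "x \<in> {t..s}" for x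
      proof (rule onorm_le)
        fix h :: real
        have "norm (f' x) \<le> \<bar>C\<bar>" using C[OF that] by simp
        then have "\<bar>h\<bar> * norm (f' x) \<le> \<bar>h\<bar> * \<bar>C\<bar>" by (rule mult_left_mono) simp
        then show "norm (h *\<^sub>R f' x) \<le> \<bar>C\<bar> * norm h" by (simp add: mult.commute)
      qed
    qed (use ab in auto)
    then show "norm (f b - f a) \<le> \<bar>C\<bar> * (norm (0 - 0 :: real) + norm (0 - 0 :: real) + (b - a))" using ab by simp
  qed simp
qed

text \<open>Converts a finite set of tagged intervals into an indexed family. Degenerate intervals
  are discarded first: having empty interior, they may sit inside another interval and break the
  ordering, while they contribute nothing to either sum.\<close>

lemma tagged_nonoverlapping_variation:
  fixes F :: "real \<Rightarrow> 'a::real_normed_vector"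
  assumes ac: "\<And>k a' b'. nonoverlapping a b k a' b' \<Longrightarrow> (\<Sum>i<k. b' i - a' i) < d \<Longrightarrow>
      (\<Sum>i<k. norm (F (b' i) - F (a' i))) < e"
    and p: "p tagged_partial_division_of {a..b}" and U: "\<And>x k. (x, k) \<in> p \<Longrightarrow> k \<subseteq> U"
    and Um: "U \<in> sets lebesgue" "emeasure lebesgue U < ennreal d"
  shows "(\<Sum>(x, k)\<in>p. norm (F (Sup k) - F (Inf k))) < e"
proof -
  define q where "q = {w \<in> p. Inf (snd w) < Sup (snd w)}"
  have fp: "finite p" using p by (simp add: tagged_partial_division_of_def)
  then have fq: "finite q" by (simp add: q_def)
  have itv: "\<exists>c c'. snd w = {c..c'} \<and> c \<le> c' \<and> a \<le> c \<and> c' \<le> b" if "w \<in> p" for w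
  proof -
    have wp: "(fst w, snd w) \<in> p" using that by simp
    obtain c c' where "snd w = {c..c'}"
      using tagged_partial_division_ofD(4)[OF p wp] by (auto simp: cbox_interval)
    then show ?thesis
      using tagged_partial_division_ofD(2,3)[OF p wp] by (intro exI[of _ c] exI[of _ c']) auto
  qed
  have io: "snd w = {Inf (snd w)..Sup (snd w)}" "Inf (snd w) \<le> Sup (snd w)" "a \<le> Inf (snd w)" "Sup (snd w) \<le> b"
    if w: "w \<in> p" for w
  proof -
    obtain c c' where c: "snd w = {c..c'}" "c \<le> c'" "a \<le> c" "c' \<le> b" using itv[OF w] by blast
    have IS: "Inf (snd w) = c" "Sup (snd w) = c'" using c by simp_all
    show "snd w = {Inf (snd w)..Sup (snd w)}" "Inf (snd w) \<le> Sup (snd w)" "a \<le> Inf (snd w)" "Sup (snd w) \<le> b"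
      unfolding IS using c by simp_all
  qed
  have dis: "{Inf (snd v)<..<Sup (snd v)} \<inter> {Inf (snd w)<..<Sup (snd w)} = {}" if "v \<in> p" "w \<in> p" "v \<noteq> w" for v w
  proof -
    have "interior (snd v) \<inter> interior (snd w) = {}"
      using tagged_partial_division_ofD(5)[OF p, of "fst v" "snd v" "fst w" "snd w"] that by (auto simp: prod_eq_iff)
    then show ?thesis
      using arg_cong[OF io(1)[OF that(1)], of interior] arg_cong[OF io(1)[OF that(2)], of interior]
      unfolding interior_atLeastAtMost_real by metis
  qed
  obtain k where k: "bij_betw k {..<card q} q" using ex_bij_betw_nat_finite[OF fq] by (auto simp: atLeast0LessThan)
  have kq: "k i \<in> q" if "i < card q" for i using k that by (auto simp: bij_betw_def)
  have "(\<Sum>i<card q. norm (F (Sup (snd (k i))) - F (Inf (snd (k i))))) < e"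
  proof (rule ac)
    show "nonoverlapping a b (card q) (\<lambda>i. Inf (snd (k i))) (\<lambda>i. Sup (snd (k i)))"
      unfolding nonoverlapping_def
    proof (intro conjI[of "\<forall>i<card q. _ i"] allI impI)
    fix i assume "i < card q"
    then show "a \<le> Inf (snd (k i)) \<and> Inf (snd (k i)) \<le> Sup (snd (k i)) \<and> Sup (snd (k i)) \<le> b"
      using io(2,3,4)[of "k i"] kq[of i] by (auto simp: q_def)
  next
    fix i j assume ij: "i < card q" "j < card q" "i \<noteq> j"
    then have "k i \<noteq> k j" using k by (auto simp: bij_betw_def inj_on_def)
    then have d: "{Inf (snd (k i))<..<Sup (snd (k i))} \<inter> {Inf (snd (k j))<..<Sup (snd (k j))} = {}"
      using dis kq ij by (auto simp: q_def)
    show "Sup (snd (k i)) \<le> Inf (snd (k j)) \<or> Sup (snd (k j)) \<le> Inf (snd (k i))"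
    proof (rule ccontr)
      assume "\<not> ?thesis"
      then have "max (Inf (snd (k i))) (Inf (snd (k j))) < min (Sup (snd (k i))) (Sup (snd (k j)))"
        using kq[OF ij(1)] kq[OF ij(2)] by (auto simp: q_def)
      from dense[OF this] d show False by auto
    qed
    qed
  next
    have "ennreal (\<Sum>i<card q. Sup (snd (k i)) - Inf (snd (k i))) = (\<Sum>i<card q. ennreal (Sup (snd (k i)) - Inf (snd (k i))))"
    proof (rule sum_ennreal[symmetric])
      fix i assume "i \<in> {..<card q}"
      then have "k i \<in> q" using kq by simp
      then show "0 \<le> Sup (snd (k i)) - Inf (snd (k i))" by (simp add: q_def)
    qed
    also have "\<dots> = (\<Sum>w\<in>q. ennreal (Sup (snd w) - Inf (snd w)))"
      by (rule sum.reindex_bij_betw[OF k, of "\<lambda>w. ennreal (Sup (snd w) - Inf (snd w))"])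
    also have "\<dots> = (\<Sum>w\<in>q. emeasure lebesgue {Inf (snd w)<..<Sup (snd w)})"
      by (intro sum.cong refl) (auto simp: q_def emeasure_completion)
    also have "\<dots> = emeasure lebesgue (\<Union>w\<in>q. {Inf (snd w)<..<Sup (snd w)})"
    proof (rule sum_emeasure[OF _ _ fq])
      show "disjoint_family_on (\<lambda>w. {Inf (snd w)<..<Sup (snd w)}) q"
        unfolding disjoint_family_on_def using dis by (auto simp: q_def)
    qed auto
    also have "\<dots> \<le> emeasure lebesgue U"
    proof (rule emeasure_mono[OF _ Um(1)], rule UN_least)
      fix w assume "w \<in> q"
      then have "w \<in> p" by (simp add: q_def)
      then have "{Inf (snd w)..Sup (snd w)} \<subseteq> U" using U[of "fst w" "snd w"] io(1) by simp
      then show "{Inf (snd w)<..<Sup (snd w)} \<subseteq> U" by auto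
    qed
    also have "\<dots> < ennreal d" by (rule Um)
    finally show "(\<Sum>i<card q. Sup (snd (k i)) - Inf (snd (k i))) < d"
      by (metis ennreal_leI linorder_not_le)
  qed
  also have "(\<Sum>i<card q. norm (F (Sup (snd (k i))) - F (Inf (snd (k i))))) = (\<Sum>w\<in>q. norm (F (Sup (snd w)) - F (Inf (snd w))))"
    by (rule sum.reindex_bij_betw[OF k, of "\<lambda>w. norm (F (Sup (snd w)) - F (Inf (snd w)))"])
  also have "\<dots> = (\<Sum>w\<in>p. norm (F (Sup (snd w)) - F (Inf (snd w))))"
  proof (rule sum.mono_neutral_left[OF fp])
    show "q \<subseteq> p" by (auto simp: q_def)
    show "\<forall>w\<in>p - q. norm (F (Sup (snd w)) - F (Inf (snd w))) = 0"
    proof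
      fix w assume "w \<in> p - q"
      then have "Inf (snd w) = Sup (snd w)" using io(2)[of w] by (auto simp: q_def)
      then show "norm (F (Sup (snd w)) - F (Inf (snd w))) = 0" by simp
    qed
  qed
  finally show ?thesis by (simp add: case_prod_unfold)
qed

text \<open>The gauge integral gives this directly. At tags outside \<open>N\<close> the gauge comes
  from the derivative; at tags in \<open>N\<close> it is an open set of small measure, on which
  absolute continuity bounds the total increment. Integrability of the derivative is part of the
  conclusion.\<close>

theorem fundamental_theorem_of_calculus_abs_cont:
  fixes F :: "real \<Rightarrow> 'a::banach"
  assumes ab: "a \<le> b" and F: "abs_cont_on a b F" and N: "negligible N"
    and der: "\<And>x. x \<in> {a..b} - N \<Longrightarrow> (F has_vector_derivative F' x) (at x within {a..b})"
  shows "(F' has_integral (F b - F a)) {a..b}"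
proof -
  \<comment> \<open>With value 0 on \<open>N\<close>, tags there contribute only increments of
    \<open>F\<close>.\<close>
  define g where "g x = (if x \<in> N then 0 else F' x)" for x
  have "(g has_integral (F b - F a)) (cbox a b)"
    unfolding has_integral
  proof (intro allI impI)
    fix e :: real assume e: "e > 0"
    define e1 where "e1 = e / (2 * (b - a + 1))"
    have e1: "e1 > 0" using e ab by (simp add: e1_def)
    have e2: "e / 2 > 0" using e by simp
    obtain d where d: "d > 0" "\<And>k a' b'. nonoverlapping a b k a' b' \<Longrightarrow> (\<Sum>i<k. b' i - a' i) < d \<Longrightarrow>
      (\<Sum>i<k. norm (F (b' i) - F (a' i))) < e / 2" using abs_cont_onD[OF F e2] by blast
    have Ns: "N \<in> null_sets lebesgue" using N by (simp add: negligible_iff_null_sets)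
    obtain U where U: "open U" "N \<subseteq> U" "emeasure lebesgue (U - N) < ennreal d"
      by (rule sets_lebesgue_outer_open[of N d]) (use Ns d(1) in auto)
    have Um: "U \<in> sets lebesgue" "emeasure lebesgue U < ennreal d"
      using U Ns by (auto simp: emeasure_Diff_null_set)
    have "\<forall>x. \<exists>r>0. x \<in> {a..b} - N \<longrightarrow> (\<forall>y\<in>{a..b}. norm (y - x) < r \<longrightarrow>
        norm (F y - F x - (y - x) *\<^sub>R F' x) \<le> e1 * norm (y - x))"
    proof
      fix x
      show "\<exists>r>0. x \<in> {a..b} - N \<longrightarrow> (\<forall>y\<in>{a..b}. norm (y - x) < r \<longrightarrow>
        norm (F y - F x - (y - x) *\<^sub>R F' x) \<le> e1 * norm (y - x))"
      proof (cases "x \<in> {a..b} - N")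
        case True
        then show ?thesis
          using der[OF True] e1 unfolding has_vector_derivative_def has_derivative_within_alt by blast
      qed (use zero_less_one in blast)
    qed
    then obtain r where r: "\<And>x. r x > 0" "\<And>x y. x \<in> {a..b} - N \<Longrightarrow> y \<in> {a..b} \<Longrightarrow> norm (y - x) < r x \<Longrightarrow>
        norm (F y - F x - (y - x) *\<^sub>R F' x) \<le> e1 * norm (y - x)" by metis
    define G where "G x = (if x \<in> N then U else ball x (r x))" for x
    show "\<exists>G. gauge G \<and> (\<forall>p. p tagged_division_of cbox a b \<and> G fine p \<longrightarrow>
        norm ((\<Sum>(x, k)\<in>p. measure lborel k *\<^sub>R g x) - (F b - F a)) < e)"
    proof (intro exI[of _ G] conjI allI impI)
      show "gauge G" using r U by (auto simp: gauge_def G_def)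
      fix p assume "p tagged_division_of cbox a b \<and> G fine p"
      then have p: "p tagged_division_of {a..b}" and fine: "G fine p" by (auto simp: cbox_interval)
      have fp: "finite p" using p by auto
      define pN where "pN = {w \<in> p. fst w \<in> N}"
      define D where "D w = measure lborel (snd w) *\<^sub>R g (fst w) - (F (Sup (snd w)) - F (Inf (snd w)))" for w
      have "(\<Sum>(x, k)\<in>p. F (Sup k) - F (Inf k)) = F b - F a"
        by (rule additive_tagged_division_1[OF ab p])
      then have "(\<Sum>(x, k)\<in>p. measure lborel k *\<^sub>R g x) - (F b - F a) = (\<Sum>w\<in>p. D w)"
        by (simp add: D_def sum_subtractf case_prod_unfold)
      also have "\<dots> = (\<Sum>w\<in>pN. D w) + (\<Sum>w\<in>p - pN. D w)"
        using fp by (subst sum.subset_diff[of pN p]) (auto simp: pN_def)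
      also have "norm \<dots> \<le> norm (\<Sum>w\<in>pN. D w) + norm (\<Sum>w\<in>p - pN. D w)" by (rule norm_triangle_ineq)
      also have "norm (\<Sum>w\<in>pN. D w) < e / 2"
      proof -
        have "norm (\<Sum>w\<in>pN. D w) \<le> (\<Sum>w\<in>pN. norm (F (Sup (snd w)) - F (Inf (snd w))))"
          by (rule sum_norm_le) (auto simp: D_def g_def pN_def norm_minus_commute)
        also have "\<dots> = (\<Sum>(x, k)\<in>pN. norm (F (Sup k) - F (Inf k)))" by (simp add: case_prod_unfold)
        also have "\<dots> < e / 2"
        proof (rule tagged_nonoverlapping_variation[OF d(2) _ _ Um])
          show "pN tagged_partial_division_of {a..b}"
            by (rule tagged_partial_division_subset[of p])
              (use p in \<open>auto simp: pN_def tagged_division_of_def\<close>)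
          show "k \<subseteq> U" if "(x, k) \<in> pN" for x k
          proof -
            have "(x, k) \<in> p" "x \<in> N" using that by (auto simp: pN_def)
            then have "k \<subseteq> G x" using fine unfolding fine_def by blast
            then show ?thesis using \<open>x \<in> N\<close> by (simp add: G_def)
          qed
        qed
        finally show ?thesis .
      qed
      also have "norm (\<Sum>w\<in>p - pN. D w) \<le> e1 * (b - a)"
      proof -
        have "norm (D w) \<le> e1 * measure lborel (snd w)" if w: "w \<in> p - pN" for w
        proof -
          obtain x k where xk: "w = (x, k)" "(x, k) \<in> p" "x \<notin> N" using w by (cases w) (auto simp: pN_def)
          obtain c c' where k: "k = {c..c'}" using tagged_division_ofD(4)[OF p xk(2)] by (auto simp: cbox_interval)
          have xin: "x \<in> {c..c'}" "{c..c'} \<subseteq> {a..b}" using tagged_division_ofD(2,3)[OF p xk(2)] k by auto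
          then have cc: "c \<le> x" "x \<le> c'" "c \<in> {a..b}" "c' \<in> {a..b}" "x \<in> {a..b} - N" using xk(3) by auto
          have "k \<subseteq> G x" using fine xk(2) unfolding fine_def by blast
          then have "k \<subseteq> ball x (r x)" using xk(3) by (simp add: G_def)
          then have "norm (c - x) < r x" "norm (c' - x) < r x"
          proof -
            have "c \<in> k" "c' \<in> k" using cc k by auto
            then have "c \<in> ball x (r x)" "c' \<in> ball x (r x)" using \<open>k \<subseteq> ball x (r x)\<close> by blast+
            then show "norm (c - x) < r x" "norm (c' - x) < r x" by (simp_all add: dist_norm norm_minus_commute)
          qed
          then have 1: "norm (F c - F x - (c - x) *\<^sub>R F' x) \<le> e1 * norm (c - x)"
            "norm (F c' - F x - (c' - x) *\<^sub>R F' x) \<le> e1 * norm (c' - x)"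
            using r(2) cc by blast+
          have "D w = (F c - F x - (c - x) *\<^sub>R F' x) - (F c' - F x - (c' - x) *\<^sub>R F' x)"
            using cc xk(3) by (simp add: D_def xk(1) k g_def algebra_simps)
          then have "norm (D w) \<le> norm (F c - F x - (c - x) *\<^sub>R F' x) + norm (F c' - F x - (c' - x) *\<^sub>R F' x)"
            by (simp only: norm_triangle_ineq4)
          also have "\<dots> \<le> e1 * norm (c - x) + e1 * norm (c' - x)" by (rule add_mono[OF 1])
          also have "\<dots> = e1 * measure lborel (snd w)" using cc by (simp add: xk(1) k algebra_simps)
          finally show ?thesis .
        qed
        then have "norm (\<Sum>w\<in>p - pN. D w) \<le> (\<Sum>w\<in>p - pN. e1 * measure lborel (snd w))" by (rule sum_norm_le)
        also have "\<dots> \<le> (\<Sum>w\<in>p. e1 * measure lborel (snd w))"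
          using fp e1 by (intro sum_mono2) auto
        also have "\<dots> = e1 * (\<Sum>(x, k)\<in>p. measure lborel k)" by (simp add: sum_distrib_left case_prod_unfold)
        also have "(\<Sum>(x, k)\<in>p. measure lborel k) = measure lborel (cbox a b)"
          by (rule additive_content_tagged_division) (use p in \<open>simp add: cbox_interval\<close>)
        finally show ?thesis using ab by simp
      qed
      also have "e1 * (b - a) \<le> e / 2"
      proof -
        have "e1 * (b - a) \<le> e1 * (b - a + 1)" using e1 by simp
        also have "\<dots> = e / 2"
        proof -
          have "e / (2 * c) * c = e / 2" if "c > 0" for c using that by simp
          from this[of "b - a + 1"] show ?thesis unfolding e1_def using ab by linarith
        qed
        finally show ?thesis .
      qed
      finally show "norm ((\<Sum>(x, k)\<in>p. measure lborel k *\<^sub>R g x) - (F b - F a)) < e" by simp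
    qed
  qed
  then have "(g has_integral (F b - F a)) {a..b}" by simp
  from has_integral_spike[OF N _ this] show ?thesis by (simp add: g_def)
qed

section \<open>Linear autonomous differential equations\<close>

context
  fixes L :: "'a::euclidean_space \<Rightarrow> 'a"
  assumes L: "linear L"
begin

text \<open>The exponential exp(t L) applied to z.\<close>

definition flow :: "real \<Rightarrow> 'a \<Rightarrow> 'a" where
  "flow t z = (\<Sum>n. (t ^ n / fact n) *\<^sub>R (L ^^ n) z)"

lemma linear_funpow_iterate: "linear (L ^^ n)"
proof (induction n)
  case 0
  show ?case unfolding funpow.simps by (rule linear_id)
next
  case (Suc n)
  show ?case unfolding funpow.simps by (rule linear_compose[OF Suc L])
qed

lemma flow_summable: "summable (\<lambda>n. (t ^ n / fact n) *\<^sub>R (L ^^ n) z)"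
proof -
  obtain K where K: "K > 0" "\<And>z. norm (L z) \<le> norm z * K"
    using bounded_linear.pos_bounded L linear_conv_bounded_linear by blast
  have pw: "norm ((L ^^ n) z) \<le> K ^ n * norm z" for n
  proof (induction n)
    case (Suc n)
    have "norm ((L ^^ Suc n) z) \<le> norm ((L ^^ n) z) * K" using K(2) by simp
    also have "\<dots> \<le> (K ^ n * norm z) * K" using Suc K(1) by (intro mult_right_mono) auto
    finally show ?case by (simp add: mult_ac)
  qed simp
  have "summable (\<lambda>n. norm z * (inverse (fact n) * (\<bar>t\<bar> * K) ^ n))"
    by (intro summable_mult summable_exp)
  then show ?thesis
  proof (rule summable_comparison_test[rotated], intro exI[of _ 0] allI impI)
    fix n
    have "norm ((t ^ n / fact n) *\<^sub>R (L ^^ n) z) = \<bar>t\<bar> ^ n / fact n * norm ((L ^^ n) z)"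
      by (simp add: power_abs)
    also have "\<dots> \<le> \<bar>t\<bar> ^ n / fact n * (K ^ n * norm z)" by (intro mult_left_mono pw) simp
    finally show "norm ((t ^ n / fact n) *\<^sub>R (L ^^ n) z) \<le> norm z * (inverse (fact n) * (\<bar>t\<bar> * K) ^ n)"
      by (simp add: power_mult_distrib divide_inverse mult_ac)
  qed
qed

lemma flow_0: "flow 0 z = z"
proof -
  have "(\<lambda>n. (0 ^ n / fact n) *\<^sub>R (L ^^ n) z) = (\<lambda>n. if n = 0 then z else 0)" by (auto simp: fun_eq_iff)
  then show ?thesis unfolding flow_def using suminf_finite[of "{0}" "\<lambda>n. if n = 0 then z else 0"] by simp
qed

lemma linear_flow: "linear (flow t)"
proof (rule linearI)
  show "flow t (x + y) = flow t x + flow t y" for x y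
    unfolding flow_def
    by (simp add: suminf_add[OF flow_summable flow_summable] linear_add[OF linear_funpow_iterate] scaleR_add_right)
  show "flow t (r *\<^sub>R x) = r *\<^sub>R flow t x" for r x
    unfolding flow_def
    by (simp add: suminf_scaleR_right[OF flow_summable] linear_cmul[OF linear_funpow_iterate] mult.commute)
qed

text \<open>Each component is a scalar power series in t; termwise differentiation shifts its
  coefficients, which amounts to one more application of \<open>L\<close>.\<close>

lemma flow_has_vector_derivative: "((\<lambda>t. flow t z) has_vector_derivative L (flow t z)) (at t)"
proof -
  have comp: "((\<lambda>t. flow t z \<bullet> b) has_field_derivative (L (flow t z) \<bullet> b)) (at t)" for b
  proof -
    define c where "c n = ((L ^^ n) z \<bullet> b) / fact n" for n
    have inner_suminf: "(\<Sum>n. (t ^ n / fact n) *\<^sub>R v n) \<bullet> b = (\<Sum>n. (v n \<bullet> b / fact n) * t ^ n)"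
      if "summable (\<lambda>n. (t ^ n / fact n) *\<^sub>R v n)" for v :: "nat \<Rightarrow> 'a" and t
      using bounded_linear.suminf[OF bounded_linear_inner_left that, of b] by (simp add: mult.commute)
    have sm: "summable (\<lambda>n. c n * y ^ n)" for y
      using bounded_linear.summable[OF bounded_linear_inner_left flow_summable, of y z b]
      by (simp add: c_def mult.commute)
    have eq: "flow t z \<bullet> b = (\<Sum>n. c n * t ^ n)" for t
      unfolding flow_def c_def by (rule inner_suminf[OF flow_summable])
    have dc: "diffs c n = ((L ((L ^^ n) z)) \<bullet> b) / fact n" for n
      by (simp add: diffs_def c_def field_simps del: of_nat_Suc)
    have bL: "bounded_linear L" using L linear_conv_bounded_linear by blast
    have sL: "summable (\<lambda>n. (t ^ n / fact n) *\<^sub>R L ((L ^^ n) z))"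
      using bounded_linear.summable[OF bL flow_summable, of t z] by (simp add: linear_cmul[OF L])
    have "L (flow t z) = (\<Sum>n. (t ^ n / fact n) *\<^sub>R L ((L ^^ n) z))"
      unfolding flow_def using bounded_linear.suminf[OF bL flow_summable, of t z] by (simp add: linear_cmul[OF L])
    then have "L (flow t z) \<bullet> b = (\<Sum>n. diffs c n * t ^ n)" by (simp add: inner_suminf[OF sL] dc)
    then show ?thesis unfolding eq using termdiffs_strong_converges_everywhere[OF sm, of t] by simp
  qed
  show ?thesis
    unfolding has_vector_derivative_def
  proof (subst has_derivative_componentwise_within, intro ballI)
    fix b :: 'a
    show "((\<lambda>t. flow t z \<bullet> b) has_derivative (\<lambda>x. (x *\<^sub>R L (flow t z)) \<bullet> b)) (at t)"
      using comp[of b] unfolding has_field_derivative_def by (simp add: mult.commute[of _ "_ \<bullet> b"])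
  qed
qed

text \<open>Gronwall's argument in both time directions: exp(-2Kt)|z|^2 does not increase for t
  \<ge> 0, and exp(2Kt)|z|^2 does not decrease for t \<le> 0.\<close>

lemma linear_ode_zero_unique:
  assumes der: "\<And>t. (z has_vector_derivative L (z t)) (at t)" and z0: "z 0 = 0"
  shows "z t = 0"
proof -
  obtain K where K: "K > 0" "\<And>z. norm (L z) \<le> norm z * K"
    using bounded_linear.pos_bounded L linear_conv_bounded_linear by blast
  have zL: "\<bar>v \<bullet> L v\<bar> \<le> K * (v \<bullet> v)" for v
  proof -
    have "\<bar>v \<bullet> L v\<bar> \<le> norm v * norm (L v)" by (rule Cauchy_Schwarz_ineq2)
    also have "\<dots> \<le> norm v * (norm v * K)" using K(2) by (intro mult_left_mono) auto
    finally show ?thesis by (simp add: dot_square_norm power2_eq_square mult_ac)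
  qed
  have w: "((\<lambda>t. z t \<bullet> z t) has_real_derivative 2 * (z t \<bullet> L (z t))) (at t)" for t
    using bounded_bilinear.has_vector_derivative[OF bounded_bilinear_inner der der, of t]
    by (simp add: has_real_derivative_iff_has_vector_derivative inner_commute)
  have d: "((\<lambda>t. exp (k * t) * (z t \<bullet> z t)) has_real_derivative exp (k * t) * (k * (z t \<bullet> z t) + 2 * (z t \<bullet> L (z t)))) (at t)" for k t
    by (auto intro!: derivative_eq_intros w simp: algebra_simps)
  have "z t \<bullet> z t \<le> 0"
  proof (cases "0 \<le> t")
    case True
    have "exp ((- 2 * K) * t) * (z t \<bullet> z t) \<le> exp ((- 2 * K) * 0) * (z 0 \<bullet> z 0)"
    proof (rule DERIV_nonpos_imp_nonincreasing[OF True])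
      fix x
      have "exp ((- 2 * K) * x) * ((- 2 * K) * (z x \<bullet> z x) + 2 * (z x \<bullet> L (z x))) \<le> 0"
        using zL[of "z x"] by (intro mult_nonneg_nonpos) (auto simp: abs_le_iff)
      then show "\<exists>y. ((\<lambda>t. exp ((- 2 * K) * t) * (z t \<bullet> z t)) has_real_derivative y) (at x) \<and> y \<le> 0"
        using d by blast
    qed
    then show ?thesis using z0 by (simp add: mult_le_0_iff)
  next
    case False
    then have t: "t \<le> 0" by simp
    have "exp ((2 * K) * t) * (z t \<bullet> z t) \<le> exp ((2 * K) * 0) * (z 0 \<bullet> z 0)"
    proof (rule DERIV_nonneg_imp_nondecreasing[OF t])
      fix x
      have "0 \<le> exp ((2 * K) * x) * ((2 * K) * (z x \<bullet> z x) + 2 * (z x \<bullet> L (z x)))"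
        using zL[of "z x"] by (intro mult_nonneg_nonneg) (auto simp: abs_le_iff)
      then show "\<exists>y. ((\<lambda>t. exp ((2 * K) * t) * (z t \<bullet> z t)) has_real_derivative y) (at x) \<and> 0 \<le> y"
        using d by blast
    qed
    then show ?thesis using z0 by (simp add: mult_le_0_iff)
  qed
  then have "z t \<bullet> z t = 0" using inner_ge_zero[of "z t"] by linarith
  then show ?thesis by simp
qed

end

section \<open>Derivatives of families of linear maps and of their inverses\<close>

lemma has_vector_derivative_iff_quotient:
  "(f has_vector_derivative f') (at r) \<longleftrightarrow> ((\<lambda>s. (1 / (s - r)) *\<^sub>R (f s - f r)) \<longlongrightarrow> f') (at r)"
proof -
  have "norm (f s - f r - (s - r) *\<^sub>R f') / norm (s - r) = norm ((1 / (s - r)) *\<^sub>R (f s - f r) - f')"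
    if "s \<noteq> r" for s
  proof -
    have "(1 / (s - r)) *\<^sub>R (f s - f r) - f' = (1 / (s - r)) *\<^sub>R (f s - f r - (s - r) *\<^sub>R f')"
      using that by (simp add: scaleR_diff_right)
    then show ?thesis by (simp add: divide_inverse mult.commute)
  qed
  then have eq: "((\<lambda>s. norm (f s - f r - (s - r) *\<^sub>R f') / norm (s - r)) \<longlongrightarrow> 0) (at r) \<longleftrightarrow>
      ((\<lambda>s. norm ((1 / (s - r)) *\<^sub>R (f s - f r) - f')) \<longlongrightarrow> 0) (at r)"
    by (intro filterlim_cong refl) (auto simp: eventually_at_filter)
  show ?thesis
    unfolding has_vector_derivative_def has_derivative_iff_norm eq tendsto_norm_zero_iff
    by (simp add: Lim_null[symmetric] bounded_linear_scaleR_left)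
qed

text \<open>Expanding the moving argument in the basis reduces this to the product rule for a scalar
  times a vector, so pointwise differentiability of the family suffices.\<close>

lemma linear_family_has_vector_derivative:
  fixes M :: "real \<Rightarrow> 'a::euclidean_space \<Rightarrow> 'b::real_normed_vector"
  assumes lin: "\<And>s. linear (M s)" and lin': "linear M'"
    and M: "\<And>v. ((\<lambda>s. M s v) has_vector_derivative M' v) (at r within I)"
    and v: "(v has_vector_derivative v') (at r within I)"
  shows "((\<lambda>s. M s (v s)) has_vector_derivative (M' (v r) + M r v')) (at r within I)"
proof -
  have exp: "N u = (\<Sum>b\<in>Basis. (u \<bullet> b) *\<^sub>R N b)" if "linear N" for N :: "'a \<Rightarrow> 'b" and u
    using that by (subst euclidean_representation[of u, symmetric]) (simp add: linear_sum linear_cmul del: euclidean_representation)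
  have vb: "((\<lambda>s. v s \<bullet> b) has_vector_derivative (v' \<bullet> b)) (at r within I)" for b
    using bounded_linear.has_vector_derivative[OF bounded_linear_inner_left v] .
  have "((\<lambda>s. \<Sum>b\<in>Basis. (v s \<bullet> b) *\<^sub>R M s b) has_vector_derivative
      (\<Sum>b\<in>Basis. (v r \<bullet> b) *\<^sub>R M' b + (v' \<bullet> b) *\<^sub>R M r b)) (at r within I)"
    by (intro has_vector_derivative_sum bounded_bilinear.has_vector_derivative[OF bounded_bilinear_scaleR vb M])
  moreover have "(\<lambda>s. \<Sum>b\<in>Basis. (v s \<bullet> b) *\<^sub>R M s b) = (\<lambda>s. M s (v s))" by (intro ext exp[OF lin, symmetric])
  moreover have "(\<Sum>b\<in>Basis. (v r \<bullet> b) *\<^sub>R M' b + (v' \<bullet> b) *\<^sub>R M r b) = M' (v r) + M r v'"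
    by (simp add: sum.distrib exp[OF lin', of "v r", symmetric] exp[OF lin, of r v', symmetric])
  ultimately show ?thesis by simp
qed

text \<open>From V s - V r = - V s (N s - N r) V r, combined with a bound on \<open>V s\<close> that
  is uniform near \<open>r\<close>.\<close>

lemma linear_family_inverse_has_vector_derivative:
  fixes N V :: "real \<Rightarrow> 'a::euclidean_space \<Rightarrow> 'a"
  assumes lin: "\<And>s. linear (N s)" and r: "r \<in> I" "open I"
    and inv: "\<And>s. s \<in> I \<Longrightarrow> linear (V s)" "\<And>s w. s \<in> I \<Longrightarrow> N s (V s w) = w" "\<And>s w. s \<in> I \<Longrightarrow> V s (N s w) = w"
    and N: "\<And>w. ((\<lambda>s. N s w) has_vector_derivative N' w) (at r)"
  shows "((\<lambda>s. V s w) has_vector_derivative - V r (N' (V r w))) (at r)"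
proof -
  obtain K where K: "K > 0" "\<And>u. norm (V r u) \<le> norm u * K"
    using bounded_linear.pos_bounded inv(1)[OF r(1)] linear_conv_bounded_linear by blast
  define m where "m s = (\<Sum>b\<in>Basis. norm (N s b - N r b))" for s
  have m0: "0 \<le> m s" for s by (simp add: m_def sum_nonneg)
  have mb: "norm (N s u - N r u) \<le> norm u * m s" for s u
  proof -
    have "N s u - N r u = (\<Sum>b\<in>Basis. (u \<bullet> b) *\<^sub>R (N s b - N r b))"
    proof -
      have "N q u = (\<Sum>b\<in>Basis. (u \<bullet> b) *\<^sub>R N q b)" for q
        using lin[of q] by (subst euclidean_representation[of u, symmetric]) (simp add: linear_sum linear_cmul del: euclidean_representation)
      then show ?thesis by (simp add: scaleR_diff_right sum_subtractf)
    qed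
    also have "norm \<dots> \<le> (\<Sum>b\<in>Basis. norm u * norm (N s b - N r b))"
      by (rule sum_norm_le) (auto intro!: mult_right_mono Basis_le_norm)
    finally show ?thesis by (simp add: m_def sum_distrib_left)
  qed
  have cN: "((\<lambda>s. N s w) \<longlongrightarrow> N r w) (at r)" for w
    using has_vector_derivative_continuous[OF N] by (simp add: continuous_at)
  have mlim: "(m \<longlongrightarrow> 0) (at r)"
  proof -
    have "((\<lambda>s. \<Sum>b\<in>Basis. norm (N s b - N r b)) \<longlongrightarrow> (\<Sum>b\<in>(Basis::'a set). norm (N r b - N r b))) (at r)"
      by (intro tendsto_intros cN)
    then show ?thesis by (simp add: m_def[abs_def])
  qed
  have evI: "eventually (\<lambda>s. s \<in> I) (at r)" using r eventually_at_in_open' by blast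
  have evm: "eventually (\<lambda>s. K * m s < 1/2) (at r)"
  proof -
    have "((\<lambda>s. K * m s) \<longlongrightarrow> K * 0) (at r)" by (intro tendsto_intros mlim)
    then show ?thesis by (intro order_tendstoD(2)) auto
  qed
  \<comment> \<open>Once K m(s) < 1/2, the term containing \<open>V s u\<close> on the right is
    absorbed on the left, which costs the factor 2.\<close>
  have evV: "eventually (\<lambda>s. \<forall>u. norm (V s u) \<le> 2 * K * norm u) (at r)"
    using evI evm
  proof eventually_elim
    case (elim s)
    show ?case
    proof
      fix u
      let ?v = "V s u"
      have "?v = V r (N r ?v)" by (simp add: inv(3)[OF r(1)])
      also have "N r ?v = u - (N s ?v - N r ?v)" by (simp add: inv(2)[OF elim(1)])
      finally have "norm ?v \<le> norm (u - (N s ?v - N r ?v)) * K" using K(2) by metis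
      also have "\<dots> \<le> (norm u + norm ?v * m s) * K"
        using norm_triangle_ineq4[of u "N s ?v - N r ?v"] mb[of s ?v] K(1) by (intro mult_right_mono) auto
      also have "\<dots> = K * norm u + (K * m s) * norm ?v" by (simp add: algebra_simps)
      also have "\<dots> \<le> K * norm u + (1/2) * norm ?v"
        using elim(2) by (intro add_left_mono mult_right_mono) auto
      finally show "norm ?v \<le> 2 * K * norm u" by simp
    qed
  qed
  have Vdiff: "V s u - V r u = - V s (N s (V r u) - N r (V r u))" if "s \<in> I" for s u
    using that by (simp add: linear_diff[OF inv(1)] inv(2)[OF r(1)] inv(3))
  have Vlim: "((\<lambda>s. V s u) \<longlongrightarrow> V r u) (at r)" for u
  proof -
    have "((\<lambda>s. V s u - V r u) \<longlongrightarrow> 0) (at r)"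
    proof (rule Lim_null_comparison)
      show "eventually (\<lambda>s. norm (V s u - V r u) \<le> 2 * K * (norm (V r u) * m s)) (at r)"
        using evI evV
      proof eventually_elim
        case (elim s)
        have "norm (V s u - V r u) \<le> 2 * K * norm (N s (V r u) - N r (V r u))"
          unfolding Vdiff[OF elim(1)] norm_minus_cancel using elim(2) by blast
        also have "\<dots> \<le> 2 * K * (norm (V r u) * m s)" using K(1) mb by (intro mult_left_mono) auto
        finally show ?case .
      qed
      have "((\<lambda>s. 2 * K * (norm (V r u) * m s)) \<longlongrightarrow> 2 * K * (norm (V r u) * 0)) (at r)"
        by (intro tendsto_intros mlim)
      then show "((\<lambda>s. 2 * K * (norm (V r u) * m s)) \<longlongrightarrow> 0) (at r)" by simp
    qed
    then show ?thesis by (rule Lim_null[THEN iffD2])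
  qed
  define y where "y s = (1 / (s - r)) *\<^sub>R (N s (V r w) - N r (V r w))" for s
  have ylim: "(y \<longlongrightarrow> N' (V r w)) (at r)"
    using N[of "V r w"] unfolding has_vector_derivative_iff_quotient y_def[abs_def] .
  have "((\<lambda>s. V s (y s)) \<longlongrightarrow> V r (N' (V r w))) (at r)"
  proof -
    let ?y = "N' (V r w)"
    have "((\<lambda>s. V s (y s) - V s ?y) \<longlongrightarrow> 0) (at r)"
    proof (rule Lim_null_comparison)
      show "eventually (\<lambda>s. norm (V s (y s) - V s ?y) \<le> 2 * K * norm (y s - ?y)) (at r)"
        using evI evV by eventually_elim (simp add: linear_diff[OF inv(1), symmetric])
      have "((\<lambda>s. 2 * K * norm (y s - ?y)) \<longlongrightarrow> 2 * K * norm (?y - ?y)) (at r)"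
        by (intro tendsto_intros ylim)
      then show "((\<lambda>s. 2 * K * norm (y s - ?y)) \<longlongrightarrow> 0) (at r)" by simp
    qed
    from tendsto_add[OF this Vlim[of ?y]] show ?thesis by simp
  qed
  then have "((\<lambda>s. - V s (y s)) \<longlongrightarrow> - V r (N' (V r w))) (at r)" by (rule tendsto_minus)
  moreover have "eventually (\<lambda>s. - V s (y s) = (1 / (s - r)) *\<^sub>R (V s w - V r w)) (at r)"
    using evI by eventually_elim (simp add: Vdiff y_def linear_cmul[OF inv(1)] linear_diff[OF inv(1)] scaleR_diff_right)
  ultimately have "((\<lambda>s. (1 / (s - r)) *\<^sub>R (V s w - V r w)) \<longlongrightarrow> - V r (N' (V r w))) (at r)"
    by (rule Lim_transform_eventually)
  then show ?thesis unfolding has_vector_derivative_iff_quotient .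
qed

section \<open>The linear-quadratic cost as a quadratic form\<close>

lemma inner_transpose: "(A *v x) \<bullet> y = x \<bullet> (transpose A *v y)"
  for A :: "real^'n^'m"
  by (metis dot_lmul_matrix inner_commute transpose_matrix_vector)

declare transpose_matrix_vector [simp del]

section \<open>The Hamiltonian flow and its field of extremals\<close>

context
  fixes A :: "real^'n^'n" and B :: "real^'m^'n" and Q :: "real^'n^'n"
  assumes Qsym: "transpose Q = Q"
begin

definition ham_op :: "(real^'n) \<times> (real^'n) \<Rightarrow> (real^'n) \<times> (real^'n)" where
  "ham_op z = (- (transpose A *v fst z) - Q *v snd z, (B ** transpose B) *v fst z + A *v snd z)"

lemma linear_ham_op: "linear ham_op"
  by (rule linearI) (auto simp: ham_op_def matrix_vector_right_distrib algebra_simps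
      matrix_vector_mult_scaleR scaleR_diff_right)

lemma Q_inner: "(Q *v x) \<bullet> y = x \<bullet> (Q *v y)"
  using inner_transpose[of Q x y] Qsym by simp

lemma ham_sol_iff: "ham_sol A B Q P X \<longleftrightarrow> (\<forall>t. ((\<lambda>t. (P t, X t)) has_vector_derivative ham_op (P t, X t)) (at t))"
proof
  assume h: "ham_sol A B Q P X"
  show "\<forall>t. ((\<lambda>t. (P t, X t)) has_vector_derivative ham_op (P t, X t)) (at t)"
    using h unfolding ham_sol_def ham_op_def by (auto intro: has_vector_derivative_Pair)
next
  assume h: "\<forall>t. ((\<lambda>t. (P t, X t)) has_vector_derivative ham_op (P t, X t)) (at t)"
  show "ham_sol A B Q P X"
    unfolding ham_sol_def
  proof (intro allI conjI)
    fix t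
    show "(P has_vector_derivative (- (transpose A *v P t) - Q *v X t)) (at t)"
      using bounded_linear.has_vector_derivative[OF bounded_linear_fst h[rule_format, of t]] by (simp add: ham_op_def)
    show "(X has_vector_derivative ((B ** transpose B) *v P t + A *v X t)) (at t)"
      using bounded_linear.has_vector_derivative[OF bounded_linear_snd h[rule_format, of t]] by (simp add: ham_op_def)
  qed
qed

definition hamP :: "real \<Rightarrow> real^'n \<Rightarrow> real^'n \<Rightarrow> real^'n" where
  "hamP t p x = fst (flow ham_op t (p, x))"

definition hamX :: "real \<Rightarrow> real^'n \<Rightarrow> real^'n \<Rightarrow> real^'n" where
  "hamX t p x = snd (flow ham_op t (p, x))"

lemma ham_sol_flow: "ham_sol A B Q (\<lambda>t. hamP t p x) (\<lambda>t. hamX t p x)"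
  unfolding ham_sol_iff hamP_def hamX_def
  using flow_has_vector_derivative[OF linear_ham_op, of "(p, x)"] by simp

lemma ham_flow_0: "hamP 0 p x = p" "hamX 0 p x = x"
  by (simp_all add: hamP_def hamX_def flow_0[OF linear_ham_op])

lemma ham_flow_linear:
  "hamP t (p + p') (x + x') = hamP t p x + hamP t p' x'" "hamX t (p + p') (x + x') = hamX t p x + hamX t p' x'"
  "hamP t (c *\<^sub>R p) (c *\<^sub>R x) = c *\<^sub>R hamP t p x" "hamX t (c *\<^sub>R p) (c *\<^sub>R x) = c *\<^sub>R hamX t p x"
  using linear_add[OF linear_flow[OF linear_ham_op], of t "(p, x)" "(p', x')"]
    linear_cmul[OF linear_flow[OF linear_ham_op], of t c "(p, x)"]
  by (simp_all add: hamP_def hamX_def)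

lemma ham_sol_unique:
  assumes "ham_sol A B Q P X" "P 0 = p" "X 0 = x"
  shows "P t = hamP t p x" "X t = hamX t p x"
proof -
  define z where "z t = (P t, X t) - (hamP t p x, hamX t p x)" for t
  have "(z has_vector_derivative ham_op (z t)) (at t)" for t
  proof -
    have "(z has_vector_derivative (ham_op (P t, X t) - ham_op (hamP t p x, hamX t p x))) (at t)"
      unfolding z_def[abs_def] using assms(1) ham_sol_flow[of p x] unfolding ham_sol_iff
      by (intro has_vector_derivative_diff) auto
    moreover have "ham_op (z t) = ham_op (P t, X t) - ham_op (hamP t p x, hamX t p x)"
      unfolding z_def by (rule linear_diff[OF linear_ham_op])
    ultimately show ?thesis by simp
  qed
  moreover have "z 0 = 0" using assms by (simp add: z_def ham_flow_0)
  ultimately have "z t = 0" by (rule linear_ode_zero_unique[OF linear_ham_op])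
  then show "P t = hamP t p x" "X t = hamX t p x" by (simp_all add: z_def zero_prod_def)
qed

lemma LQ_exp_eq: "LQ_exp A B Q x T p = hamX T p x"
  unfolding LQ_exp_def
proof (rule the_equality)
  show "\<exists>P X. ham_sol A B Q P X \<and> P 0 = p \<and> X 0 = x \<and> X T = hamX T p x"
    using ham_sol_flow[of p x] ham_flow_0 by blast
  show "y = hamX T p x" if "\<exists>P X. ham_sol A B Q P X \<and> P 0 = p \<and> X 0 = x \<and> X T = y" for y
    using that ham_sol_unique(2) by blast
qed

text \<open>Invariance of the symplectic form: the terms of the derivative cancel because Q and B
  B^T are symmetric. The symmetry statements and the mixed term of the cost come from here.\<close>

lemma ham_symplectic:
  assumes "ham_sol A B Q P X" "ham_sol A B Q P' X'"
  shows "P t \<bullet> X' t - P' t \<bullet> X t = P 0 \<bullet> X' 0 - P' 0 \<bullet> X 0"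
proof -
  define f where "f t = P t \<bullet> X' t - P' t \<bullet> X t" for t
  have "(f has_real_derivative 0) (at t)" for t
  proof -
    note d = assms[unfolded ham_sol_def, rule_format, of t]
    have BB: "p \<bullet> ((B ** transpose B) *v p') = (transpose B *v p) \<bullet> (transpose B *v p')" for p p'
      unfolding matrix_vector_mul_assoc[symmetric]
      using inner_transpose[of B "transpose B *v p'" p] by (metis inner_commute)
    have AA: "(transpose A *v p) \<bullet> x = p \<bullet> (A *v x)" for p x
      using inner_transpose[of "transpose A" p x] by (simp add: transpose_transpose)
    have "(f has_vector_derivative
        ((P t \<bullet> ((B ** transpose B) *v P' t + A *v X' t) + (- (transpose A *v P t) - Q *v X t) \<bullet> X' t) -
         (P' t \<bullet> ((B ** transpose B) *v P t + A *v X t) + (- (transpose A *v P' t) - Q *v X' t) \<bullet> X t))) (at t)"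
      unfolding f_def[abs_def] using d
      by (intro has_vector_derivative_diff bounded_bilinear.has_vector_derivative[OF bounded_bilinear_inner]) auto
    moreover have "(P t \<bullet> ((B ** transpose B) *v P' t + A *v X' t) + (- (transpose A *v P t) - Q *v X t) \<bullet> X' t) -
         (P' t \<bullet> ((B ** transpose B) *v P t + A *v X t) + (- (transpose A *v P' t) - Q *v X' t) \<bullet> X t) = 0"
      using Q_inner[of "X t" "X' t"]
      by (simp add: inner_add_right inner_diff_left BB AA inner_commute[of "Q *v X' t"] inner_commute[of "transpose B *v P' t"])
    ultimately show ?thesis by (simp add: has_real_derivative_iff_has_vector_derivative)
  qed
  then have "f t = f 0" by (rule DERIV_isconst_all[rule_format, rotated])
  then show ?thesis by (simp add: f_def)
qed

text \<open>A nonzero p with X(t) = 0 would make t itself a conjugate time, below their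
  infimum.\<close>

lemma hamX_injective:
  assumes t: "0 < t" "ereal t < first_conj_time A B Q" and z: "hamX t p 0 = 0"
  shows "p = 0"
proof (rule ccontr)
  assume p: "p \<noteq> 0"
  have "conjugate_time A B Q t"
    unfolding conjugate_time_def
  proof (intro conjI t(1) exI)
    show "ham_sol A B Q (\<lambda>t. hamP t p 0) (\<lambda>t. hamX t p 0)" by (rule ham_sol_flow)
    show "hamX 0 p 0 = 0" "hamX t p 0 = 0" using z by (simp_all add: ham_flow_0)
    show "\<not> (\<forall>r. hamP r p 0 = 0 \<and> hamX r p 0 = 0)"
      using p ham_flow_0(1)[of p 0] by metis
  qed
  then have "first_conj_time A B Q \<le> ereal t"
    unfolding first_conj_time_def by (intro Inf_lower) auto
  then show False using t(2) by simp
qed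

lemma linear_hamX0: "linear (\<lambda>p. hamX t p 0)"
  using ham_flow_linear(2)[of t _ _ 0 0] ham_flow_linear(4)[of t _ _ 0] by (intro linearI) simp_all

lemma linear_hamP0: "linear (\<lambda>p. hamP t p 0)"
  using ham_flow_linear(1)[of t _ _ 0 0] ham_flow_linear(3)[of t _ _ 0] by (intro linearI) simp_all

lemma linear_hamX1: "linear (\<lambda>x. hamX t 0 x)"
  using ham_flow_linear(2)[of t 0 0] ham_flow_linear(4)[of t _ 0] by (intro linearI) simp_all

text \<open>The inverse of \<open>p \<mapsto> X(r)\<close> for extremals issuing from \<open>0\<close>, and the matrix \<open>P(r) X(r)\<^sup>-\<^sup>1\<close> of
  the corresponding field of extremals, which solves a Riccati equation.\<close>

definition extremal_inv :: "real \<Rightarrow> real^'n \<Rightarrow> real^'n" where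
  "extremal_inv r = inv (\<lambda>p. hamX r p 0)"

definition riccati :: "real \<Rightarrow> real^'n \<Rightarrow> real^'n" where
  "riccati r w = hamP r (extremal_inv r w) 0"

lemma extremal_inv:
  assumes r: "0 < r" "ereal r < first_conj_time A B Q"
  shows "linear (extremal_inv r)" "hamX r (extremal_inv r w) 0 = w" "extremal_inv r (hamX r p 0) = p"
proof -
  have inj: "inj (\<lambda>p. hamX r p 0)"
    using linear_injective_0[OF linear_hamX0] hamX_injective[OF r] by blast
  then have surj: "surj (\<lambda>p. hamX r p 0)"
    by (rule linear_injective_imp_surjective[OF linear_hamX0]) simp_all
  show 1: "hamX r (extremal_inv r w) 0 = w" for w
    unfolding extremal_inv_def using surj_f_inv_f[OF surj, of w] .
  show 2: "extremal_inv r (hamX r p 0) = p" for p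
    unfolding extremal_inv_def using inv_f_f[OF inj, of p] .
  show "linear (extremal_inv r)"
  proof (rule linearI)
    fix v w and c :: real
    have "hamX r (extremal_inv r v + extremal_inv r w) 0 = v + w"
      using linear_add[OF linear_hamX0] 1 by metis
    then show "extremal_inv r (v + w) = extremal_inv r v + extremal_inv r w" using 2 by metis
    have "hamX r (c *\<^sub>R extremal_inv r v) 0 = c *\<^sub>R v"
      using linear_cmul[OF linear_hamX0] 1 by metis
    then show "extremal_inv r (c *\<^sub>R v) = c *\<^sub>R extremal_inv r v" using 2 by metis
  qed
qed

lemma linear_riccati:
  assumes "0 < r" "ereal r < first_conj_time A B Q"
  shows "linear (riccati r)"
  using linear_compose[OF extremal_inv(1)[OF assms] linear_hamP0[of r]] by (simp add: riccati_def[abs_def] o_def)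

text \<open>The symplectic form vanishes at time 0 on two extremals issuing from 0, hence also at
  time r, where they pass through v and w.\<close>

lemma riccati_symmetric:
  assumes "0 < r" "ereal r < first_conj_time A B Q"
  shows "riccati r v \<bullet> w = v \<bullet> riccati r w"
  using ham_symplectic[OF ham_sol_flow ham_sol_flow, of r "extremal_inv r v" 0 "extremal_inv r w" 0]
  by (simp add: extremal_inv(2)[OF assms] ham_flow_0 riccati_def inner_commute)

lemma riccati_has_vector_derivative:
  assumes r: "0 < r" "ereal r < first_conj_time A B Q"
  shows "((\<lambda>s. riccati s w) has_vector_derivative
    (- (transpose A *v riccati r w) - Q *v w - riccati r ((B ** transpose B) *v riccati r w + A *v w))) (at r)"
proof -
  \<comment> \<open>Differentiating the inverse at \<open>r\<close> requires invertibility on an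
    open set of times.\<close>
  define I where "I = {s. 0 < s \<and> ereal s < first_conj_time A B Q}"
  have oI: "open I"
  proof -
    have "open {s. 0 < s \<and> ereal s < x}" for x
    proof (cases x)
      case (real y)
      then have "{s. 0 < s \<and> ereal s < x} = {0<..<y}" by auto
      then show ?thesis by simp
    next
      case PInf
      then have "{s. 0 < s \<and> ereal s < x} = {0<..}" by auto
      then show ?thesis by simp
    qed simp
    then show ?thesis by (simp add: I_def)
  qed
  have rI: "r \<in> I" using r by (simp add: I_def)
  have dX: "((\<lambda>s. hamX s p 0) has_vector_derivative ((B ** transpose B) *v hamP r p 0 + A *v hamX r p 0)) (at r)"
    and dP: "((\<lambda>s. hamP s p 0) has_vector_derivative (- (transpose A *v hamP r p 0) - Q *v hamX r p 0)) (at r)" for p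
    using ham_sol_flow[of p 0] by (auto simp: ham_sol_def)
  have dV: "((\<lambda>s. extremal_inv s w) has_vector_derivative
      - extremal_inv r ((B ** transpose B) *v hamP r (extremal_inv r w) 0 + A *v hamX r (extremal_inv r w) 0)) (at r)"
    by (rule linear_family_inverse_has_vector_derivative[where N = "\<lambda>s p. hamX s p 0"
          and N' = "\<lambda>p. (B ** transpose B) *v hamP r p 0 + A *v hamX r p 0", OF linear_hamX0 rI oI])
      (use dX extremal_inv in \<open>auto simp: I_def\<close>)
  have lP': "linear (\<lambda>p. - (transpose A *v hamP r p 0) - Q *v hamX r p 0)"
    by (rule linearI) (simp_all add: linear_add[OF linear_hamX0] linear_add[OF linear_hamP0]
        linear_cmul[OF linear_hamX0] linear_cmul[OF linear_hamP0] matrix_vector_right_distrib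
        matrix_vector_mult_scaleR algebra_simps scaleR_diff_right)
  have "((\<lambda>s. hamP s (extremal_inv s w) 0) has_vector_derivative
      ((- (transpose A *v hamP r (extremal_inv r w) 0) - Q *v hamX r (extremal_inv r w) 0) +
       hamP r (- extremal_inv r ((B ** transpose B) *v hamP r (extremal_inv r w) 0 + A *v hamX r (extremal_inv r w) 0)) 0)) (at r)"
    by (rule linear_family_has_vector_derivative[OF linear_hamP0 lP' dP dV])
  then show ?thesis
    by (simp add: riccati_def[symmetric] extremal_inv(2)[OF r] linear_neg[OF linear_hamP0])
qed

section \<open>Verification and the quadratic formula for the cost\<close>

context
  fixes T :: real
  assumes T: "0 < T" "ereal T < first_conj_time A B Q"
begin

text \<open>Verification: with the field of extremals issuing from \<open>0\<close> at a time slightly before \<open>0\<close>,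
  the second variation is a square plus a boundary term vanishing at both ends.\<close>

lemma LQ_action_lower_bound:
  assumes u: "LQ_control A B 0 T \<gamma> u" and ends: "\<gamma> 0 = x" "\<gamma> T = hamX T p x"
  shows "(1/2) * (hamP T p x \<bullet> hamX T p x - p \<bullet> x) \<le> LQ_action_val Q 0 T \<gamma> u"
proof -
  obtain T1 where T1: "ereal T < ereal T1" "ereal T1 < first_conj_time A B Q"
  proof -
    obtain z where z: "ereal T < z" "z < first_conj_time A B Q" using dense[OF T(2)] by blast
    then obtain T1 where "z = ereal T1" by (cases z) auto
    then show ?thesis using that z by blast
  qed
  \<comment> \<open>The shifted times \<tau> + e run through [e, T1], away from the singular time 0
    and still below the first conjugate time.\<close>
  define e where "e = T1 - T"
  have e: "e > 0" using T1(1) by (simp add: e_def)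
  have in_range: "0 < \<tau> + e \<and> ereal (\<tau> + e) < first_conj_time A B Q" if "\<tau> \<in> {0..T}" for \<tau>
  proof -
    have "ereal (\<tau> + e) \<le> ereal T1" using that by (simp add: e_def)
    then have "ereal (\<tau> + e) < first_conj_time A B Q" using T1(2) by (rule le_less_trans)
    then show ?thesis using that e by simp
  qed
  define S where "S \<tau> = riccati (\<tau> + e)" for \<tau>
  have lS: "linear (S \<tau>)" if "\<tau> \<in> {0..T}" for \<tau> unfolding S_def using in_range[OF that] linear_riccati by blast
  have Ssym: "S \<tau> v \<bullet> w = v \<bullet> S \<tau> w" if "\<tau> \<in> {0..T}" for \<tau> v w
    unfolding S_def using in_range[OF that] riccati_symmetric by blast
  define S' where "S' \<tau> w = - (transpose A *v S \<tau> w) - Q *v w - S \<tau> ((B ** transpose B) *v S \<tau> w + A *v w)" for \<tau> w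
  have dS: "((\<lambda>\<tau>. S \<tau> w) has_vector_derivative S' \<tau> w) (at \<tau> within {0..T})" if \<tau>: "\<tau> \<in> {0..T}" for \<tau> w
  proof -
    have 1: "((\<lambda>s. riccati s w) has_vector_derivative S' \<tau> w) (at (\<tau> + e))"
      unfolding S'_def S_def using in_range[OF \<tau>] riccati_has_vector_derivative by blast
    have 2: "((\<lambda>\<tau>. \<tau> + e) has_vector_derivative 1) (at \<tau>)"
      by (auto intro!: derivative_eq_intros)
    have "((\<lambda>s. riccati s w) \<circ> (\<lambda>\<tau>. \<tau> + e) has_vector_derivative 1 *\<^sub>R S' \<tau> w) (at \<tau>)"
      by (rule vector_diff_chain_at[OF 2 1])
    then show ?thesis by (simp add: o_def S_def has_vector_derivative_at_within)
  qed
  have cS: "continuous_on {0..T} (\<lambda>\<tau>. S \<tau> w)" for w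
    by (rule continuous_on_vector_derivative) (use dS in auto)
  \<comment> \<open>Regularity of \<open>S\<close> is known only at fixed vectors; this expansion
    carries it over to moving arguments.\<close>
  have expS: "S \<tau> v = (\<Sum>b\<in>Basis. (v \<bullet> b) *\<^sub>R S \<tau> b)" if "\<tau> \<in> {0..T}" for \<tau> v
    using lS[OF that] by (subst euclidean_representation[of v, symmetric]) (simp add: linear_sum linear_cmul del: euclidean_representation)
  have cSv: "continuous_on {0..T} (\<lambda>\<tau>. S \<tau> (v \<tau>))" if "continuous_on {0..T} v" for v
  proof -
    have "continuous_on {0..T} (\<lambda>\<tau>. \<Sum>b\<in>Basis. (v \<tau> \<bullet> b) *\<^sub>R S \<tau> b)"
      by (intro continuous_intros cS that)
    then show ?thesis by (rule continuous_on_cong[THEN iffD1, OF refl _, rotated]) (simp add: expS)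
  qed
  have cM: "continuous_on {0..T} (\<lambda>\<tau>. M *v v \<tau>)" if "continuous_on {0..T} v" for M :: "real^'n^'n" and v
    by (rule bounded_linear.continuous_on[OF matrix_vector_mul_bounded_linear that])
  have acS: "abs_cont_on 0 T (\<lambda>\<tau>. S \<tau> w)" for w
  proof (rule abs_cont_on_C1[OF dS])
    show "continuous_on {0..T} (\<lambda>\<tau>. S' \<tau> w)"
      unfolding S'_def by (intro continuous_intros cM cSv cS)
  qed
  define P where "P \<tau> = hamP \<tau> p x" for \<tau>
  define X where "X \<tau> = hamX \<tau> p x" for \<tau>
  have PX: "ham_sol A B Q P X" unfolding P_def X_def by (rule ham_sol_flow)
  note dPX = PX[unfolded ham_sol_def, rule_format]
  have dP: "(P has_vector_derivative (- (transpose A *v P \<tau>) - Q *v X \<tau>)) (at \<tau> within s)"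
    and dX: "(X has_vector_derivative ((B ** transpose B) *v P \<tau> + A *v X \<tau>)) (at \<tau> within s)" for \<tau> s
    using dPX by (auto intro: has_vector_derivative_at_within)
  have cP: "continuous_on {0..T} P" and cX: "continuous_on {0..T} X"
    using dP dX by (auto intro!: continuous_on_vector_derivative)
  have acP: "abs_cont_on 0 T P"
    by (rule abs_cont_on_C1[OF dP]) (intro continuous_intros cM cP cX)
  have acX: "abs_cont_on 0 T X"
    by (rule abs_cont_on_C1[OF dX]) (intro continuous_intros cM cP cX)
  have ac\<gamma>: "abs_cont_on 0 T \<gamma>" using u by (simp add: LQ_control_def)
  define \<delta> where "\<delta> \<tau> = \<gamma> \<tau> - X \<tau>" for \<tau>
  have ac\<delta>: "abs_cont_on 0 T \<delta>"
  proof -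
    have "abs_cont_on 0 T (\<lambda>\<tau>. (-1) *\<^sub>R X \<tau>)"
      by (rule abs_cont_on_bilinear[OF bounded_bilinear_scaleR abs_cont_on_const acX])
    from abs_cont_on_add[OF ac\<gamma> this] show ?thesis by (simp add: \<delta>_def[abs_def])
  qed
  \<comment> \<open>Value along the extremal, first order term, and quadratic form of the field
    applied to the deviation. The last two vanish at both ends since \<open>\<delta>\<close> does.
    The basis sum is S \<delta>, written so that the rules for sums and bilinear maps apply.\<close>
  define F where "F \<tau> = P \<tau> \<bullet> X \<tau> + 2 * (P \<tau> \<bullet> \<delta> \<tau>) + \<delta> \<tau> \<bullet> (\<Sum>b\<in>Basis. (\<delta> \<tau> \<bullet> b) *\<^sub>R S \<tau> b)" for \<tau>
  have acF: "abs_cont_on 0 T F"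
  proof -
    note bi = abs_cont_on_bilinear[OF bounded_bilinear_inner]
    have "abs_cont_on 0 T (\<lambda>\<tau>. \<Sum>b\<in>Basis. (\<delta> \<tau> \<bullet> b) *\<^sub>R S \<tau> b)"
      by (intro abs_cont_on_sum abs_cont_on_bilinear[OF bounded_bilinear_scaleR] bi abs_cont_on_const ac\<delta> acS) auto
    then show ?thesis
      unfolding F_def by (intro abs_cont_on_add bi acP acX ac\<delta> abs_cont_on_const
        abs_cont_on_bilinear[OF bounded_bilinear_mult])
  qed
  have "AE \<tau> in lebesgue_on {0..T}. (\<gamma> has_vector_derivative (A *v \<gamma> \<tau> + B *v u \<tau>)) (at \<tau> within {0..T})"
    using u by (simp add: LQ_control_def)
  then have "AE \<tau> in lebesgue. \<tau> \<in> {0..T} \<longrightarrow> (\<gamma> has_vector_derivative (A *v \<gamma> \<tau> + B *v u \<tau>)) (at \<tau> within {0..T})"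
    by (subst (asm) AE_restrict_space_iff) auto
  then obtain N where N: "N \<in> null_sets lebesgue"
    "\<And>\<tau>. \<tau> \<in> {0..T} \<Longrightarrow> \<tau> \<notin> N \<Longrightarrow> (\<gamma> has_vector_derivative (A *v \<gamma> \<tau> + B *v u \<tau>)) (at \<tau> within {0..T})"
    by (elim AE_E3) auto
  have negN: "negligible N" using N(1) by (simp add: negligible_iff_null_sets)
  define l where "l \<tau> = (norm (u \<tau>))\<^sup>2 - \<gamma> \<tau> \<bullet> (Q *v \<gamma> \<tau>)" for \<tau>
  \<comment> \<open>Completion of the square: the derivative of \<open>F\<close> falls short of the
    integrand by the squared distance of the control from the feedback B^T (P + S \<delta>) of the
    field.\<close>
  define F' where "F' \<tau> = l \<tau> - (norm (u \<tau> - transpose B *v (P \<tau> + S \<tau> (\<delta> \<tau>))))\<^sup>2" for \<tau>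
  have dF: "(F has_vector_derivative F' \<tau>) (at \<tau> within {0..T})" if \<tau>: "\<tau> \<in> {0..T} - N" for \<tau>
  proof -
    have \<tau>T: "\<tau> \<in> {0..T}" using \<tau> by simp
    define v where "v = u \<tau> - transpose B *v P \<tau>"
    have d\<gamma>: "(\<gamma> has_vector_derivative (A *v \<gamma> \<tau> + B *v u \<tau>)) (at \<tau> within {0..T})" using N(2) \<tau> by simp
    have d\<delta>: "(\<delta> has_vector_derivative (A *v \<delta> \<tau> + B *v v)) (at \<tau> within {0..T})"
    proof -
      have "A *v \<delta> \<tau> + B *v v = (A *v \<gamma> \<tau> + B *v u \<tau>) - ((B ** transpose B) *v P \<tau> + A *v X \<tau>)"
        by (simp add: \<delta>_def v_def matrix_vector_mult_diff_distrib matrix_vector_mul_assoc)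
      then show ?thesis unfolding \<delta>_def[abs_def] using has_vector_derivative_diff[OF d\<gamma> dX] by (simp add: \<delta>_def)
    qed
    define d where "d = A *v \<delta> \<tau> + B *v v"
    have dinner: "((\<lambda>\<tau>. \<delta> \<tau> \<bullet> b) has_vector_derivative (d \<bullet> b)) (at \<tau> within {0..T})" for b
      using bounded_linear.has_vector_derivative[OF bounded_linear_inner_left d\<delta>] by (simp add: d_def)
    have dSd: "((\<lambda>\<tau>. \<Sum>b\<in>Basis. (\<delta> \<tau> \<bullet> b) *\<^sub>R S \<tau> b) has_vector_derivative (S' \<tau> (\<delta> \<tau>) + S \<tau> d)) (at \<tau> within {0..T})"
    proof -
      have "((\<lambda>\<tau>. \<Sum>b\<in>Basis. (\<delta> \<tau> \<bullet> b) *\<^sub>R S \<tau> b) has_vector_derivative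
          (\<Sum>b\<in>Basis. (\<delta> \<tau> \<bullet> b) *\<^sub>R S' \<tau> b + (d \<bullet> b) *\<^sub>R S \<tau> b)) (at \<tau> within {0..T})"
        by (intro has_vector_derivative_sum bounded_bilinear.has_vector_derivative[OF bounded_bilinear_scaleR dinner dS[OF \<tau>T]])
      moreover have "(\<Sum>b\<in>Basis. (\<delta> \<tau> \<bullet> b) *\<^sub>R S' \<tau> b + (d \<bullet> b) *\<^sub>R S \<tau> b) = S' \<tau> (\<delta> \<tau>) + S \<tau> d"
      proof -
        have lS': "linear (S' \<tau>)"
          unfolding S'_def by (rule linearI) (simp_all add: linear_add[OF lS[OF \<tau>T]] linear_cmul[OF lS[OF \<tau>T]]
              matrix_vector_right_distrib matrix_vector_mult_scaleR algebra_simps scaleR_diff_right)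
        have "S' \<tau> (\<delta> \<tau>) = (\<Sum>b\<in>Basis. (\<delta> \<tau> \<bullet> b) *\<^sub>R S' \<tau> b)"
          using lS' by (subst euclidean_representation[of "\<delta> \<tau>", symmetric]) (simp add: linear_sum linear_cmul del: euclidean_representation)
        then show ?thesis by (simp add: sum.distrib expS[OF \<tau>T, of d])
      qed
      ultimately show ?thesis by simp
    qed
    have "(F has_vector_derivative
        ((P \<tau> \<bullet> ((B ** transpose B) *v P \<tau> + A *v X \<tau>) + (- (transpose A *v P \<tau>) - Q *v X \<tau>) \<bullet> X \<tau>) +
         2 * (P \<tau> \<bullet> d + (- (transpose A *v P \<tau>) - Q *v X \<tau>) \<bullet> \<delta> \<tau>) +
         (\<delta> \<tau> \<bullet> (S' \<tau> (\<delta> \<tau>) + S \<tau> d) + d \<bullet> (\<Sum>b\<in>Basis. (\<delta> \<tau> \<bullet> b) *\<^sub>R S \<tau> b)))) (at \<tau> within {0..T})"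
      unfolding F_def[abs_def]
      by (intro has_vector_derivative_add has_vector_derivative_mult_right
          bounded_bilinear.has_vector_derivative[OF bounded_bilinear_inner] dP dX d\<delta>[folded d_def] dSd)
    moreover have "(P \<tau> \<bullet> ((B ** transpose B) *v P \<tau> + A *v X \<tau>) + (- (transpose A *v P \<tau>) - Q *v X \<tau>) \<bullet> X \<tau>) +
         2 * (P \<tau> \<bullet> d + (- (transpose A *v P \<tau>) - Q *v X \<tau>) \<bullet> \<delta> \<tau>) +
         (\<delta> \<tau> \<bullet> (S' \<tau> (\<delta> \<tau>) + S \<tau> d) + d \<bullet> (\<Sum>b\<in>Basis. (\<delta> \<tau> \<bullet> b) *\<^sub>R S \<tau> b)) = F' \<tau>"
    proof -
      define s where "s = S \<tau> (\<delta> \<tau>)"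
      define bp where "bp = transpose B *v P \<tau>"
      define bs where "bs = transpose B *v s"
      have AA: "(transpose A *v y) \<bullet> z = y \<bullet> (A *v z)" for y z
        using inner_transpose[of "transpose A" y z] by (simp add: transpose_transpose)
      have BB: "y \<bullet> (B *v z) = (transpose B *v y) \<bullet> z" for y z
        using inner_transpose[of B z y] by (simp add: inner_commute)
      have Sd: "\<delta> \<tau> \<bullet> S \<tau> w = s \<bullet> w" for w using Ssym[OF \<tau>T, of "\<delta> \<tau>" w] by (simp add: s_def)
      have e1: "P \<tau> \<bullet> ((B ** transpose B) *v P \<tau>) = bp \<bullet> bp"
        by (simp add: matrix_vector_mul_assoc[symmetric] BB bp_def)
      have e2: "P \<tau> \<bullet> d = P \<tau> \<bullet> (A *v \<delta> \<tau>) + bp \<bullet> v" by (simp add: d_def inner_add_right BB bp_def)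
      have e3: "s \<bullet> d = s \<bullet> (A *v \<delta> \<tau>) + bs \<bullet> v" by (simp add: d_def inner_add_right BB bs_def)
      have e4: "s \<bullet> ((B ** transpose B) *v s) = bs \<bullet> bs"
        by (simp add: matrix_vector_mul_assoc[symmetric] BB bs_def)
      have e5: "\<delta> \<tau> \<bullet> S' \<tau> (\<delta> \<tau>) = - (s \<bullet> (A *v \<delta> \<tau>)) - \<delta> \<tau> \<bullet> (Q *v \<delta> \<tau>) - (bs \<bullet> bs + s \<bullet> (A *v \<delta> \<tau>))"
      proof -
        have "\<delta> \<tau> \<bullet> (transpose A *v s) = s \<bullet> (A *v \<delta> \<tau>)" using AA[of s "\<delta> \<tau>"] by (simp add: inner_commute)
        then show ?thesis
          unfolding S'_def s_def[symmetric] by (simp add: inner_diff_right inner_add_right Sd e4)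
      qed
      have e6: "d \<bullet> (\<Sum>b\<in>Basis. (\<delta> \<tau> \<bullet> b) *\<^sub>R S \<tau> b) = s \<bullet> d"
        using expS[OF \<tau>T, of "\<delta> \<tau>"] by (simp add: s_def inner_commute)
      have \<gamma>X: "\<gamma> \<tau> = X \<tau> + \<delta> \<tau>" by (simp add: \<delta>_def)
      have QX: "(Q *v X \<tau>) \<bullet> \<delta> \<tau> = X \<tau> \<bullet> (Q *v \<delta> \<tau>)" by (rule Q_inner)
      have e7: "\<gamma> \<tau> \<bullet> (Q *v \<gamma> \<tau>) = X \<tau> \<bullet> (Q *v X \<tau>) + 2 * (X \<tau> \<bullet> (Q *v \<delta> \<tau>)) + \<delta> \<tau> \<bullet> (Q *v \<delta> \<tau>)"
        using QX unfolding \<gamma>X by (simp add: matrix_vector_right_distrib inner_add_left inner_add_right inner_commute)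
      have uv: "u \<tau> = bp + v" by (simp add: v_def bp_def)
      have e8: "F' \<tau> = (bp \<bullet> bp + 2 * (bp \<bullet> v) + v \<bullet> v) - (X \<tau> \<bullet> (Q *v X \<tau>) + 2 * (X \<tau> \<bullet> (Q *v \<delta> \<tau>)) + \<delta> \<tau> \<bullet> (Q *v \<delta> \<tau>))
          - (v \<bullet> v - 2 * (bs \<bullet> v) + bs \<bullet> bs)"
      proof -
        have eq: "u \<tau> - transpose B *v (P \<tau> + S \<tau> (\<delta> \<tau>)) = v - bs"
          by (simp add: uv bp_def bs_def s_def matrix_vector_right_distrib)
        show ?thesis
          unfolding F'_def l_def e7 eq power2_norm_eq_inner
          by (simp add: uv inner_add_left inner_add_right inner_diff_left inner_diff_right inner_commute)
      qed
      show ?thesis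
        unfolding e6 e8 inner_add_right[of "\<delta> \<tau>"] Sd e5
        by (simp add: inner_add_right inner_diff_left e1 e2 e3 AA QX inner_commute[of "Q *v X \<tau>" "X \<tau>"])
    qed
    ultimately show ?thesis by simp
  qed
  have iF: "(F' has_integral (F T - F 0)) {0..T}"
    by (rule fundamental_theorem_of_calculus_abs_cont[OF _ acF negN dF]) (use T in auto)
  have il: "integrable (lebesgue_on {0..T}) l"
  proof -
    have c: "continuous_on {0..T} (\<lambda>\<tau>. \<gamma> \<tau> \<bullet> (Q *v \<gamma> \<tau>))"
      by (intro continuous_intros cM abs_cont_on_continuous ac\<gamma>)
    have "integrable (lebesgue_on {0..T}) (\<lambda>\<tau>. \<gamma> \<tau> \<bullet> (Q *v \<gamma> \<tau>))"
      using absolutely_integrable_continuous_real[OF c] by (simp add: integrable_restrict_space set_integrable_def)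
    then show ?thesis unfolding l_def using u by (intro Bochner_Integration.integrable_diff) (auto simp: LQ_control_def)
  qed
  have "(l has_integral (integral\<^sup>L (lebesgue_on {0..T}) l)) {0..T}"
    by (rule has_integral_integral_lebesgue_on[OF il]) simp
  then have "F T - F 0 \<le> integral\<^sup>L (lebesgue_on {0..T}) l"
    by (rule has_integral_le[OF iF]) (simp add: F'_def)
  moreover have "F T = hamP T p x \<bullet> hamX T p x" using ends by (simp add: F_def \<delta>_def P_def X_def)
  moreover have "F 0 = p \<bullet> x" using ends by (simp add: F_def \<delta>_def P_def X_def ham_flow_0)
  ultimately show ?thesis by (simp add: LQ_action_val_def l_def[abs_def])
qed

text \<open>Along an extremal with u = B^T P the derivative of P.X is |u|^2 - X.QX, so the action is
  a boundary term and attains the lower bound.\<close>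

lemma LQ_extremal_control:
  "LQ_control A B 0 T (\<lambda>\<tau>. hamX \<tau> p x) (\<lambda>\<tau>. transpose B *v hamP \<tau> p x)"
  "LQ_action_val Q 0 T (\<lambda>\<tau>. hamX \<tau> p x) (\<lambda>\<tau>. transpose B *v hamP \<tau> p x) = (1/2) * (hamP T p x \<bullet> hamX T p x - p \<bullet> x)"
proof -
  define P where "P \<tau> = hamP \<tau> p x" for \<tau>
  define X where "X \<tau> = hamX \<tau> p x" for \<tau>
  have PX: "ham_sol A B Q P X" unfolding P_def X_def by (rule ham_sol_flow)
  note dPX = PX[unfolded ham_sol_def, rule_format]
  have dP: "(P has_vector_derivative (- (transpose A *v P \<tau>) - Q *v X \<tau>)) (at \<tau> within s)"
    and dX: "(X has_vector_derivative ((B ** transpose B) *v P \<tau> + A *v X \<tau>)) (at \<tau> within s)" for \<tau> s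
    using dPX by (auto intro: has_vector_derivative_at_within)
  have cP: "continuous_on {0..T} P" and cX: "continuous_on {0..T} X"
    using dP dX by (auto intro!: continuous_on_vector_derivative)
  have cM: "continuous_on {0..T} (\<lambda>\<tau>. M *v v \<tau>)" if "continuous_on {0..T} v" for M :: "real^'k^'j" and v
    by (rule bounded_linear.continuous_on[OF matrix_vector_mul_bounded_linear that])
  have acX: "abs_cont_on 0 T X"
    by (rule abs_cont_on_C1[OF dX]) (intro continuous_intros cM cP cX)
  define u where "u \<tau> = transpose B *v P \<tau>" for \<tau>
  have cu: "continuous_on {0..T} u" unfolding u_def by (rule cM[OF cP])
  have int: "integrable (lebesgue_on {0..T}) f" if "continuous_on {0..T} f" for f :: "real \<Rightarrow> real"
    using absolutely_integrable_continuous_real[OF that] by (simp add: integrable_restrict_space set_integrable_def)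
  show "LQ_control A B 0 T (\<lambda>\<tau>. hamX \<tau> p x) (\<lambda>\<tau>. transpose B *v hamP \<tau> p x)"
    unfolding LQ_control_def X_def[symmetric] P_def[symmetric] u_def[symmetric]
  proof (intro conjI)
    show "abs_cont_on 0 T X" by (rule acX)
    show "u \<in> borel_measurable (lebesgue_on {0..T})" by (rule continuous_imp_measurable_on_sets_lebesgue[OF cu]) simp
    show "integrable (lebesgue_on {0..T}) (\<lambda>\<tau>. (norm (u \<tau>))\<^sup>2)" by (intro int continuous_intros cu)
    have "(X has_vector_derivative A *v X \<tau> + B *v u \<tau>) (at \<tau> within {0..T})" for \<tau>
      using dX[of \<tau>] by (simp add: u_def matrix_vector_mul_assoc add.commute)
    then show "AE \<tau> in lebesgue_on {0..T}. (X has_vector_derivative A *v X \<tau> + B *v u \<tau>) (at \<tau> within {0..T})"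
      by simp
  qed
  define l where "l \<tau> = (norm (u \<tau>))\<^sup>2 - X \<tau> \<bullet> (Q *v X \<tau>)" for \<tau>
  have "((\<lambda>\<tau>. P \<tau> \<bullet> X \<tau>) has_vector_derivative l \<tau>) (at \<tau> within {0..T})" for \<tau>
  proof -
    have "((\<lambda>\<tau>. P \<tau> \<bullet> X \<tau>) has_vector_derivative
        (P \<tau> \<bullet> ((B ** transpose B) *v P \<tau> + A *v X \<tau>) + (- (transpose A *v P \<tau>) - Q *v X \<tau>) \<bullet> X \<tau>)) (at \<tau> within {0..T})"
      by (rule bounded_bilinear.has_vector_derivative[OF bounded_bilinear_inner dP dX])
    moreover have "P \<tau> \<bullet> ((B ** transpose B) *v P \<tau>) = u \<tau> \<bullet> u \<tau>"
      using inner_transpose[of B "u \<tau>" "P \<tau>"] by (simp add: u_def matrix_vector_mul_assoc inner_commute)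
    moreover have "(transpose A *v P \<tau>) \<bullet> X \<tau> = P \<tau> \<bullet> (A *v X \<tau>)"
      using inner_transpose[of "transpose A" "P \<tau>" "X \<tau>"] by (simp add: transpose_transpose)
    ultimately show ?thesis
      by (simp add: l_def power2_norm_eq_inner inner_add_right inner_diff_left inner_commute[of "Q *v X \<tau>"])
  qed
  then have "(l has_integral (P T \<bullet> X T - P 0 \<bullet> X 0)) {0..T}"
    using T by (intro fundamental_theorem_of_calculus) auto
  moreover have "(l has_integral (integral\<^sup>L (lebesgue_on {0..T}) l)) {0..T}"
    by (rule has_integral_integral_lebesgue_on) (auto simp: l_def intro!: int continuous_intros cu cM cX)
  ultimately have "integral\<^sup>L (lebesgue_on {0..T}) l = P T \<bullet> X T - P 0 \<bullet> X 0"
    by (rule has_integral_unique[rotated])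
  then show "LQ_action_val Q 0 T (\<lambda>\<tau>. hamX \<tau> p x) (\<lambda>\<tau>. transpose B *v hamP \<tau> p x) = (1/2) * (hamP T p x \<bullet> hamX T p x - p \<bullet> x)"
    by (simp add: LQ_action_val_def l_def[abs_def] u_def P_def X_def ham_flow_0)
qed

lemma LQ_cost_eq: "LQ_cost A B Q 0 T x (hamX T p x) = (1/2) * (hamP T p x \<bullet> hamX T p x - p \<bullet> x)"
  unfolding LQ_cost_def
proof (rule cInf_eq_minimum)
  show "(1/2) * (hamP T p x \<bullet> hamX T p x - p \<bullet> x) \<in> {LQ_action_val Q 0 T \<gamma> u |\<gamma> u.
      LQ_control A B 0 T \<gamma> u \<and> \<gamma> 0 = x \<and> \<gamma> T = hamX T p x}"
    using LQ_extremal_control[of p x] ham_flow_0(2)[of p x] by (metis (mono_tags, lifting) mem_Collect_eq)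
  fix v assume "v \<in> {LQ_action_val Q 0 T \<gamma> u |\<gamma> u. LQ_control A B 0 T \<gamma> u \<and> \<gamma> 0 = x \<and> \<gamma> T = hamX T p x}"
  then show "(1/2) * (hamP T p x \<bullet> hamX T p x - p \<bullet> x) \<le> v" using LQ_action_lower_bound by blast
qed

text \<open>Here \<open>E\<close> inverts p |-> exp_{0,T}(p), and - G x is the initial covector of
  the extremal from x to 0. By linearity the extremal from x to y has initial covector E y - G x,
  and the value formula becomes a quadratic polynomial in (x, y); \<open>H\<close> is the Riccati
  matrix at time T.\<close>

lemma LQ_cost_quadratic:
  "\<exists>E Ei M G H. linear E \<and> linear Ei \<and> linear M \<and> linear G \<and> linear H \<and>
     (\<forall>y. Ei (E y) = y) \<and> (\<forall>y. E (Ei y) = y) \<and> (\<forall>x. G x = E (M x)) \<and> (\<forall>x y. G x \<bullet> y = x \<bullet> G y) \<and>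
     (\<forall>x y. LQ_cost A B Q 0 T x y = (1/2) * (x \<bullet> G x) + (1/2) * (y \<bullet> H y) - x \<bullet> E y) \<and>
     (\<forall>x p. LQ_exp A B Q x T p = Ei p + M x)"
proof -
  define E where "E = extremal_inv T"
  define Ei where "Ei p = hamX T p 0" for p
  define M where "M x = hamX T 0 x" for x
  define G where "G x = E (M x)" for x
  define H where "H = riccati T"
  have lE: "linear E" and lEi: "linear Ei" and lM: "linear M" and lH: "linear H"
    unfolding E_def Ei_def[abs_def] M_def[abs_def] H_def
    by (rule extremal_inv(1)[OF T] linear_hamX0 linear_hamX1 linear_riccati[OF T])+
  have lG: "linear G" using linear_compose[OF lM lE] by (simp add: G_def[abs_def] o_def)
  have EEi: "E (Ei p) = p" and EiE: "Ei (E y) = y" for p y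
    unfolding E_def Ei_def by (rule extremal_inv(3)[OF T], rule extremal_inv(2)[OF T])
  have exp: "hamX T p x = Ei p + M x" for p x
    using ham_flow_linear(2)[of T p 0 0 x] by (simp add: Ei_def M_def)
  have h0: "hamX T (- G x) x = 0" for x
    unfolding exp by (simp add: linear_neg[OF lEi] G_def EiE)
  \<comment> \<open>Symplectic invariance for two extremals that both end at 0.\<close>
  have Gsym: "G x \<bullet> y = x \<bullet> G y" for x y
    using ham_symplectic[OF ham_sol_flow ham_sol_flow, of T "- G x" x "- G y" y]
    by (simp add: h0 ham_flow_0 inner_commute)
  have cost: "LQ_cost A B Q 0 T x y = (1/2) * (x \<bullet> G x) + (1/2) * (y \<bullet> H y) - x \<bullet> E y" for x y
  proof -
    define p where "p = - G x + E y"
    have X: "hamX T p x = y" unfolding p_def exp by (simp add: linear_diff[OF lEi] linear_add[OF lEi] linear_neg[OF lEi] G_def EiE)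
    have "hamP T p x = hamP T (- G x) x + hamP T (E y) 0"
      using ham_flow_linear(1)[of T "- G x" "E y" x 0] by (simp add: p_def)
    moreover have "hamP T (E y) 0 = H y" by (simp add: H_def E_def riccati_def)
    \<comment> \<open>Symplectic invariance for the extremal from x to 0 and the one from 0 to
      y.\<close>
    moreover have "hamP T (- G x) x \<bullet> y = - (E y \<bullet> x)"
      using ham_symplectic[OF ham_sol_flow ham_sol_flow, of T "- G x" x "E y" 0] h0[of x] EiE[of y]
      by (simp add: ham_flow_0 Ei_def)
    ultimately have "hamP T p x \<bullet> y - p \<bullet> x = - (E y \<bullet> x) + H y \<bullet> y + G x \<bullet> x - E y \<bullet> x"
      by (simp add: inner_add_left p_def inner_diff_left)
    then show ?thesis using LQ_cost_eq[of x p] unfolding X by (simp add: inner_commute)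
  qed
  have "LQ_exp A B Q x T p = Ei p + M x" for x p unfolding LQ_exp_eq exp ..
  then show ?thesis using lE lEi lM lG lH EEi EiE Gsym cost G_def
    by (intro exI[of _ E] exI[of _ Ei] exI[of _ M] exI[of _ G] exI[of _ H]) auto
qed

end

end

section \<open>Optimal plans for costs of the form \<open>a x + b y - x \<bullet> L y\<close>\<close>

text \<open>Closed sets are Borel, so the vanishing \<open>emeasure\<close> of a hypersurface is
  genuine nullity and not the default value of a nonmeasurable set.\<close>

lemma cc_hypersurface_closed:
  assumes "cc_hypersurface E"
  shows "closed E"
proof -
  obtain k f g where fg: "convex_on UNIV f" "convex_on UNIV g" and E: "E = {x. x $ k = f x - g x}"
    using assms unfolding cc_hypersurface_def by blast
  have "continuous_on UNIV f" "continuous_on UNIV g"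
    by (rule convex_on_continuous[OF open_UNIV fg(1)], rule convex_on_continuous[OF open_UNIV fg(2)])
  then show ?thesis unfolding E by (intro closed_Collect_eq continuous_intros)
qed

text \<open>Existence of a subgradient is not claimed: points without one satisfy the statement
  vacuously. Existence is later supplied by a plan living on the graph of the
  subdifferential.\<close>

lemma AE_subgrad_unique:
  fixes f :: "real^'n \<Rightarrow> real"
  assumes f: "convex_on D f" and mu: "sets \<mu> = sets borel"
    and hyp: "\<And>E. cc_hypersurface E \<Longrightarrow> emeasure \<mu> E = 0"
  shows "AE x in \<mu>. \<forall>p\<in>subgrad D f x. x \<in> interior D \<and> subgrad D f x = {p}"
proof -
  obtain Z where Z: "countable Z" "\<forall>z\<in>Z. cc_hypersurface z"
    "{x. \<exists>p\<in>subgrad D f x. \<exists>q\<in>subgrad D f x. p \<noteq> q} \<subseteq> \<Union>Z"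
    using multiple_subgradients_cover[of D f] by blast
  have "z \<in> null_sets \<mu>" if "z \<in> Z" for z
    using hyp Z(2) that mu by (intro null_setsI) (auto simp: borel_closed cc_hypersurface_closed)
  then have "(\<Union>z\<in>Z. z) \<in> null_sets \<mu>" by (intro null_sets_UN' Z(1))
  then have "AE x in \<mu>. x \<notin> (\<Union>z\<in>Z. z)" by (rule AE_not_in)
  then show ?thesis
  proof eventually_elim
    case (elim x)
    have eq: "p = q" if "p \<in> subgrad D f x" "q \<in> subgrad D f x" for p q
      using elim Z(3) that by blast
    show ?case
    proof (intro ballI conjI)
      fix p assume p: "p \<in> subgrad D f x"
      show "x \<in> interior D"
        using subgrad_boundary_multiple[OF convex_on_imp_convex[OF f] _ p] eq[OF p] by blast
      show "subgrad D f x = {p}" using p eq by blast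
    qed
  qed
qed

text \<open>A gradient defined everywhere, Borel for convex \<open>f\<close> without any discussion
  of where it is differentiable. The value 0 off the interior settles points where \<open>f\<close>
  means nothing.\<close>

definition grad_map :: "'a::euclidean_space set \<Rightarrow> ('a \<Rightarrow> real) \<Rightarrow> 'a \<Rightarrow> 'a" where
  "grad_map D f x = (\<Sum>b\<in>Basis. directional_deriv (\<lambda>x. if x \<in> interior D then f x else 0) b x *\<^sub>R b)"

lemma borel_measurable_grad_map:
  assumes f: "convex_on D f"
  shows "grad_map D f \<in> borel_measurable borel"
proof -
  have "continuous_on (interior D) f"
    by (rule convex_on_continuous) (auto intro: convex_on_subset[OF f interior_subset] convex_interior convex_on_imp_convex[OF f])
  then have "(\<lambda>x. if x \<in> interior D then f x else 0) \<in> borel_measurable borel"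
    by (intro borel_measurable_continuous_on_if) auto
  then show ?thesis
    unfolding grad_map_def[abs_def]
    by (intro borel_measurable_sum borel_measurable_scaleR borel_measurable_directional_deriv) auto
qed

lemma grad_map_eq:
  assumes f: "convex_on D f" and x: "x \<in> interior D" and p: "subgrad D f x = {p}"
  shows "grad_map D f x = p"
proof -
  define f0 where "f0 x = (if x \<in> interior D then f x else 0)" for x
  have f0: "(f0 has_derivative (\<lambda>h. p \<bullet> h)) (at x)"
    by (rule has_derivative_transform_within_open[OF unique_subgrad_has_derivative[OF f x p] open_interior x])
      (simp add: f0_def)
  have "directional_deriv f0 b x = p \<bullet> b" for b
  proof (rule directional_deriv_eq)
    have g: "((\<lambda>t. x + t *\<^sub>R b) has_derivative (\<lambda>t. t *\<^sub>R b)) (at 0)"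
      by (auto intro!: derivative_eq_intros)
    have "((\<lambda>t. f0 (x + t *\<^sub>R b)) has_derivative (\<lambda>t. p \<bullet> (t *\<^sub>R b))) (at 0)"
      by (rule has_derivative_compose[OF g]) (use f0 in simp)
    then show "((\<lambda>t. f0 (x + t *\<^sub>R b)) has_real_derivative p \<bullet> b) (at 0)"
      by (simp add: has_field_derivative_def mult_commute_abs)
  qed
  then show ?thesis
    unfolding grad_map_def f0_def[symmetric] by (simp add: euclidean_representation)
qed

lemma P2_bilinear_integrable:
  assumes M: "P2 M" and L: "linear L"
  shows "integrable M (\<lambda>x. x \<bullet> L x)"
proof -
  obtain K where K: "K > 0" "\<forall>x y. \<bar>x \<bullet> L y\<bar> \<le> K * (norm x * norm y)" using bilinear_bound[OF M M L] by blast
  have s: "sets M = sets borel" and i: "integrable M (\<lambda>x. (norm x)\<^sup>2)" using M by (auto simp: P2_def)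
  note [measurable] = linear_measurable[OF M M L]
  have "(\<lambda>x. x \<bullet> L x) \<in> borel_measurable borel" by measurable
  then have m: "(\<lambda>x. x \<bullet> L x) \<in> borel_measurable M" by (simp add: measurable_cong_sets[OF s refl])
  show ?thesis
  proof (rule Bochner_Integration.integrable_bound[OF _ m])
    show "integrable M (\<lambda>x. K * (norm x)\<^sup>2)" using i by simp
    show "AE x in M. norm (x \<bullet> L x) \<le> norm (K * (norm x)\<^sup>2)"
      using K by (intro AE_I2) (simp add: power2_eq_square)
  qed
qed

lemma P2_transport_plan:
  assumes mu: "P2 \<mu>" and nu: "P2 \<nu>" and a: "transport_plan \<mu> \<nu> \<alpha>"
  shows "P2 \<alpha>"
proof -
  have "integrable \<alpha> (\<lambda>z. (norm z)\<^sup>2) \<longleftrightarrow> integrable \<alpha> (\<lambda>z. (norm (fst z))\<^sup>2 + (norm (snd z))\<^sup>2)"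
    by (intro arg_cong[where f = "integrable \<alpha>"] ext) (simp add: norm_prod_def)
  then show ?thesis
    unfolding P2_def
    using transport_planD(1,2)[OF a] transport_plan_square_integrable[OF mu nu linear_id a] by auto
qed

lemma optimal_plan_iff_maximal_plan:
  fixes \<mu> \<nu> :: "'a::euclidean_space measure"
  assumes mu: "P2 \<mu>" and nu: "P2 \<nu>" and lin: "linear L" "linear G" "linear H"
    and c: "\<And>x y. c x y = (1/2) * (x \<bullet> G x) + (1/2) * (y \<bullet> H y) - x \<bullet> L y"
  shows "optimal_plan c \<mu> \<nu> \<alpha> \<longleftrightarrow> maximal_plan L \<mu> \<nu> \<alpha>"
proof -
  note iG = P2_bilinear_integrable[OF mu lin(2)] and iH = P2_bilinear_integrable[OF nu lin(3)]
  note [measurable] = linear_measurable[OF mu nu lin(2)] linear_measurable[OF mu nu lin(3)]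
  have m: "(\<lambda>x. x \<bullet> G x) \<in> borel_measurable borel" "(\<lambda>x. x \<bullet> H x) \<in> borel_measurable borel"
    by measurable
  have cost: "(\<integral>z. (\<lambda>(x, y). c x y) z \<partial>\<beta>) =
    (1/2) * (\<integral>x. x \<bullet> G x \<partial>\<mu>) + (1/2) * (\<integral>y. y \<bullet> H y \<partial>\<nu>) - (\<integral>z. fst z \<bullet> L (snd z) \<partial>\<beta>)"
    if b: "transport_plan \<mu> \<nu> \<beta>" for \<beta>
  proof -
    have "(\<integral>z. (\<lambda>(x, y). c x y) z \<partial>\<beta>) =
      (\<integral>z. (1/2) * (fst z \<bullet> G (fst z)) + (1/2) * (snd z \<bullet> H (snd z)) - fst z \<bullet> L (snd z) \<partial>\<beta>)"
      by (simp add: case_prod_beta c)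
    also have "\<dots> = (1/2) * (\<integral>z. fst z \<bullet> G (fst z) \<partial>\<beta>) + (1/2) * (\<integral>z. snd z \<bullet> H (snd z) \<partial>\<beta>) - (\<integral>z. fst z \<bullet> L (snd z) \<partial>\<beta>)"
      using transport_plan_integral(3)[OF b m(1)] transport_plan_integral(4)[OF b m(2)] iG iH
        transport_plan_bilinear_integrable[OF mu nu lin(1) b] by simp
    finally show ?thesis
      using transport_plan_integral(1)[OF b m(1)] transport_plan_integral(2)[OF b m(2)] by simp
  qed
  then show ?thesis unfolding optimal_plan_def maximal_plan_def by auto
qed

text \<open>Intended for an arbitrary potential: the plan is already a graph over
  \<open>\<mu>\<close>, so a statement about almost every pair becomes one about almost every
  x.\<close>

lemma AE_subgrad_of_map:
  fixes f :: "real^'n \<Rightarrow> real" and L :: "real^'n \<Rightarrow> real^'n"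
  assumes f: "convex_on D f" and mu: "sets \<mu> = sets borel"
    and hyp: "\<And>E. cc_hypersurface E \<Longrightarrow> emeasure \<mu> E = 0"
    and \<T>: "\<T> \<in> borel_measurable borel"
    and ae: "AE z in distr \<mu> borel (\<lambda>x. (x, \<T> x)). L (snd z) \<in> subgrad D f (fst z)"
  shows "AE x in \<mu>. x \<in> interior D \<and> subgrad D f x = {L (\<T> x)}"
proof -
  have m: "(\<lambda>x. (x, \<T> x)) \<in> measurable \<mu> borel"
    unfolding measurable_cong_sets[OF mu refl] using \<T> by (intro borel_measurable_Pair) auto
  have "AE x in \<mu>. L (\<T> x) \<in> subgrad D f x" using AE_distrD[OF m ae] by simp
  moreover have "AE x in \<mu>. \<forall>p\<in>subgrad D f x. x \<in> interior D \<and> subgrad D f x = {p}"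
    by (rule AE_subgrad_unique[OF f mu hyp])
  ultimately show ?thesis by eventually_elim blast
qed

text \<open>Almost every pair has as first component a point with a single subgradient, which
  determines the second component through \<open>Li\<close>; the plan is then the image of its first
  marginal.\<close>

lemma transport_plan_of_subgrad:
  fixes f :: "real^'n \<Rightarrow> real"
  assumes f: "convex_on D f" and mu: "sets \<mu> = sets borel"
    and hyp: "\<And>E. cc_hypersurface E \<Longrightarrow> emeasure \<mu> E = 0"
    and a: "transport_plan \<mu> \<nu> \<alpha>" and Li: "linear Li" "\<And>y. Li (L y) = y"
    and ae: "AE z in \<alpha>. L (snd z) \<in> subgrad D f (fst z)"
  shows "\<alpha> = distr \<mu> borel (\<lambda>x. (x, Li (grad_map D f x)))"
proof -
  note D = transport_planD[OF a] and ms = transport_plan_measurable[OF a]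
  have "Li \<in> borel_measurable borel"
    using Li(1) linear_continuous_on linear_conv_bounded_linear borel_measurable_continuous_onI by blast
  then have \<T>: "(\<lambda>x. Li (grad_map D f x)) \<in> borel_measurable borel"
    using borel_measurable_grad_map[OF f] by measurable
  have m: "(\<lambda>x. (x, Li (grad_map D f x))) \<in> measurable borel borel"
    using \<T> unfolding borel_prod[symmetric] by measurable
  have "AE x in distr \<alpha> borel fst. \<forall>p\<in>subgrad D f x. x \<in> interior D \<and> subgrad D f x = {p}"
    unfolding D(4) by (rule AE_subgrad_unique[OF f mu hyp])
  from AE_distrD[OF ms(1) this] ae
  have eq: "AE z in \<alpha>. z = (fst z, Li (grad_map D f (fst z)))"
  proof eventually_elim
    case (elim z)
    then have "grad_map D f (fst z) = L (snd z)" by (intro grad_map_eq[OF f]) blast+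
    then show ?case by (simp add: Li(2))
  qed
  have "\<alpha> = distr \<alpha> borel (\<lambda>z. z)" using D(2) by (simp add: distr_id2)
  also have "\<dots> = distr \<alpha> borel (\<lambda>z. (fst z, Li (grad_map D f (fst z))))"
    using measurable_compose[OF ms(1) m] D(2) by (intro distr_cong_AE eq measurable_ident_sets) auto
  also have "\<dots> = distr (distr \<alpha> borel fst) borel (\<lambda>x. (x, Li (grad_map D f x)))"
    by (subst distr_distr[OF m ms(1)]) (simp add: o_def)
  finally show ?thesis unfolding D(4) .
qed

text \<open>Rockafellar's function is built from the supports of all maximal plans together, so
  every one of them equals the same graph plan. Conversely the graph plan is maximal because some
  maximal plan exists and equals it.\<close>

lemma maximal_plan_iff_map:
  fixes \<mu> \<nu> :: "(real^'n) measure"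
  assumes mu: "P2 \<mu>" and nu: "P2 \<nu>" and hyp: "\<And>E. cc_hypersurface E \<Longrightarrow> emeasure \<mu> E = 0"
    and L: "linear L" and Li: "linear Li" "\<And>y. Li (L y) = y"
  shows "\<exists>\<T>\<in>borel_measurable borel. \<forall>\<alpha>. maximal_plan L \<mu> \<nu> \<alpha> \<longleftrightarrow> \<alpha> = distr \<mu> borel (\<lambda>x. (x, \<T> x))"
proof -
  have s: "sets \<mu> = sets borel" using mu by (simp add: P2_def)
  obtain \<alpha>0 where \<alpha>0: "maximal_plan L \<mu> \<nu> \<alpha>0"
    using maximal_bilinear_plan_exists[OF mu nu L] unfolding maximal_plan_def by blast
  have supp: "AE z in \<alpha>. z \<in> plan_support L \<mu> \<nu>" if "maximal_plan L \<mu> \<nu> \<alpha>" for \<alpha>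
  proof -
    have "sets \<alpha> = sets borel" using that transport_planD(2) by (auto simp: maximal_plan_def)
    then have "AE z in \<alpha>. z \<in> msupport \<alpha>" by (rule AE_msupport)
    then show ?thesis by eventually_elim (use that in \<open>auto simp: plan_support_def\<close>)
  qed
  have "plan_support L \<mu> \<nu> \<noteq> {}"
  proof
    assume e: "plan_support L \<mu> \<nu> = {}"
    interpret prob_space \<alpha>0 using \<alpha>0 transport_planD(1) by (auto simp: maximal_plan_def)
    show False using supp[OF \<alpha>0] unfolding e by simp
  qed
  then obtain S where S: "S \<noteq> {}"
    "\<forall>(x, y)\<in>plan_support L \<mu> \<nu>. L y \<in> subgrad (affine_dom S) (affine_sup S) x"
    using Rockafellar[of "plan_support L \<mu> \<nu>" L] plan_support_cyclically_monotone[OF mu nu L] by blast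
  note cvx = convex_on_affine_sup[OF S(1)]
  define \<T> where "\<T> x = Li (grad_map (affine_dom S) (affine_sup S) x)" for x
  have "Li \<in> borel_measurable borel" by (rule linear_measurable[OF mu nu Li(1)])
  then have m: "\<T> \<in> borel_measurable borel"
    unfolding \<T>_def[abs_def] using borel_measurable_grad_map[OF cvx] by measurable
  have eq: "\<alpha> = distr \<mu> borel (\<lambda>x. (x, \<T> x))" if "maximal_plan L \<mu> \<nu> \<alpha>" for \<alpha>
    unfolding \<T>_def
  proof (rule transport_plan_of_subgrad[where L = L, OF cvx s hyp _ Li])
    show "transport_plan \<mu> \<nu> \<alpha>" using that by (simp add: maximal_plan_def)
    show "AE z in \<alpha>. L (snd z) \<in> subgrad (affine_dom S) (affine_sup S) (fst z)"
      using supp[OF that] by eventually_elim (use S(2) in auto)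
  qed
  have "maximal_plan L \<mu> \<nu> \<alpha> \<longleftrightarrow> \<alpha> = distr \<mu> borel (\<lambda>x. (x, \<T> x))" for \<alpha>
    using eq eq[OF \<alpha>0] \<alpha>0 by auto
  with m show ?thesis by blast
qed

section \<open>Kantorovich potentials\<close>

text \<open>Adding x.Gx/2 turns l - c(x, y) into an affine function of x with slope L y, so a
  c-convex function becomes a supremum of affine ones. A pair is in the c-subdifferential when x
  minimizes psi + c(., y), which for this function is the subgradient inequality with slope L
  y.\<close>

lemma c_convex_quadratic:
  fixes c :: "'a::euclidean_space \<Rightarrow> 'a \<Rightarrow> real"
  assumes c: "\<And>x y. c x y = (1/2) * (x \<bullet> G x) + (1/2) * (y \<bullet> H y) - x \<bullet> L y" and psi: "c_convex c \<psi>"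
  shows "\<exists>D f. convex_on D f \<and> (\<forall>x. \<psi> x = (if x \<in> D then ereal (f x - (1/2) * (x \<bullet> G x)) else \<infinity>)) \<and>
    (\<forall>(x, y)\<in>c_subdiff c \<psi>. L y \<in> subgrad D f x)"
proof -
  obtain x0 \<A> where x0: "\<psi> x0 \<noteq> \<infinity>" and \<A>: "\<A> \<noteq> {}" "\<And>x. \<psi> x = (SUP (y, l)\<in>\<A>. ereal (l - c x y))"
    using psi unfolding c_convex_def by blast
  define S where "S = (\<lambda>(y, l). (L y, l - (1/2) * (y \<bullet> H y))) ` \<A>"
  define D where "D = affine_dom S"
  define f where "f = affine_sup S"
  have S: "S \<noteq> {}" using \<A>(1) by (simp add: S_def)
  have cS: "l - c x y = L y \<bullet> x + (l - (1/2) * (y \<bullet> H y)) - (1/2) * (x \<bullet> G x)" for x y l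
    by (simp add: c inner_commute)
  have up: "ereal (l - c x y) \<le> \<psi> x" if "(y, l) \<in> \<A>" for x y l
    unfolding \<A>(2) using SUP_upper[OF that, of "\<lambda>(y, l). ereal (l - c x y)"] by simp
  have psi_le: "\<psi> x \<le> ereal (f x - (1/2) * (x \<bullet> G x))" if x: "x \<in> D" for x
    unfolding \<A>(2)
  proof (rule SUP_least)
    fix w assume w: "w \<in> \<A>"
    obtain y l where yl: "w = (y, l)" by (cases w)
    have "(L y, l - (1/2) * (y \<bullet> H y)) \<in> S" using w yl by (force simp: S_def)
    then have "L y \<bullet> x + (l - (1/2) * (y \<bullet> H y)) \<le> f x"
      using affine_sup_upper x by (simp add: D_def f_def)
    then show "(case w of (y, l) \<Rightarrow> ereal (l - c x y)) \<le> ereal (f x - (1/2) * (x \<bullet> G x))"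
      unfolding yl by (simp add: cS)
  qed
  \<comment> \<open>A real upper bound of \<open>\<psi> x\<close> yields membership in the domain
    and the bound on \<open>f x\<close> together.\<close>
  have psi_ge: "x \<in> D \<and> f x - (1/2) * (x \<bullet> G x) \<le> r" if r: "\<psi> x \<le> ereal r" for x r
  proof -
    have "p \<bullet> x + k \<le> r + (1/2) * (x \<bullet> G x)" if pk: "(p, k) \<in> S" for p k
    proof -
      obtain y l where "(y, l) \<in> \<A>" "p = L y" "k = l - (1/2) * (y \<bullet> H y)" using pk by (auto simp: S_def)
      with order_trans[OF up[of y l x] r] cS[of l x y] show ?thesis by simp
    qed
    from affine_domI[OF this] affine_sup_least[OF S this] show ?thesis unfolding D_def f_def by simp
  qed
  have eq: "\<psi> x = (if x \<in> D then ereal (f x - (1/2) * (x \<bullet> G x)) else \<infinity>)" for x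
  proof (cases "\<psi> x")
    case (real r)
    then show ?thesis using psi_ge[of x r] psi_le[of x] by auto
  next
    case PInf
    then show ?thesis using psi_le[of x] by auto
  next
    case MInf
    obtain y l where "(y, l) \<in> \<A>" using \<A>(1) by auto
    then show ?thesis using up[of y l x] MInf by simp
  qed
  have "L y \<in> subgrad D f x" if xy: "(x, y) \<in> c_subdiff c \<psi>" for x y
  proof -
    have le: "ereal (c x y) + \<psi> x \<le> \<psi> z + ereal (c z y)" for z
      using xy INF_lower[of z UNIV "\<lambda>x. \<psi> x + ereal (c x y)"]
      by (simp add: c_subdiff_def c_transform_def)
    \<comment> \<open>Comparison with a point where \<open>\<psi>\<close> is finite excludes \<psi>
      x = \<infinity>, where the defining equation of the c-subdifferential could hold
      trivially.\<close>
    have "x0 \<in> D" using x0 eq[of x0] by (auto split: if_splits)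
    then have x: "x \<in> D" using le[of x0] by (auto simp: eq split: if_splits)
    have "f x + L y \<bullet> (z - x) \<le> f z" if "z \<in> D" for z
      using le[of z] x that by (simp add: eq c inner_diff_right inner_commute)
    then show ?thesis using x by (simp add: subgrad_def)
  qed
  then have "\<forall>(x, y)\<in>c_subdiff c \<psi>. L y \<in> subgrad D f x" by blast
  moreover have "convex_on D f" unfolding D_def f_def by (rule convex_on_affine_sup[OF S])
  ultimately show ?thesis using eq by blast
qed

section \<open>Differentiability of potentials\<close>

context
  fixes f :: "'a::euclidean_space \<Rightarrow> real" and D G \<psi>
  assumes f: "convex_on D f" and G: "linear G" "\<And>x y. G x \<bullet> y = x \<bullet> G y"
    and \<psi>: "\<And>x. \<psi> x = (if x \<in> D then ereal (f x - (1/2) * (x \<bullet> G x)) else \<infinity>)"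
begin

lemma quadratic_form_has_derivative:
  "((\<lambda>x. (1/2) * (x \<bullet> G x)) has_derivative (\<lambda>h. G x \<bullet> h)) (at x)"
proof -
  have "(G has_derivative G) (at x)" using G(1) by (simp add: linear_conv_bounded_linear bounded_linear_imp_has_derivative)
  then have "((\<lambda>x. (1/2) * (x \<bullet> G x)) has_derivative (\<lambda>h. (1/2) * (x \<bullet> G h + h \<bullet> G x))) (at x)"
    by (intro has_derivative_mult_right has_derivative_inner has_derivative_ident)
  moreover have "(1/2) * (x \<bullet> G h + h \<bullet> G x) = G x \<bullet> h" for h
    by (simp add: G(2)[of x h] inner_commute[of h])
  ultimately show ?thesis by simp
qed

text \<open>Finiteness of \<open>\<psi>\<close> near x corresponds to interior points of the domain,
  and differentiability of a convex function there to a single subgradient. In particular the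
  gradient is unique, so the choice in \<open>ereal_grad\<close> is determined.\<close>

lemma ereal_has_grad_iff:
  "ereal_has_grad \<psi> x g \<longleftrightarrow> x \<in> interior D \<and> subgrad D f x = {g + G x}"
proof
  assume x: "x \<in> interior D \<and> subgrad D f x = {g + G x}"
  have "((\<lambda>x. f x - (1/2) * (x \<bullet> G x)) has_derivative (\<lambda>h. (g + G x) \<bullet> h - G x \<bullet> h)) (at x)"
    using x by (intro has_derivative_diff unique_subgrad_has_derivative[OF f] quadratic_form_has_derivative) auto
  moreover have "\<forall>\<^sub>F z in nhds x. z \<in> interior D" using x by (intro eventually_nhds_in_open) auto
  then have "\<forall>\<^sub>F z in nhds x. \<psi> z = ereal (f z - (1/2) * (z \<bullet> G z))"
    by eventually_elim (use interior_subset in \<open>auto simp: \<psi>\<close>)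
  ultimately show "ereal_has_grad \<psi> x g"
    unfolding ereal_has_grad_def by (intro exI[of _ "\<lambda>x. f x - (1/2) * (x \<bullet> G x)"]) (simp add: inner_add_left)
next
  assume "ereal_has_grad \<psi> x g"
  then obtain \<phi> where ev: "\<forall>\<^sub>F z in nhds x. \<psi> z = ereal (\<phi> z)" and \<phi>: "(\<phi> has_derivative (\<lambda>h. g \<bullet> h)) (at x)"
    unfolding ereal_has_grad_def by blast
  obtain U where U: "open U" "x \<in> U" "\<And>z. z \<in> U \<Longrightarrow> \<psi> z = ereal (\<phi> z)"
    using ev unfolding eventually_nhds by blast
  have UD: "z \<in> D \<and> \<phi> z + (1/2) * (z \<bullet> G z) = f z" if "z \<in> U" for z
    using U(3)[OF that] by (auto simp: \<psi> split: if_splits)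
  then have x: "x \<in> interior D" using U by (meson interiorI subsetI)
  have "((\<lambda>z. \<phi> z + (1/2) * (z \<bullet> G z)) has_derivative (\<lambda>h. g \<bullet> h + G x \<bullet> h)) (at x)"
    by (intro has_derivative_add \<phi> quadratic_form_has_derivative)
  then have "(f has_derivative (\<lambda>h. g \<bullet> h + G x \<bullet> h)) (at x)"
    by (rule has_derivative_transform_within_open[OF _ U(1,2)]) (use UD in blast)
  then have "(f has_derivative (\<lambda>h. (g + G x) \<bullet> h)) (at x)" by (simp add: inner_add_left)
  then have "subgrad D f x = {g + G x}"
    using subgrad_unique_if_has_derivative[OF x] subgrad_interior_nonempty[OF f x] by blast
  then show "x \<in> interior D \<and> subgrad D f x = {g + G x}" using x by blast
qed

lemma ereal_grad_eq:
  assumes "x \<in> interior D" "subgrad D f x = {p}"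
  shows "ereal_differentiable_at \<psi> x" "ereal_grad \<psi> x = p - G x"
proof -
  have g: "ereal_has_grad \<psi> x (p - G x)" using assms by (simp add: ereal_has_grad_iff)
  then show "ereal_differentiable_at \<psi> x" by (auto simp: ereal_differentiable_at_def)
  show "ereal_grad \<psi> x = p - G x"
    unfolding ereal_grad_def
    by (rule some_equality[where P = "ereal_has_grad \<psi> x", OF g]) (use assms in \<open>auto simp: ereal_has_grad_iff\<close>)
qed

lemma ereal_differentiableD:
  assumes "ereal_differentiable_at \<psi> x"
  obtains p where "x \<in> interior D" "subgrad D f x = {p}"
  using assms unfolding ereal_differentiable_at_def ereal_has_grad_iff by blast

end

text \<open>The quadratic form of \<open>G\<close> is its own second order expansion, so subtracting
  it changes the Hessian from M to M - G and leaves the error term unchanged.\<close>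

lemma ereal_twice_differentiableI:
  fixes f :: "real^'n \<Rightarrow> real"
  assumes f: "convex_on D f" and G: "linear G" "\<And>x y. G x \<bullet> y = x \<bullet> G y"
    and \<psi>: "\<And>x. \<psi> x = (if x \<in> D then ereal (f x - (1/2) * (x \<bullet> G x)) else \<infinity>)"
    and x: "x \<in> interior D" "subgrad D f x = {p}" and M: "linear M"
    and exp: "\<And>e. e > 0 \<Longrightarrow> \<exists>d>0. \<forall>y\<in>ball x d. \<forall>q\<in>subgrad D f y. norm (q - p - M (y - x)) \<le> e * norm (y - x)"
  shows "ereal_twice_differentiable_at \<psi> x"
proof -
  define F where "F x = f x - (1/2) * (x \<bullet> G x)" for x
  have ev: "\<forall>\<^sub>F z in nhds x. \<psi> z = ereal (F z)"
  proof -
    have "\<forall>\<^sub>F z in nhds x. z \<in> interior D" using x by (intro eventually_nhds_in_open) auto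
    then show ?thesis by eventually_elim (use interior_subset in \<open>auto simp: \<psi> F_def\<close>)
  qed
  have "((\<lambda>x. f x - (1/2) * (x \<bullet> G x)) has_derivative (\<lambda>h. p \<bullet> h - G x \<bullet> h)) (at x)"
    by (intro has_derivative_diff unique_subgrad_has_derivative[OF f x] quadratic_form_has_derivative[OF f G \<psi>])
  then have der: "(F has_derivative (\<lambda>h. (p - G x) \<bullet> h)) (at x)" by (simp add: F_def[abs_def] inner_diff_left)
  define H where "H = matrix (\<lambda>h. M h - G h)"
  have H: "H *v h = M h - G h" for h
    unfolding H_def by (rule matrix_works) (unfold linear_matrix_vector_mul_eq, intro linear_compose_sub M G(1))
  have "((\<lambda>y. (F y - F x - (p - G x) \<bullet> (y - x) - (1/2) * ((y - x) \<bullet> (H *v (y - x)))) / (norm (y - x))\<^sup>2) \<longlongrightarrow> 0) (at x)"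
    unfolding LIM_eq
  proof (intro allI impI)
    fix r :: real assume r: "0 < r"
    then have r2: "r/2 > 0" by simp
    obtain d where d: "d > 0" "\<And>y. y \<in> ball x d \<Longrightarrow>
        \<bar>f y - f x - p \<bullet> (y - x) - (1/2) * ((y - x) \<bullet> M (y - x))\<bar> \<le> (r/2) * (norm (y - x))\<^sup>2"
      using taylor2_of_subgrad_derivative[OF f x(1) M exp r2] by blast
    have "norm ((F y - F x - (p - G x) \<bullet> (y - x) - (1/2) * ((y - x) \<bullet> (H *v (y - x)))) / (norm (y - x))\<^sup>2 - 0) < r"
      if y: "y \<noteq> x" "norm (y - x) < d" for y
    proof -
      define h where "h = y - x"
      have "G y = G x + G h" using linear_add[OF G(1), of x h] by (simp add: h_def)
      moreover have "y = x + h" by (simp add: h_def)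
      ultimately have "y \<bullet> G y = x \<bullet> G x + x \<bullet> G h + h \<bullet> G x + h \<bullet> G h"
        by (simp add: inner_add_left inner_add_right)
      then have "y \<bullet> G y = x \<bullet> G x + 2 * (G x \<bullet> h) + h \<bullet> G h"
        using G(2)[of x h] inner_commute[of h "G x"] by linarith
      then have "F y - F x - (p - G x) \<bullet> h - (1/2) * (h \<bullet> (H *v h)) = f y - f x - p \<bullet> h - (1/2) * (h \<bullet> M h)"
        unfolding F_def H inner_diff_left inner_diff_right by (simp add: right_diff_distrib distrib_left)
      then have eq: "F y - F x - (p - G x) \<bullet> (y - x) - (1/2) * ((y - x) \<bullet> (H *v (y - x))) =
        f y - f x - p \<bullet> (y - x) - (1/2) * ((y - x) \<bullet> M (y - x))" unfolding h_def .
      have "y \<in> ball x d" using y by (simp add: dist_norm norm_minus_commute)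
      then have "\<bar>f y - f x - p \<bullet> (y - x) - (1/2) * ((y - x) \<bullet> M (y - x))\<bar> / (norm (y - x))\<^sup>2 \<le> r/2"
        using d(2)[of y] y by (simp add: divide_le_eq)
      then show ?thesis
        unfolding eq diff_zero real_norm_def abs_divide abs_power2 using r by linarith
    qed
    then show "\<exists>s>0. \<forall>y. y \<noteq> x \<and> norm (y - x) < s \<longrightarrow>
      norm ((F y - F x - (p - G x) \<bullet> (y - x) - (1/2) * ((y - x) \<bullet> (H *v (y - x)))) / (norm (y - x))\<^sup>2 - 0) < r"
      using d(1) by blast
  qed
  then show ?thesis unfolding ereal_twice_differentiable_at_def using ev der by blast
qed

theorem theorem3p12:
  fixes A :: "real^'n^'n" and B :: "real^'m^'n" and Q :: "real^'n^'n" and T :: real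
    and \<mu> \<nu> :: "(real^'n) measure"
  assumes rankB: "rank B = CARD('m)"
    and Qsym: "transpose Q = Q"
    and Tpos: "T > 0"
    and kalman: "kalman_condition A B"
    and Tconj: "ereal T < first_conj_time A B Q"
    and mu: "P2 \<mu>" and nu: "P2 \<nu>"
    and hyp: "\<forall>E. cc_hypersurface E \<longrightarrow> emeasure \<mu> E = 0"
  shows "(\<exists>!\<alpha>. optimal_plan (LQ_cost A B Q 0 T) \<mu> \<nu> \<alpha>) \<and>
    (\<forall>\<alpha>. optimal_plan (LQ_cost A B Q 0 T) \<mu> \<nu> \<alpha> \<longrightarrow>
       P2 \<alpha> \<and>
       (\<exists>\<T> :: real^'n \<Rightarrow> real^'n. \<T> \<in> borel_measurable borel \<and>
          \<alpha> = distr \<mu> borel (\<lambda>x. (x, \<T> x)) \<and>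
          (\<forall>\<psi>. kantorovich_potential (LQ_cost A B Q 0 T) \<alpha> \<psi> \<longrightarrow>
             (AE x in \<mu>. ereal_differentiable_at \<psi> x) \<and>
             (AE x in \<mu>. \<T> x = LQ_exp A B Q x T (ereal_grad \<psi> x)) \<and>
             (absolutely_continuous lborel \<mu> \<longrightarrow>
                (AE x in \<mu>. ereal_twice_differentiable_at \<psi> x) \<and>
                (AE x in \<mu>. ereal_differentiable_at \<psi> x \<and>
                   (\<exists>L. ((\<lambda>y. LQ_exp A B Q y T (ereal_grad \<psi> y)) has_derivative L)
                          (at x within {y. ereal_differentiable_at \<psi> y})))))))"
proof -
  obtain E Ei M G H where lin: "linear E" "linear Ei" "linear M" "linear G" "linear H"
    and EiE: "\<And>y. Ei (E y) = y" and GE: "\<And>x. G x = E (M x)" and Gsym: "\<And>x y. G x \<bullet> y = x \<bullet> G y"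
    and c: "\<And>x y. LQ_cost A B Q 0 T x y = (1/2) * (x \<bullet> G x) + (1/2) * (y \<bullet> H y) - x \<bullet> E y"
    and exp: "\<And>x p. LQ_exp A B Q x T p = Ei p + M x"
    using LQ_cost_quadratic[OF Qsym Tpos Tconj] by blast
  note opt = optimal_plan_iff_maximal_plan[OF mu nu lin(1,4,5) c]
  have s: "sets \<mu> = sets borel" using mu by (simp add: P2_def)
  have null: "emeasure \<mu> Z = 0" if "cc_hypersurface Z" for Z using hyp that by blast
  obtain \<T> where \<T>: "\<T> \<in> borel_measurable borel"
    "\<And>\<alpha>. maximal_plan E \<mu> \<nu> \<alpha> \<longleftrightarrow> \<alpha> = distr \<mu> borel (\<lambda>x. (x, \<T> x))"
    using maximal_plan_iff_map[OF mu nu null lin(1,2) EiE] by blast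
  \<comment> \<open>The potential is arbitrary, and its convex function need not be the one from
    which \<open>\<T>\<close> was built. Since the plan is already the graph of \<open>\<T>\<close>,
    the only subgradient at almost every x is again E (\<T> x).\<close>
  have pot: "(AE x in \<mu>. ereal_differentiable_at \<psi> x) \<and>
     (AE x in \<mu>. \<T> x = LQ_exp A B Q x T (ereal_grad \<psi> x)) \<and>
     (absolutely_continuous lborel \<mu> \<longrightarrow>
        (AE x in \<mu>. ereal_twice_differentiable_at \<psi> x) \<and>
        (AE x in \<mu>. ereal_differentiable_at \<psi> x \<and>
           (\<exists>L. ((\<lambda>y. LQ_exp A B Q y T (ereal_grad \<psi> y)) has_derivative L)
                  (at x within {y. ereal_differentiable_at \<psi> y}))))"
    if K: "kantorovich_potential (LQ_cost A B Q 0 T) (distr \<mu> borel (\<lambda>x. (x, \<T> x))) \<psi>" for \<psi>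
  proof -
    obtain D f where f: "convex_on D f"
      and \<psi>: "\<And>x. \<psi> x = (if x \<in> D then ereal (f x - (1/2) * (x \<bullet> G x)) else \<infinity>)"
      and sub: "\<forall>(x, y)\<in>c_subdiff (LQ_cost A B Q 0 T) \<psi>. E y \<in> subgrad D f x"
      using c_convex_quadratic[OF c] K unfolding kantorovich_potential_def by blast
    note grad = ereal_grad_eq[OF f lin(4) Gsym \<psi>] and diffD = ereal_differentiableD[OF f lin(4) Gsym \<psi>]
    have "AE z in distr \<mu> borel (\<lambda>x. (x, \<T> x)). z \<in> c_subdiff (LQ_cost A B Q 0 T) \<psi>"
      using K by (simp add: kantorovich_potential_def)
    then have "AE z in distr \<mu> borel (\<lambda>x. (x, \<T> x)). E (snd z) \<in> subgrad D f (fst z)"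
      by eventually_elim (use sub in auto)
    from AE_subgrad_of_map[OF f s null \<T>(1) this]
    have ae: "AE x in \<mu>. x \<in> interior D \<and> subgrad D f x = {E (\<T> x)}" .
    \<comment> \<open>The gradient of \<open>\<psi>\<close> is p - G x, and G = E M; thus Ei (G x)
      cancels the term M x of the exponential map.\<close>
    have exp_grad: "LQ_exp A B Q x T (ereal_grad \<psi> x) = Ei p"
      if "x \<in> interior D" "subgrad D f x = {p}" for x p
      unfolding exp grad(2)[OF that] by (simp add: linear_diff[OF lin(2)] GE EiE)
    have 1: "AE x in \<mu>. ereal_differentiable_at \<psi> x" using ae by eventually_elim (use grad(1) in blast)
    have 2: "AE x in \<mu>. \<T> x = LQ_exp A B Q x T (ereal_grad \<psi> x)"
      using ae by eventually_elim (simp add: exp_grad EiE)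
    have 3: "(AE x in \<mu>. ereal_twice_differentiable_at \<psi> x) \<and>
        (AE x in \<mu>. ereal_differentiable_at \<psi> x \<and>
           (\<exists>L. ((\<lambda>y. LQ_exp A B Q y T (ereal_grad \<psi> y)) has_derivative L)
                  (at x within {y. ereal_differentiable_at \<psi> y})))"
      if ac: "absolutely_continuous lborel \<mu>"
    proof -
      obtain N where N: "negligible N" "\<forall>x\<in>interior D - N. \<exists>p M. linear M \<and> subgrad D f x = {p} \<and>
          (\<forall>e>0. \<exists>d>0. \<forall>y\<in>ball x d. \<forall>q\<in>subgrad D f y. norm (q - p - M (y - x)) \<le> e * norm (y - x))"
        using subgrad_differentiable_AE[OF f] by blast
      \<comment> \<open>A Lebesgue null set need not be Borel; it is enlarged to a null set of
        \<open>lborel\<close>, to which absolute continuity refers.\<close>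
      obtain N' where N': "N' \<in> null_sets lborel" "N \<subseteq> N'"
        using N(1) unfolding negligible_iff_null_sets null_sets_completion_iff2 by blast
      have "N' \<in> null_sets \<mu>" using ac N'(1) by (auto simp: absolutely_continuous_def)
      then have "AE x in \<mu>. x \<notin> N'" by (rule AE_not_in)
      then have "AE x in \<mu>. x \<in> interior D - N" using ae by eventually_elim (use N'(2) in blast)
      then have "AE x in \<mu>. ereal_twice_differentiable_at \<psi> x \<and> ereal_differentiable_at \<psi> x \<and>
           (\<exists>L. ((\<lambda>y. LQ_exp A B Q y T (ereal_grad \<psi> y)) has_derivative L)
                  (at x within {y. ereal_differentiable_at \<psi> y}))"
      proof eventually_elim
        case (elim x)
        then have x: "x \<in> interior D" by blast
        obtain p R where R: "linear R" and p: "subgrad D f x = {p}"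
          and ex: "\<And>e. e > 0 \<Longrightarrow> \<exists>d>0. \<forall>y\<in>ball x d. \<forall>q\<in>subgrad D f y. norm (q - p - R (y - x)) \<le> e * norm (y - x)"
          using N(2) elim by blast
        obtain K where K: "K > 0" "\<And>y. norm (Ei y) \<le> norm y * K"
          using bounded_linear.pos_bounded lin(2) linear_conv_bounded_linear by blast
        \<comment> \<open>At the comparison points \<open>\<psi>\<close> is differentiable, so the
          exponential map of its gradient is \<open>Ei\<close> of the unique subgradient, and the
          first order expansion of the subgradients carries over.\<close>
        have "((\<lambda>y. LQ_exp A B Q y T (ereal_grad \<psi> y)) has_derivative (\<lambda>h. Ei (R h)))
            (at x within {y. ereal_differentiable_at \<psi> y})"
          unfolding has_derivative_within_alt
        proof (intro conjI allI impI)
          show "bounded_linear (\<lambda>h. Ei (R h))"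
            using linear_compose[OF R lin(2)] by (simp add: o_def linear_conv_bounded_linear)
          fix e :: real assume "e > 0"
          then have "e / K > 0" using K(1) by simp
          then obtain d where d: "d > 0" "\<And>y q. y \<in> ball x d \<Longrightarrow> q \<in> subgrad D f y \<Longrightarrow> norm (q - p - R (y - x)) \<le> (e / K) * norm (y - x)"
            using ex by blast
          have "norm (LQ_exp A B Q y T (ereal_grad \<psi> y) - LQ_exp A B Q x T (ereal_grad \<psi> x) - Ei (R (y - x)))
              \<le> e * norm (y - x)" if y: "ereal_differentiable_at \<psi> y" "norm (y - x) < d" for y
          proof -
            obtain q where q: "y \<in> interior D" "subgrad D f y = {q}" using diffD[OF y(1)] by blast
            have "norm (Ei (q - p - R (y - x))) \<le> norm (q - p - R (y - x)) * K" by (rule K(2))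
            also have "\<dots> \<le> ((e / K) * norm (y - x)) * K"
              using q y(2) K(1) by (intro mult_right_mono d(2)) (auto simp: dist_norm norm_minus_commute)
            finally show ?thesis
              using K(1) by (simp add: exp_grad[OF x p] exp_grad[OF q] linear_diff[OF lin(2)])
          qed
          then show "\<exists>d>0. \<forall>y\<in>{y. ereal_differentiable_at \<psi> y}. norm (y - x) < d \<longrightarrow>
            norm (LQ_exp A B Q y T (ereal_grad \<psi> y) - LQ_exp A B Q x T (ereal_grad \<psi> x) - Ei (R (y - x)))
              \<le> e * norm (y - x)" using d(1) by blast
        qed
        then show ?case
          using ereal_twice_differentiableI[OF f lin(4) Gsym \<psi> x p R ex] grad(1)[OF x p] by blast
      qed
      then show ?thesis by auto
    qed
    show ?thesis using 1 2 3 by blast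
  qed
  show ?thesis
  proof (intro conjI allI impI)
    show "\<exists>!\<alpha>. optimal_plan (LQ_cost A B Q 0 T) \<mu> \<nu> \<alpha>" unfolding opt \<T>(2) by blast
    fix \<alpha> assume opt\<alpha>: "optimal_plan (LQ_cost A B Q 0 T) \<mu> \<nu> \<alpha>"
    then show "P2 \<alpha>" using P2_transport_plan[OF mu nu] by (simp add: optimal_plan_def)
    have eq: "\<alpha> = distr \<mu> borel (\<lambda>x. (x, \<T> x))" using opt\<alpha> unfolding opt \<T>(2) .
    show "\<exists>\<T> :: real^'n \<Rightarrow> real^'n. \<T> \<in> borel_measurable borel \<and>
          \<alpha> = distr \<mu> borel (\<lambda>x. (x, \<T> x)) \<and>
          (\<forall>\<psi>. kantorovich_potential (LQ_cost A B Q 0 T) \<alpha> \<psi> \<longrightarrow>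
             (AE x in \<mu>. ereal_differentiable_at \<psi> x) \<and>
             (AE x in \<mu>. \<T> x = LQ_exp A B Q x T (ereal_grad \<psi> x)) \<and>
             (absolutely_continuous lborel \<mu> \<longrightarrow>
                (AE x in \<mu>. ereal_twice_differentiable_at \<psi> x) \<and>
                (AE x in \<mu>. ereal_differentiable_at \<psi> x \<and>
                   (\<exists>L. ((\<lambda>y. LQ_exp A B Q y T (ereal_grad \<psi> y)) has_derivative L)
                          (at x within {y. ereal_differentiable_at \<psi> y})))))"
      unfolding eq
      by (rule exI[of _ \<T>], rule conjI[OF \<T>(1)], rule conjI[OF refl], intro allI impI, rule pot)
  qed
qed

end
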